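(* Fix $\beta>0$, $\beta'=\beta/2$, $\theta\ge1$, and let $(\lambda_1,\dots,\lambda_n)\in(0,\infty)^n$ be distributed according to the Laguerre $\beta$-ensemble density $\mathbf P^L_{n,\beta}$ of parameter $\theta$ (see context). Let $$Y^L_{n,\beta}=\log\mathbf P^L_{n,\beta}(\lambda_1,\dots,\lambda_n)+nE^L_\beta,$$ where $E^L_\beta=E^H_\beta+\mathcal S(H)-\mathcal S(L)$ (see context). Then the sequence $\left(n^{-1/3}Y^L_{n,\beta}\right)_n$ converges mod-Gaussian on the strip $S_1=\{z\in\mathbb C:\Re z>-1\}$, as $n\to\infty$, with parameters $t_n^\beta=n^{1/3}\sigma_\beta^2$ and limiting function $$\psi^\beta(z)=e^{-A_\beta z^3/6},$$ where $$\sigma_\beta^2=\beta'-\beta'^2\,\ell''(1+\beta'),\qquad A_\beta=\beta'^3\,\ell'''(1+\beta')+\beta'.$$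
   Context: Laguerre ensemble of parameter $\theta\ge1$: with $L(x)=\theta x-(\theta-1)\log x$, $x>0$, $$\mathbf P^L_{n,\beta}(\lambda_1,\dots,\lambda_n)=\frac1{\mathcal Z^L_n(\beta)}\prod_{1\le j<k\le n}|\lambda_k-\lambda_j|^\beta\prod_{k=1}^ne^{-\frac\beta2nL(\lambda_k)}$$ with respect to Lebesgue measure on $(0,\infty)^n$, $\mathcal Z_n^L(\beta)$ being the normalizing constant. $\ell(x)=\log\Gamma(x)$, $\Psi=\ell'$ is the digamma function. Constants: $E^H_\beta=\log2\pi-\frac12-\beta'+\beta'\Psi(1+\beta')-\ell(1+\beta')$; $\mathcal S(H)=\int\rho_H\log\rho_H\,dx$ and $\mathcal S(L)=\int\rho_L\log\rho_L\,dx$, where $\rho_H(x)=\frac1{2\pi}\sqrt{4-x^2}$ on $[-2,2]$ and $\rho_L(x)=\theta\frac{\sqrt{(c_+-x)(x-c_-)}}{2\pi x}$ on $[c_-,c_+]$, $c_\pm=\frac{(1\pm\sqrt\theta)^2}\theta$. Explicitly, $\mathcal S(H)=\frac12-\log2\pi$ and $\mathcal S(L)=1-\log2\pi+\frac{\theta-1}2\log(\theta-1)-\frac{\theta-2}2\log\theta$ (with $0\log0=0$). Mod-Gaussian convergence: for $-\infty\le c<0<d\le\infty$ let $S_{(c,d)}=\{z\in\mathbb C:c<\Re z<d\}$. Real random variables $(X_n)$ whose moment generating functions $\mathbb E[e^{zX_n}]$ exist on $S_{(c,d)}$ converge mod-Gaussian on $S_{(c,d)}$ with parameters $t_n\to\infty$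 and limiting function $\psi$ if $\psi$ is analytic on $S_{(c,d)}$, does not vanish on the real part of $S_{(c,d)}$, and $\mathbb E[e^{zX_n}]e^{-t_nz^2/2}\to\psi(z)$ locally uniformly on $S_{(c,d)}$. The strip $S_1$ is $S_{(-1,\infty)}$. *)

theory Defs
  imports "HOL-Probability.Probability" "HOL-Complex_Analysis.Complex_Analysis"
begin

section \<open>Mod-Gaussian convergence\<close>

definition strip :: "ereal \<Rightarrow> ereal \<Rightarrow> complex set" where
  "strip c d = {z. c < ereal (Re z) \<and> ereal (Re z) < d}"

definition mgf :: "'a measure \<Rightarrow> ('a \<Rightarrow> real) \<Rightarrow> complex \<Rightarrow> complex" where
  "mgf M X z = (LINT \<omega>|M. exp (z * of_real (X \<omega>)))"

definition mgf_exists :: "'a measure \<Rightarrow> ('a \<Rightarrow> real) \<Rightarrow> complex \<Rightarrow> bool" where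
  "mgf_exists M X z \<longleftrightarrow> integrable M (\<lambda>\<omega>. exp (z * of_real (X \<omega>)))"

definition locally_uniform_limit ::
    "complex set \<Rightarrow> (nat \<Rightarrow> complex \<Rightarrow> complex) \<Rightarrow> (complex \<Rightarrow> complex) \<Rightarrow> bool" where
  "locally_uniform_limit S f g \<longleftrightarrow>
     (\<forall>z\<in>S. \<exists>r>0. uniform_limit (S \<inter> ball z r) f g sequentially)"

text \<open>
  Sequences of random variables are indexed by \<open>n \<ge> 1\<close>; the entries at \<open>0\<close> are
  unconstrained.  The probability space may depend on \<open>n\<close>.
\<close>

definition mod_Gaussian_convergent ::
    "(nat \<Rightarrow> 'a measure) \<Rightarrow> (nat \<Rightarrow> 'a \<Rightarrow> real) \<Rightarrow> ereal \<Rightarrow> ereal \<Rightarrow>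
     (nat \<Rightarrow> real) \<Rightarrow> (complex \<Rightarrow> complex) \<Rightarrow> bool" where
  "mod_Gaussian_convergent M X c d t \<psi> \<longleftrightarrow>
     c < 0 \<and> 0 < d \<and>
     (\<forall>n\<ge>1. prob_space (M n) \<and> X n \<in> borel_measurable (M n) \<and>
        (\<forall>z\<in>strip c d. mgf_exists (M n) (X n) z)) \<and>
     filterlim t at_top sequentially \<and>
     \<psi> analytic_on strip c d \<and>
     (\<forall>x::real. of_real x \<in> strip c d \<longrightarrow> \<psi> (of_real x) \<noteq> 0) \<and>
     locally_uniform_limit (strip c d)
       (\<lambda>n z. mgf (M n) (X n) z * exp (- (of_real (t n) * z\<^sup>2 / 2))) \<psi>"


section \<open>The Laguerre ensemble\<close>

text \<open>
  Points of \<open>(0,\<infinity>)\<^sup>n\<close> are extensional functions on \<open>{1..n}\<close>; the following is Lebesgue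
  measure on that set.
\<close>

definition pos_lebesgue :: "nat \<Rightarrow> (nat \<Rightarrow> real) measure" where
  "pos_lebesgue n =
     restrict_space (\<Pi>\<^sub>M i\<in>{1..n}. lborel) (\<Pi>\<^sub>E i\<in>{1..n}. {0<..})"

definition L_pot :: "real \<Rightarrow> real \<Rightarrow> real" where
  "L_pot \<theta> x = \<theta> * x - (\<theta> - 1) * ln x"

definition laguerre_weight :: "real \<Rightarrow> nat \<Rightarrow> real \<Rightarrow> (nat \<Rightarrow> real) \<Rightarrow> real" where
  "laguerre_weight \<theta> n \<beta> l =
     (\<Prod>(j, k)\<in>{(j, k). 1 \<le> j \<and> j < k \<and> k \<le> n}. \<bar>l k - l j\<bar> powr \<beta>) *
     (\<Prod>k=1..n. exp (- (\<beta> / 2) * real n * L_pot \<theta> (l k)))"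

definition laguerre_Z :: "real \<Rightarrow> nat \<Rightarrow> real \<Rightarrow> real" where
  "laguerre_Z \<theta> n \<beta> = (LINT l|pos_lebesgue n. laguerre_weight \<theta> n \<beta> l)"

definition laguerre_density :: "real \<Rightarrow> nat \<Rightarrow> real \<Rightarrow> (nat \<Rightarrow> real) \<Rightarrow> real" where
  "laguerre_density \<theta> n \<beta> l = laguerre_weight \<theta> n \<beta> l / laguerre_Z \<theta> n \<beta>"


section \<open>Constants\<close>

definition ell :: "real \<Rightarrow> real" where
  "ell x = ln (Gamma x)"

definition \<rho>_H :: "real \<Rightarrow> real" where
  "\<rho>_H x = 1 / (2 * pi) * sqrt (4 - x\<^sup>2)"

definition S_H :: real where
  "S_H = (LINT x:{-2..2}|lborel. \<rho>_H x * ln (\<rho>_H x))"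

definition c_plus :: "real \<Rightarrow> real" where
  "c_plus \<theta> = (1 + sqrt \<theta>)\<^sup>2 / \<theta>"

definition c_minus :: "real \<Rightarrow> real" where
  "c_minus \<theta> = (1 - sqrt \<theta>)\<^sup>2 / \<theta>"

definition \<rho>_L :: "real \<Rightarrow> real \<Rightarrow> real" where
  "\<rho>_L \<theta> x = \<theta> * (sqrt ((c_plus \<theta> - x) * (x - c_minus \<theta>)) / (2 * pi * x))"

definition S_L :: "real \<Rightarrow> real" where
  "S_L \<theta> = (LINT x:{c_minus \<theta>..c_plus \<theta>}|lborel. \<rho>_L \<theta> x * ln (\<rho>_L \<theta> x))"

definition E_H :: "real \<Rightarrow> real" where
  "E_H \<beta> = ln (2 * pi) - 1 / 2 - \<beta> / 2 + \<beta> / 2 * Digamma (1 + \<beta> / 2) - ell (1 + \<beta> / 2)"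

definition E_L :: "real \<Rightarrow> real \<Rightarrow> real" where
  "E_L \<theta> \<beta> = E_H \<beta> + S_H - S_L \<theta>"

definition sigma_sq :: "real \<Rightarrow> real" where
  "sigma_sq \<beta> = \<beta> / 2 - (\<beta> / 2)\<^sup>2 * (deriv ^^ 2) ell (1 + \<beta> / 2)"

definition A_const :: "real \<Rightarrow> real" where
  "A_const \<beta> = (\<beta> / 2) ^ 3 * (deriv ^^ 3) ell (1 + \<beta> / 2) + \<beta> / 2"

definition Y_L :: "real \<Rightarrow> nat \<Rightarrow> real \<Rightarrow> (nat \<Rightarrow> real) \<Rightarrow> real" where
  "Y_L \<theta> n \<beta> l = ln (laguerre_density \<theta> n \<beta> l) + real n * E_L \<theta> \<beta>"

end

theory Submission
  imports Defs "HOL-Real_Asymp.Real_Asymp"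
begin

text \<open>
  Write \<open>b = \<beta> / 2\<close>.  The inverse temperature enters the unnormalised Laguerre weight only as an exponent:
  raising the weight to the power \<open>x\<close> replaces \<open>\<beta>\<close> by \<open>\<beta> x\<close>.  Hence, with \<open>s = z n\<^sup>-\<^sup>1\<^sup>/\<^sup>3\<close>, the moment
  generating function at \<open>z\<close> is \<open>exp (ln Z(\<beta>(1+s)) - (1+s) ln Z(\<beta>) + s n E)\<close>, where \<open>Z\<close> is the partition
  function, and the statement concerns the expansion of \<open>ln Z\<close> around one inverse temperature in a complex
  neighbourhood whose radius is of order \<open>n\<close> to the power \<open>-1/3\<close>.

  The partition function is a product of Gamma values (\<open>selberg_laguerre\<close>).  Three facts give this.
  Aomoto's integration by parts yields \<open>S(a+1) / S(a)\<close> for the integral \<open>S(a)\<close> with Laguerre parameter \<open>a\<close>.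
  Since \<open>S\<close> is log-convex in \<open>a\<close>, the Bohr-Mollerup argument shows that \<open>S\<close> is a constant multiple of the
  product of Gamma values with the same quotients.  The constant is found by induction on the number
  of particles: at \<open>a = 1\<close> the weight is \<open>exp (- b \<Sum>x\<^sub>i)\<close> times differences, so splitting off the smallest
  particle and translating the others gives \<open>S(1)\<close> for \<open>n\<close> particles as \<open>S(1 + 2g) / b\<close> for \<open>n - 1\<close> particles.
  The integration by parts is only done for exponents \<open>2g > 1\<close>, where no singularity occurs; both sides are
  holomorphic in the inverse temperature, so the identity theorem extends it to all complex ones with
  positive real part (\<open>complex_partition_eq\<close>).

  Let \<open>G\<close> be the resulting logarithm of the partition function as a function of \<open>x\<close>, the factor by
  which the inverse temperature is multiplied.  The expansion
  \<open>\<psi>'(1+w) = 1/w - 1/(2w\<^sup>2) + O(1/(Re w)\<^sup>3)\<close> in the right half-plane shows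
  \<open>G''(x) = n h(x) + O(ln n)\<close> uniformly near \<open>x = 1\<close>, with \<open>h(x) = b/x - b\<^sup>2 \<psi>'(1 + b x)\<close>: the contributions of
  order \<open>n\<^sup>2\<close> cancel (\<open>log_partition_curvature\<close>).  Here \<open>h(1)\<close> is the variance constant and \<open>-h'(1)\<close> is the
  constant \<open>A\<close>.  Integrating twice, the terms of order two and three in \<open>s\<close> are as claimed, and the error is
  \<open>|s|\<^sup>2 (O(ln n) + n O(|s|\<^sup>2))\<close>, which vanishes for \<open>s\<close> of order \<open>n\<close> to the power \<open>-1/3\<close>.

  The linear term needs \<open>G'(1) - G(1) + n E = O(ln n)\<close> (\<open>log_partition_mean\<close>), that is, the exact value of \<open>E\<close>.
  Up to an elementary prefactor the left side is a sum of \<open>u \<psi>(1+u) - ln \<Gamma>(1+u)\<close>, which by Stirling's formula equals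
  \<open>u + 1/2 - ln (2\<pi>u) / 2 + O(1/u)\<close>; summing the logarithms produces \<open>\<theta> ln \<theta>\<close> and \<open>(\<theta>-1) ln (\<theta>-1)\<close>.  That
  this constant is the one defined through the entropies is an evaluation of two integrals
  (\<open>S_H_eq\<close>, \<open>S_L_eq\<close>): both densities are images of \<open>sin\<^sup>2\<phi> / |1 + r e\<^sup>i\<^sup>\<phi>|\<^sup>2\<close> on the half-circle, the semicircle law
  with \<open>r = 0\<close> and the Laguerre law with \<open>r = 1 / sqrt \<theta>\<close>, and their logarithms are, up to constants, combinations of functions
  \<open>ln |1 + q e\<^sup>i\<^sup>\<phi>|\<close>, whose Fourier series are explicit.
\<close>

section \<open>Calculus on the half-line\<close>

lemma isCont_abs_powr_div:
  fixes c u :: real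
  assumes "c > 1"
  shows "isCont (\<lambda>u. \<bar>u\<bar> powr c / u) u"
proof (cases "u = 0")
  case True
  have "((\<lambda>u::real. \<bar>u\<bar> powr (c - 1)) \<longlongrightarrow> \<bar>0\<bar> powr (c - 1)) (at 0)"
    using assms by (intro tendsto_powr') (auto intro!: tendsto_eq_intros)
  moreover have "\<bar>\<bar>u\<bar> powr c / u\<bar> \<le> \<bar>u\<bar> powr (c - 1)" for u :: real
    by (cases "u = 0") (simp_all add: powr_diff abs_mult)
  ultimately have "((\<lambda>u::real. \<bar>u\<bar> powr c / u) \<longlongrightarrow> 0) (at 0)"
    using assms by (intro Lim_null_comparison[of "\<lambda>u. \<bar>u\<bar> powr c / u" "\<lambda>u. \<bar>u\<bar> powr (c-1)"]) auto
  then show ?thesis using True by (simp add: isCont_def)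
next
  case False
  then show ?thesis by (intro continuous_intros) auto
qed

text \<open>
  The derivative of \<open>|u|\<^sup>c\<close> is \<open>c |u|\<^sup>c / u\<close>, also at \<open>u = 0\<close>, where division by zero gives the correct value 0.
  This form keeps the logarithmic derivative of the weight free of case distinctions.
\<close>

lemma has_field_derivative_abs_powr:
  fixes c u :: real
  assumes "c > 1"
  shows "((\<lambda>u. \<bar>u\<bar> powr c) has_field_derivative c * (\<bar>u\<bar> powr c / u)) (at u)"
proof (cases "u = 0")
  case True
  have "(\<lambda>h::real. (\<bar>0 + h\<bar> powr c - \<bar>0\<bar> powr c) / h) \<midarrow>0\<rightarrow> 0"
    using isCont_abs_powr_div[OF assms, of 0] assms by (simp add: isCont_def)
  then show ?thesis using True by (simp add: DERIV_def)
next
  case False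
  have *: "\<bar>u\<bar> powr c = (u\<^sup>2) powr (c / 2)" for u :: real
  proof -
    have "(u\<^sup>2) powr (c / 2) = (\<bar>u\<bar> powr 2) powr (c / 2)" by (simp add: powr_numeral)
    also have "\<dots> = \<bar>u\<bar> powr c" by (subst powr_powr) simp
    finally show ?thesis ..
  qed
  have "((\<lambda>u. (u\<^sup>2) powr (c / 2)) has_field_derivative c * ((u\<^sup>2) powr (c / 2) / u)) (at u)"
    using False by (auto intro!: derivative_eq_intros simp: powr_diff) (simp add: power2_eq_square)
  then show ?thesis by (simp add: *)
qed

text \<open>
  Apply \<open>1 + y \<le> exp y\<close> to \<open>y = t / m\<close> with \<open>m\<close> so large that the exponent \<open>N t / m\<close> stays below \<open>c t\<close>.
\<close>

lemma powr_le_exp: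
  fixes N c :: real
  assumes "N \<ge> 0" "c > 0"
  obtains K where "K > 0" "\<And>t. t \<ge> 0 \<Longrightarrow> (1 + t) powr N \<le> K * exp (c * t)"
proof -
  define m where "m = max 1 ((N + 1) / c)"
  have m: "m \<ge> 1" "m \<ge> (N + 1) / c" by (auto simp: m_def)
  have "(1 + t) powr N \<le> m powr N * exp (c * t)" if t: "t \<ge> 0" for t
  proof -
    have "1 + t \<le> m * (1 + t / m)" using m by (simp add: field_simps)
    also have "\<dots> \<le> m * exp (t / m)" using m by (intro mult_left_mono exp_ge_add_one_self) auto
    finally have "(1 + t) powr N \<le> (m * exp (t / m)) powr N"
      using t assms by (intro powr_mono2) auto
    also have "\<dots> = m powr N * exp (N * t / m)" using m by (simp add: powr_mult exp_powr_real mult_ac)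
    also have "N * t / m \<le> c * t"
    proof -
      have "c * m \<ge> N + 1" using m(2) assms by (simp add: field_simps)
      then have "N * t \<le> c * m * t" using t by (intro mult_right_mono) auto
      then show ?thesis using m by (simp add: field_simps)
    qed
    finally show ?thesis using m by simp
  qed
  then show ?thesis using m that[of "m powr N"] by auto
qed

lemma
  fixes c :: real assumes "c > 0"
  shows integrable_exp_halfline: "integrable lborel (\<lambda>t. indicator {0<..} t * exp (- (c * t)))"
    and integral_exp_halfline: "(LINT t|lborel. indicator {0<..} t * exp (- (c * t))) = 1 / c"
proof -
  have *: "einterval 0 \<infinity> = {0::real<..}" by (auto simp: einterval_def)
  show "integrable lborel (\<lambda>t. indicator {0<..} t * exp (- (c * t)))"
    and "(LINT t|lborel. indicator {0<..} t * exp (- (c * t))) = 1 / c"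
    using integrable_I0i_exp_mscale[OF assms] LBINT_I0i_exp_mscale[OF assms]
    by (simp_all add: set_integrable_def interval_lebesgue_integral_def set_lebesgue_integral_def 
          mult_ac *)
qed

lemma powr_exp_tendsto_0:
  fixes N c :: real assumes "c > 0" "N \<ge> 0"
  shows "((\<lambda>t. (1 + t) powr N * exp (- (c * t))) \<longlongrightarrow> 0) at_top"
proof -
  obtain K where K: "K > 0" "\<And>t. t \<ge> 0 \<Longrightarrow> (1 + t) powr N \<le> K * exp (c / 2 * t)"
    by (rule powr_le_exp[of N "c/2"]) (use assms in auto)
  have "((\<lambda>t. K * exp (- (c / 2) * t)) \<longlongrightarrow> 0) at_top"
    using assms K(1) by real_asymp
  moreover have "eventually (\<lambda>t. norm ((1 + t) powr N * exp (- (c * t))) \<le> K * exp (- (c / 2) * t)) at_top"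
    using eventually_ge_at_top[of 0]
  proof eventually_elim
    case (elim t)
    have "(1 + t) powr N * exp (- (c * t)) \<le> K * exp (c / 2 * t) * exp (- (c * t))"
      using K(2) elim by (intro mult_right_mono) auto
    then show ?case by (simp add: mult_exp_exp field_simps flip: exp_add)
  qed
  ultimately show ?thesis by (rule Lim_null_comparison[rotated])
qed

text \<open>
  The integrand is the derivative of \<open>t\<^sup>a exp (- b t) \<Prod>|t - y\<^sub>j|\<^sup>c\<close>, which vanishes at 0 and at infinity.  At
  \<open>t = y\<^sub>j\<close> the convention \<open>x / 0 = 0\<close> is harmless because the product vanishes there.
\<close>

lemma halfline_derivative_integral_0:
  fixes a b c :: real and y :: "'i \<Rightarrow> real"
  assumes J: "finite J" and "a > 0" "b > 0" "c > 1"
  shows "(LINT t|lborel. indicator {0<..} t * ((a - b * t + (\<Sum>j\<in>J. c * t / (t - y j))) *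
           (t powr (a - 1) * exp (- (b * t)) * (\<Prod>j\<in>J. \<bar>t - y j\<bar> powr c)))) = 0"
    (is "(LINT t|lborel. indicator {0<..} t * ?d t) = 0")
proof (cases "set_integrable lborel {0<..} ?d")
  \<comment> \<open>If the integrand were not integrable, its integral would be 0 by convention; this
    treats every choice of the other coordinates at once.\<close>
  case False
  then show ?thesis by (simp add: set_integrable_def not_integrable_integral_eq)
next
  case True
  define F where "F t = t powr a * exp (- (b * t)) * (\<Prod>j\<in>J. \<bar>t - y j\<bar> powr c)" for t
  define p where "p j t = c * (\<bar>t - y j\<bar> powr c / (t - y j))" for j t
  define D where "D t = (a * t powr (a - 1) - b * t powr a) * exp (- (b * t)) * (\<Prod>j\<in>J. \<bar>t - y j\<bar> powr c) 
      + t powr a * exp (- (b * t)) * (\<Sum>j\<in>J. p j t * (\<Prod>i\<in>J-{j}. \<bar>t - y i\<bar> powr c))" for t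
  have p: "p j t * (\<Prod>i\<in>J-{j}. \<bar>t - y i\<bar> powr c) = c / (t - y j) * (\<Prod>i\<in>J. \<bar>t - y i\<bar> powr c)"
    if "j \<in> J" for j t
    by (simp add: prod.remove[OF J that] p_def)
  have D_eq: "D t = ?d t" if "t > 0" for t
  proof -
    have t: "t powr a = t * t powr (a - 1)" using that by (simp add: powr_diff)
    have "(\<Sum>j\<in>J. p j t * (\<Prod>i\<in>J-{j}. \<bar>t - y i\<bar> powr c)) =
       (\<Sum>j\<in>J. c / (t - y j)) * (\<Prod>i\<in>J. \<bar>t - y i\<bar> powr c)"
      unfolding sum_distrib_right using p by (intro sum.cong) auto
    moreover have "(\<Sum>j\<in>J. c * t / (t - y j)) = t * (\<Sum>j\<in>J. c / (t - y j))"
      by (simp add: sum_distrib_left mult_ac)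
    ultimately show ?thesis unfolding D_def t by (simp only:) (simp add: algebra_simps)
  qed
  have factor_deriv: "((\<lambda>t. \<bar>t - y j\<bar> powr c) has_real_derivative p j t) (at t)" for j t
  proof -
    have "((\<lambda>t. t - y j) has_real_derivative 1) (at t)" by (auto intro!: derivative_eq_intros)
    then have "((\<lambda>t. \<bar>t - y j\<bar> powr c) has_real_derivative p j t * 1) (at t)" unfolding p_def
      by (rule DERIV_chain2[where f = "\<lambda>u. \<bar>u\<bar> powr c" and g = "\<lambda>t. t - y j", rotated])
        (rule has_field_derivative_abs_powr[OF \<open>c > 1\<close>])
    then show ?thesis by simp
  qed
  have prod_deriv: "((\<lambda>t. \<Prod>j\<in>A. \<bar>t - y j\<bar> powr c) has_real_derivative 
      (\<Sum>j\<in>A. p j t * (\<Prod>i\<in>A-{j}. \<bar>t - y i\<bar> powr c))) (at t)" for t A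
  proof -
    have "((\<lambda>t. \<Prod>j\<in>A. \<bar>t - y j\<bar> powr c) has_derivative 
      (\<lambda>h. \<Sum>j\<in>A. (p j t * h) * (\<Prod>i\<in>A-{j}. \<bar>t - y i\<bar> powr c))) (at t)"
      using factor_deriv by (intro has_derivative_prod) (simp add: has_field_derivative_def)
    moreover have "(\<lambda>h. \<Sum>j\<in>A. (p j t * h) * (\<Prod>i\<in>A-{j}. \<bar>t - y i\<bar> powr c)) =
        (*) (\<Sum>j\<in>A. p j t * (\<Prod>i\<in>A-{j}. \<bar>t - y i\<bar> powr c))"
      by (rule ext) (simp add: sum_distrib_left mult_ac)
    ultimately show ?thesis by (simp add: has_field_derivative_def)
  qed
  have deriv: "(F has_real_derivative D t) (at t)" if "t > 0" for t
  proof -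
    have "((\<lambda>t. exp (- (b * t))) has_real_derivative - b * exp (- (b * t))) (at t)"
      by (auto intro!: derivative_eq_intros)
    from DERIV_mult[OF DERIV_mult[OF has_real_derivative_powr[OF that, of a] this] prod_deriv]
    show ?thesis unfolding F_def D_def by (rule DERIV_cong) (simp add: algebra_simps)
  qed
  have cont: "isCont D t" if "t > 0" for t
  proof -
    have 1: "isCont (p j) t" for j
    proof -
      have "isCont (\<lambda>t. t - y j) t" by (intro continuous_intros)
      then have "isCont (\<lambda>t. \<bar>t - y j\<bar> powr c / (t - y j)) t"
        by (rule isCont_o2[where g = "\<lambda>u. \<bar>u\<bar> powr c / u"]) (rule isCont_abs_powr_div[OF \<open>c > 1\<close>])
      then show ?thesis unfolding p_def by (rule isCont_mult[OF continuous_const])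
    qed
    have 2: "isCont (\<lambda>t. t powr r) t" for r
      using has_real_derivative_powr[OF that] by (rule DERIV_isCont)
    have 3: "isCont (\<lambda>t. exp (- (b * t))) t" by (intro continuous_intros)
    show ?thesis unfolding D_def
      by (intro isCont_add isCont_mult isCont_diff continuous_const isCont_sum ballI 1 2 3 
            DERIV_isCont[OF prod_deriv])
  qed
  have at0: "(F \<longlongrightarrow> 0) (at_right 0)"
  proof -
    have "(F \<longlongrightarrow> 0 powr a * exp (- (b * 0)) * (\<Prod>j\<in>J. \<bar>0 - y j\<bar> powr c)) (at_right 0)"
      unfolding F_def using assms
      by (intro tendsto_intros tendsto_powr') (auto intro!: tendsto_intros simp: eventually_at_filter)
    then show ?thesis by simp
  qed
  have at_inf: "(F \<longlongrightarrow> 0) at_top"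
  proof -
    define N where "N = a + (\<Sum>j\<in>J. c)"
    have "((\<lambda>t. (\<Prod>j\<in>J. (1 + \<bar>y j\<bar>) powr c) * ((1 + t) powr N * exp (- (b * t)))) \<longlongrightarrow> 0) at_top"
      using assms by (intro tendsto_mult_right_zero powr_exp_tendsto_0) (auto simp: N_def intro!: add_nonneg_nonneg sum_nonneg)
    moreover have "eventually (\<lambda>t. norm (F t) \<le> (\<Prod>j\<in>J. (1 + \<bar>y j\<bar>) powr c) * ((1 + t) powr N * exp (- (b * t)))) at_top"
      using eventually_gt_at_top[of 0]
    proof eventually_elim
      case (elim t)
      have "(\<Prod>j\<in>J. \<bar>t - y j\<bar> powr c) \<le> (\<Prod>j\<in>J. (1 + \<bar>y j\<bar>) powr c * (1 + t) powr c)"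
      proof (intro prod_mono conjI)
        fix j
        have "\<bar>y j\<bar> * t \<ge> 0" using elim by simp
        then have "\<bar>t - y j\<bar> \<le> (1 + \<bar>y j\<bar>) * (1 + t)" using elim unfolding ring_distribs by linarith
        then show "\<bar>t - y j\<bar> powr c \<le> (1 + \<bar>y j\<bar>) powr c * (1 + t) powr c"
          using assms elim by (subst powr_mult[symmetric]) (auto intro!: powr_mono2)
      qed auto
      also have "\<dots> = (\<Prod>j\<in>J. (1 + \<bar>y j\<bar>) powr c) * (1 + t) powr (\<Sum>j\<in>J. c)"
        unfolding prod.distrib using elim J by (subst powr_sum) auto
      finally have "t powr a * exp (- (b * t)) * (\<Prod>j\<in>J. \<bar>t - y j\<bar> powr c) \<le> 
         (1 + t) powr a * exp (- (b * t)) * ((\<Prod>j\<in>J. (1 + \<bar>y j\<bar>) powr c) * (1 + t) powr (\<Sum>j\<in>J. c))"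
        using elim assms by (intro mult_mono powr_mono2) (auto intro!: prod_nonneg)
      then show ?case using elim unfolding F_def N_def powr_add
        by (simp add: abs_mult abs_prod mult_ac)
    qed
    ultimately show ?thesis by (rule Lim_null_comparison[rotated])
  qed
  have "(LBINT t=0..\<infinity>. D t) = 0 - 0"
  proof (rule interval_integral_FTC_integrable)
    show "set_integrable lborel (einterval 0 \<infinity>) D"
    proof -
      have "(\<lambda>t. indicator (einterval 0 \<infinity>) t *\<^sub>R D t) = (\<lambda>t. indicator {0<..} t *\<^sub>R ?d t)"
        by (rule ext) (auto simp: indicator_def einterval_def D_eq)
      with True show ?thesis by (simp only: set_integrable_def)
    qed
    show "((F \<circ> real_of_ereal) \<longlongrightarrow> 0) (at_right 0)"
      using at0 by (simp add: ereal_tendsto_simps1 zero_ereal_def)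
    show "((F \<circ> real_of_ereal) \<longlongrightarrow> 0) (at_left \<infinity>)"
      using at_inf by (simp add: ereal_tendsto_simps1)
  qed (use deriv cont in \<open>auto simp: has_real_derivative_iff_has_vector_derivative\<close>)
  also have "(LBINT t=0..\<infinity>. D t) = (LINT t|lborel. indicator {0<..} t * ?d t)"
    unfolding interval_lebesgue_integral_def set_lebesgue_integral_def
    by (auto intro!: Bochner_Integration.integral_cong simp: indicator_def einterval_def D_eq)
  finally show ?thesis by simp
qed


section \<open>The Laguerre weight and its integrability\<close>

interpretation lborel_prod: product_sigma_finite "\<lambda>_::'i. lborel :: real measure"
  by standard

text \<open>
  Index sets are arbitrary finite sets, so that removing a particle is removing an index.
\<close>

abbreviation Leb :: "'i set \<Rightarrow> ('i \<Rightarrow> real) measure" where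
  "Leb I \<equiv> Pi\<^sub>M I (\<lambda>_. lborel)"

text \<open>
  The product runs over ordered pairs, so every difference occurs twice and the total exponent is
  \<open>2g\<close>.  In this form invariance under permutations is a mere reindexing.
\<close>

definition vandermonde_powr :: "real \<Rightarrow> 'i set \<Rightarrow> ('i \<Rightarrow> real) \<Rightarrow> real" where
  "vandermonde_powr g I x = (\<Prod>i\<in>I. \<Prod>j\<in>I - {i}. \<bar>x i - x j\<bar> powr g)"

abbreviation gamma_wt :: "real \<Rightarrow> real \<Rightarrow> real \<Rightarrow> real" where
  "gamma_wt a b t \<equiv> indicator {0<..} t * (t powr (a - 1) * exp (- (b * t)))"

definition laguerre_wt :: "real \<Rightarrow> real \<Rightarrow> real \<Rightarrow> 'i set \<Rightarrow> ('i \<Rightarrow> real) \<Rightarrow> real" where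
  "laguerre_wt a b g I x =
     (\<Prod>i\<in>I. gamma_wt a b (x i)) * vandermonde_powr g I x"

lemma vandermonde_powr_nonneg: "vandermonde_powr g I x \<ge> 0"
  by (auto simp: vandermonde_powr_def intro!: prod_nonneg)

lemma laguerre_wt_nonneg: "laguerre_wt a b g I x \<ge> 0"
  unfolding laguerre_wt_def using vandermonde_powr_nonneg[of g I x]
  by (auto intro!: mult_nonneg_nonneg prod_nonneg)

lemma laguerre_wt_eq_0: "i \<in> I \<Longrightarrow> finite I \<Longrightarrow> x i \<le> 0 \<Longrightarrow> laguerre_wt a b g I x = 0"
  by (auto simp: laguerre_wt_def intro!: bexI[of _ i])

lemma vandermonde_powr_insert:
  assumes "finite I" "p \<notin> I"
  shows "vandermonde_powr g (insert p I) x =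
    (\<Prod>j\<in>I. \<bar>x p - x j\<bar> powr (2 * g)) * vandermonde_powr g I x"
proof -
  have *: "insert p I - {i} = insert p (I - {i})" if "i \<in> I" for i using that assms by auto
  have "(\<Prod>i\<in>I. \<Prod>j\<in>insert p I - {i}. \<bar>x i - x j\<bar> powr g) = 
     (\<Prod>i\<in>I. \<bar>x i - x p\<bar> powr g * (\<Prod>j\<in>I - {i}. \<bar>x i - x j\<bar> powr g))"
    using assms by (intro prod.cong refl) (simp add: *)
  also have "\<dots> = (\<Prod>i\<in>I. \<bar>x p - x i\<bar> powr g) * vandermonde_powr g I x"
    by (simp add: prod.distrib vandermonde_powr_def abs_minus_commute)
  finally have "vandermonde_powr g (insert p I) x = 
     (\<Prod>i\<in>I. \<bar>x p - x i\<bar> powr g) * ((\<Prod>i\<in>I. \<bar>x p - x i\<bar> powr g) * vandermonde_powr g I x)"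
    using assms by (simp add: vandermonde_powr_def)
  also have "\<dots> = (\<Prod>j\<in>I. \<bar>x p - x j\<bar> powr (2 * g)) * vandermonde_powr g I x"
    unfolding mult_2 powr_add prod.distrib by (simp add: mult_ac)
  finally show ?thesis .
qed

lemma measurable_vandermonde_powr [measurable]:
  "vandermonde_powr g I \<in> borel_measurable (Leb I)"
  unfolding vandermonde_powr_def by measurable

lemma measurable_laguerre_wt [measurable]:
  "laguerre_wt a b g I \<in> borel_measurable (Leb I)"
  unfolding laguerre_wt_def by measurable

definition orthant_bound :: "real \<Rightarrow> real \<Rightarrow> 'i set \<Rightarrow> ('i \<Rightarrow> real) \<Rightarrow> real" where
  "orthant_bound N b I x = (\<Prod>i\<in>I. indicator {0<..} (x i) * ((1 + x i) powr N * exp (- (b * x i))))"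

lemma integrable_orthant_bound:
  assumes "finite I" "b > 0" "N \<ge> 0"
  shows "integrable (Leb I) (orthant_bound N b I)"
proof -
  obtain K where K: "K > 0" "\<And>t. t \<ge> 0 \<Longrightarrow> (1 + t) powr N \<le> K * exp (b / 2 * t)"
    by (rule powr_le_exp[of N "b/2"]) (use assms in auto)
  have "integrable lborel (\<lambda>t. indicator {0<..} t * ((1 + t) powr N * exp (- (b * t))))"
  proof (rule Bochner_Integration.integrable_bound)
    show "integrable lborel (\<lambda>t. K * (indicator {0<..} t * exp (- (b / 2 * t))))"
      using assms by (intro integrable_mult_right integrable_exp_halfline) auto
    show "AE t in lborel. norm (indicator {0<..} t * ((1 + t) powr N * exp (- (b * t)))) \<le> 
        norm (K * (indicator {0<..} t * exp (- (b / 2 * t))))"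
    proof (rule AE_I2)
      fix t :: real
      have "(1 + t) powr N * exp (- (b * t)) \<le> K * exp (b / 2 * t) * exp (- (b * t))" if "t > 0"
        using K(2)[of t] that by (intro mult_right_mono) auto
      also have "K * exp (b / 2 * t) * exp (- (b * t)) = K * exp (- (b / 2 * t))"
        by (simp add: field_simps flip: exp_add)
      finally show "norm (indicator {0<..} t * ((1 + t) powr N * exp (- (b * t)))) \<le> 
          norm (K * (indicator {0<..} t * exp (- (b / 2 * t))))"
        using K(1) by (auto simp: indicator_def)
    qed
  qed measurable
  then show ?thesis unfolding orthant_bound_def
    by (intro lborel_prod.product_integrable_prod assms)
qed

text \<open>
  For positive coordinates \<open>|x\<^sub>i - x\<^sub>j| \<le> (1 + x\<^sub>i) (1 + x\<^sub>j)\<close>, so the differences are dominated by a product over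
  single coordinates.  The diagonal factors added for symmetry are at least 1.
\<close>

lemma vandermonde_powr_le:
  assumes "finite I" "g \<ge> 0" "\<And>i. i \<in> I \<Longrightarrow> x i > 0"
  shows "vandermonde_powr g I x \<le> (\<Prod>i\<in>I. (1 + x i) powr (2 * g * card I))"
proof -
  have nn: "1 + x i > 0" if "i \<in> I" for i using assms(3)[OF that] by simp
  have "vandermonde_powr g I x \<le> (\<Prod>i\<in>I. \<Prod>j\<in>I. (1 + x i) powr g * (1 + x j) powr g)"
    unfolding vandermonde_powr_def
  proof (intro prod_mono conjI prod_nonneg)
    fix i assume i: "i \<in> I"
    have "(\<Prod>j\<in>I - {i}. \<bar>x i - x j\<bar> powr g) \<le> (\<Prod>j\<in>I - {i}. (1 + x i) powr g * (1 + x j) powr g)"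
    proof (intro prod_mono conjI)
      fix j assume j: "j \<in> I - {i}"
      have "x i * x j \<ge> 0" using assms(3)[of i] assms(3)[of j] i j by simp
      then have "\<bar>x i - x j\<bar> \<le> (1 + x i) * (1 + x j)"
        using assms(3)[of i] assms(3)[of j] i j unfolding ring_distribs by (simp add: abs_le_iff)
      then have "\<bar>x i - x j\<bar> powr g \<le> ((1 + x i) * (1 + x j)) powr g"
        using assms by (intro powr_mono2) auto
      then show "\<bar>x i - x j\<bar> powr g \<le> (1 + x i) powr g * (1 + x j) powr g"
        using nn[of i] nn[of j] i j by (simp add: powr_mult)
    qed auto
    also have "\<dots> \<le> ((1 + x i) powr g * (1 + x i) powr g) * (\<Prod>j\<in>I - {i}. (1 + x i) powr g * (1 + x j) powr g)"
    proof -
      have "1 \<le> (1 + x i) powr g" using assms(3)[OF i] \<open>g \<ge> 0\<close> by (intro ge_one_powr_ge_zero) auto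
      then have "1 * 1 \<le> (1 + x i) powr g * (1 + x i) powr g" by (intro mult_mono) auto
      from mult_right_mono[OF this, of "\<Prod>j\<in>I - {i}. (1 + x i) powr g * (1 + x j) powr g"]
      show ?thesis by (simp add: prod_nonneg)
    qed
    also have "\<dots> = (\<Prod>j\<in>I. (1 + x i) powr g * (1 + x j) powr g)"
      by (rule prod.remove[OF \<open>finite I\<close> i, symmetric])
    finally show "(\<Prod>j\<in>I - {i}. \<bar>x i - x j\<bar> powr g) \<le> (\<Prod>j\<in>I. (1 + x i) powr g * (1 + x j) powr g)" .
  qed auto
  also have "\<dots> = (\<Prod>i\<in>I. ((1 + x i) powr g) ^ card I) * (\<Prod>j\<in>I. (1 + x j) powr g) ^ card I"
    by (simp add: prod.distrib)
  also have "\<dots> = (\<Prod>i\<in>I. ((1 + x i) powr g) ^ card I * ((1 + x i) powr g) ^ card I)"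
    by (simp add: prod.distrib prod_power_distrib)
  also have "\<dots> = (\<Prod>i\<in>I. (1 + x i) powr (2 * g * card I))"
  proof (intro prod.cong refl)
    fix i assume "i \<in> I"
    with nn[of i] show "((1 + x i) powr g) ^ card I * ((1 + x i) powr g) ^ card I = (1 + x i) powr (2 * g * card I)"
      by (simp add: powr_def exp_of_nat_mult[symmetric] algebra_simps flip: exp_add)
  qed
  finally show ?thesis .
qed

lemma weight_prefactor_le:
  assumes "finite I" "a \<ge> 1"
  shows "(\<Prod>i\<in>I. gamma_wt a b (x i)) * (\<Prod>i\<in>I. (1 + x i) powr M) 
     \<le> orthant_bound (a - 1 + M) b I x"
proof (cases "\<forall>i\<in>I. x i > 0")
  case False
  then obtain i where "i \<in> I" "\<not> 0 < x i" by force
  then have "(\<Prod>i\<in>I. gamma_wt a b (x i)) = 0"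
    using assms by (intro prod_zero bexI[of _ i]) auto
  then show ?thesis by (auto simp: orthant_bound_def intro!: prod_nonneg)
next
  case True
  have "gamma_wt a b (x i) \<le> (1 + x i) powr (a - 1) * exp (- (b * x i))"
    if "i \<in> I" for i
  proof -
    have "x i powr (a - 1) \<le> (1 + x i) powr (a - 1)"
      using True that assms by (intro powr_mono2) (auto simp: less_imp_le)
    then show ?thesis using True that by auto
  qed
  then have "(\<Prod>i\<in>I. gamma_wt a b (x i)) * (\<Prod>i\<in>I. (1 + x i) powr M)
     \<le> (\<Prod>i\<in>I. (1 + x i) powr (a - 1) * exp (- (b * x i))) * (\<Prod>i\<in>I. (1 + x i) powr M)"
    by (intro mult_right_mono prod_mono) (auto intro!: prod_nonneg)
  also have "\<dots> = orthant_bound (a - 1 + M) b I x"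
    unfolding orthant_bound_def prod.distrib[symmetric] powr_add using True by (auto intro!: prod.cong simp: mult_ac)
  finally show ?thesis .
qed

text \<open>
  All integrands below are bounded by a polynomial in the coordinates times the weight of
  independent Gamma variables; \<open>a \<ge> 1\<close> removes the singularity at the origin.
\<close>

lemma integrable_weight_bound:
  assumes "finite I" "a \<ge> 1" "b > 0" "M \<ge> 0" and f: "f \<in> borel_measurable (Leb I)"
    and bound: "\<And>x. (\<And>i. i \<in> I \<Longrightarrow> x i > 0) \<Longrightarrow> \<bar>f x\<bar> \<le> C * ((\<Prod>i\<in>I. x i powr (a - 1) * exp (- (b * x i))) * (\<Prod>i\<in>I. (1 + x i) powr M))"
    and zero: "\<And>x i. i \<in> I \<Longrightarrow> x i \<le> 0 \<Longrightarrow> f x = 0"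
    and C: "C \<ge> 0"
  shows "integrable (Leb I) (f :: _ \<Rightarrow> real)"
proof (rule Bochner_Integration.integrable_bound[OF _ f])
  show "integrable (Leb I) (\<lambda>x. C * orthant_bound (a - 1 + M) b I x)"
    using assms by (intro integrable_mult_right integrable_orthant_bound) auto
  show "AE x in Leb I. norm (f x) \<le> norm (C * orthant_bound (a - 1 + M) b I x)"
  proof (rule AE_I2)
    fix x
    have "\<bar>f x\<bar> \<le> C * ((\<Prod>i\<in>I. gamma_wt a b (x i)) * (\<Prod>i\<in>I. (1 + x i) powr M))"
    proof (cases "\<forall>i\<in>I. x i > 0")
      case True
      then show ?thesis using bound[of x] by simp
    next
      case False
      then obtain i where "i \<in> I" "x i \<le> 0" by force
      then have "f x = 0" using zero by blast
      then show ?thesis using C by (auto intro!: mult_nonneg_nonneg prod_nonneg)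
    qed
    also have "\<dots> \<le> C * orthant_bound (a - 1 + M) b I x"
      using assms by (intro mult_left_mono weight_prefactor_le) auto
    finally show "norm (f x) \<le> norm (C * orthant_bound (a - 1 + M) b I x)" by simp
  qed
qed

lemma integrable_laguerre_wt_mult:
  assumes "finite I" "a \<ge> 1" "b > 0" "g \<ge> 0" "h \<in> borel_measurable (Leb I)" "C \<ge> 0" "M \<ge> 0"
    and h: "\<And>x. (\<And>i. i \<in> I \<Longrightarrow> x i > 0) \<Longrightarrow> \<bar>h x * vandermonde_powr g I x\<bar> \<le> C * (\<Prod>i\<in>I. (1 + x i) powr M)"
  shows "integrable (Leb I) (\<lambda>x. h x * laguerre_wt a b g I x :: real)"
proof (rule integrable_weight_bound[where a = a and b = b and M = M and C = C])
  fix x :: "'a \<Rightarrow> real" assume x: "\<And>i. i \<in> I \<Longrightarrow> x i > 0"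
  define P where "P = (\<Prod>i\<in>I. x i powr (a - 1) * exp (- (b * x i)))"
  have "P \<ge> 0" by (auto simp: P_def intro!: prod_nonneg)
  have "\<bar>h x * laguerre_wt a b g I x\<bar> = P * \<bar>h x * vandermonde_powr g I x\<bar>"
    using \<open>P \<ge> 0\<close> x unfolding laguerre_wt_def P_def by (simp add: abs_mult abs_prod mult_ac)
  also have "\<dots> \<le> P * (C * (\<Prod>i\<in>I. (1 + x i) powr M))"
    using h[OF x] \<open>P \<ge> 0\<close> by (intro mult_left_mono) auto
  finally show "\<bar>h x * laguerre_wt a b g I x\<bar> \<le> C * (P * (\<Prod>i\<in>I. (1 + x i) powr M))"
    by (simp add: mult_ac)
qed (use assms in \<open>auto simp: laguerre_wt_eq_0\<close>)

lemma integrable_laguerre_wt: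
  assumes "finite I" "a \<ge> 1" "b > 0" "g \<ge> 0"
  shows "integrable (Leb I) (laguerre_wt a b g I)"
proof -
  have "integrable (Leb I) (\<lambda>x. 1 * laguerre_wt a b g I x)"
    by (rule integrable_laguerre_wt_mult[where C = 1 and M = "2 * g * card I"])
       (use assms vandermonde_powr_le[of I g] in \<open>auto simp: abs_of_nonneg vandermonde_powr_nonneg\<close>)
  then show ?thesis by simp
qed

lemma prod_le_prod_one_plus:
  assumes "finite I" "T \<subseteq> I" "\<And>i. i \<in> I \<Longrightarrow> x i > (0::real)"
  shows "(\<Prod>i\<in>T. x i) \<le> (\<Prod>i\<in>I. 1 + x i)"
proof -
  have "(\<Prod>i\<in>T. x i) \<le> (\<Prod>i\<in>T. 1 + x i)" 
    using assms by (intro prod_mono) (auto simp: less_imp_le subset_iff)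
  also have "\<dots> \<le> (\<Prod>i\<in>I. 1 + x i)"
    using assms by (intro prod_mono2) (auto simp: less_imp_le subset_iff add_nonneg_nonneg)
  finally show ?thesis .
qed

lemma integrable_prod_laguerre_wt:
  assumes "finite I" "T \<subseteq> I" "a \<ge> 1" "b > 0" "g \<ge> 0"
  shows "integrable (Leb I) (\<lambda>x. (\<Prod>i\<in>T. x i) * laguerre_wt a b g I x)"
proof (rule integrable_laguerre_wt_mult[where C = 1 and M = "1 + 2 * g * card I"])
  show "(\<lambda>x. \<Prod>i\<in>T. x i) \<in> borel_measurable (Leb I)" by measurable (use assms in auto)
  fix x :: "'a \<Rightarrow> real" assume x: "\<And>i. i \<in> I \<Longrightarrow> x i > 0"
  have "\<bar>(\<Prod>i\<in>T. x i) * vandermonde_powr g I x\<bar> = (\<Prod>i\<in>T. x i) * vandermonde_powr g I x"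
    using x assms by (intro abs_of_nonneg mult_nonneg_nonneg prod_nonneg vandermonde_powr_nonneg) 
      (auto simp: less_imp_le subset_iff)
  also have "\<dots> \<le> (\<Prod>i\<in>I. 1 + x i) * (\<Prod>i\<in>I. (1 + x i) powr (2 * g * card I))"
    using x assms by (intro mult_mono prod_le_prod_one_plus vandermonde_powr_le prod_nonneg vandermonde_powr_nonneg) 
      (auto simp: less_imp_le subset_iff add_nonneg_nonneg)
  also have "\<dots> = (\<Prod>i\<in>I. (1 + x i) powr (1 + 2 * g * card I))"
    unfolding powr_add prod.distrib[symmetric] using x by (intro prod.cong refl) (auto simp: less_imp_le add_nonneg_nonneg)
  finally show "\<bar>(\<Prod>i\<in>T. x i) * vandermonde_powr g I x\<bar> \<le> 1 * (\<Prod>i\<in>I. (1 + x i) powr (1 + 2 * g * card I))" by simp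
qed (use assms in auto)

text \<open>
  One factor \<open>|x\<^sub>p - x\<^sub>j|\<close> is cancelled by the pole; the remaining exponent \<open>2g - 1\<close> is nonnegative, and lowering
  an exponent only helps because the dominating factor is at least 1.
\<close>

lemma vandermonde_pole_le:
  assumes "finite I" "p \<notin> I" "j \<in> I" "g \<ge> 1/2" "\<And>i. i \<in> insert p I \<Longrightarrow> x i > 0"
  shows "\<bar>vandermonde_powr g (insert p I) x / (x p - x j)\<bar> \<le> (\<Prod>i\<in>insert p I. (1 + x i) powr (2 * g * card (insert p I)))"
proof -
  have gt1: "\<bar>x p - x i\<bar> \<le> (1 + x p) * (1 + x i)" "(1 + x p) * (1 + x i) \<ge> 1" if "i \<in> I" for i
  proof -
    have "x p > 0" "x i > 0" using assms(5) that by auto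
    moreover from this have "x p * x i \<ge> 0" by simp
    ultimately show "\<bar>x p - x i\<bar> \<le> (1 + x p) * (1 + x i)" "(1 + x p) * (1 + x i) \<ge> 1"
      by (auto simp: ring_distribs abs_le_iff)
  qed
  have le: "\<bar>x p - x i\<bar> powr (2 * g) \<le> ((1 + x p) * (1 + x i)) powr (2 * g)" if "i \<in> I" for i
    using gt1[OF that] assms by (intro powr_mono2) auto
  have le_j: "\<bar>x p - x j\<bar> powr (2 * g) / \<bar>x p - x j\<bar> \<le> ((1 + x p) * (1 + x j)) powr (2 * g)"
  proof -
    have "\<bar>x p - x j\<bar> powr (2 * g) / \<bar>x p - x j\<bar> \<le> \<bar>x p - x j\<bar> powr (2 * g - 1)"
      by (simp add: powr_diff)
    also have "\<dots> \<le> ((1 + x p) * (1 + x j)) powr (2 * g - 1)"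
      using gt1[of j] assms by (intro powr_mono2) auto
    also have "\<dots> \<le> ((1 + x p) * (1 + x j)) powr (2 * g)"
      using gt1[of j] assms by (intro powr_mono) auto
    finally show ?thesis .
  qed
  have "\<bar>vandermonde_powr g (insert p I) x / (x p - x j)\<bar> = 
      (\<bar>x p - x j\<bar> powr (2 * g) / \<bar>x p - x j\<bar>) * (\<Prod>i\<in>I-{j}. \<bar>x p - x i\<bar> powr (2 * g)) * vandermonde_powr g I x"
    unfolding vandermonde_powr_insert[OF assms(1,2)] prod.remove[OF assms(1,3)]
    by (simp add: abs_mult abs_divide abs_prod abs_of_nonneg[OF vandermonde_powr_nonneg])
  also have "\<dots> \<le> ((1 + x p) * (1 + x j)) powr (2 * g) * (\<Prod>i\<in>I-{j}. ((1 + x p) * (1 + x i)) powr (2 * g)) * (\<Prod>i\<in>I. (1 + x i) powr (2 * g * card I))"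
    using assms by (intro mult_mono le_j prod_mono vandermonde_powr_le) 
      (auto intro!: le prod_nonneg mult_nonneg_nonneg vandermonde_powr_nonneg)
  also have "\<dots> = (\<Prod>i\<in>I. ((1 + x p) * (1 + x i)) powr (2 * g)) * (\<Prod>i\<in>I. (1 + x i) powr (2 * g * card I))"
    by (simp add: prod.remove[OF assms(1,3)])
  also have "\<dots> = (\<Prod>i\<in>I. (1 + x p) powr (2 * g)) * (\<Prod>i\<in>I. (1 + x i) powr (2 * g + 2 * g * card I))"
    unfolding powr_add prod.distrib[symmetric] using assms(5)
    by (intro prod.cong refl) (auto simp: powr_mult less_imp_le add_nonneg_nonneg mult_ac)
  also have "(\<Prod>i\<in>I. (1 + x p) powr (2 * g)) = (1 + x p) powr (\<Sum>i\<in>I. 2 * g)"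
    using assms(1) assms(5)[of p] by (subst powr_sum) auto
  also have "\<dots> \<le> (1 + x p) powr (2 * g + 2 * g * card I)"
    using assms(4) assms(5)[of p] by (intro powr_mono) (auto simp: mult_ac)
  also have "2 * g + 2 * g * card I = 2 * g * card (insert p I)" 
    using assms(1,2) by (simp add: algebra_simps)
  finally show ?thesis using assms(1,2) by (simp add: mult_right_mono prod_nonneg)
qed

lemma integrable_pole_laguerre_wt:
  assumes I: "finite I" "p \<in> I" "j \<in> I" "p \<noteq> j" "T \<subseteq> I" and "a \<ge> 1" "b > 0" "g \<ge> 1/2"
  shows "integrable (Leb I) (\<lambda>x. (\<Prod>i\<in>T. x i) * (x p / (x p - x j)) * laguerre_wt a b g I x)"
proof (rule integrable_laguerre_wt_mult[where C = 1 and M = "2 + 2 * g * card I"])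
  have [measurable]: "(\<lambda>x. \<Prod>i\<in>T. x i) \<in> borel_measurable (Leb I)" by measurable (use assms in auto)
  show "(\<lambda>x. (\<Prod>i\<in>T. x i) * (x p / (x p - x j))) \<in> borel_measurable (Leb I)"
    using assms by measurable
  fix x :: "'a \<Rightarrow> real" assume x: "\<And>i. i \<in> I \<Longrightarrow> x i > 0"
  have "\<bar>(\<Prod>i\<in>T. x i) * (x p / (x p - x j)) * vandermonde_powr g I x\<bar> = 
      (\<Prod>i\<in>T. x i) * (\<Prod>i\<in>{p}. x i) * \<bar>vandermonde_powr g (insert p (I - {p})) x / (x p - x j)\<bar>"
  proof -
    have "(\<Prod>i\<in>T. x i) \<ge> 0" using x assms(5) by (intro prod_nonneg) (auto simp: less_imp_le subset_iff)
    moreover have "x p > 0" using x assms by auto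
    moreover have "insert p (I - {p}) = I" using assms by auto
    ultimately show ?thesis by (simp add: abs_mult abs_divide)
  qed
  also have "\<dots> \<le> (\<Prod>i\<in>I. 1 + x i) * (\<Prod>i\<in>I. 1 + x i) * (\<Prod>i\<in>insert p (I - {p}). (1 + x i) powr (2 * g * card (insert p (I-{p}))))"
    using x assms by (intro mult_mono prod_le_prod_one_plus vandermonde_pole_le prod_nonneg mult_nonneg_nonneg) 
      (auto simp: less_imp_le subset_iff add_nonneg_nonneg)
  also have "insert p (I - {p}) = I" using assms by auto
  also have "(\<Prod>i\<in>I. 1 + x i) * (\<Prod>i\<in>I. 1 + x i) * (\<Prod>i\<in>I. (1 + x i) powr (2 * g * card I))
     = (\<Prod>i\<in>I. (1 + x i) powr (2 + 2 * g * card I))"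
    unfolding powr_add prod.distrib[symmetric] using x 
    by (intro prod.cong refl) (auto simp: less_imp_le add_nonneg_nonneg power2_eq_square)
  finally show "\<bar>(\<Prod>i\<in>T. x i) * (x p / (x p - x j)) * vandermonde_powr g I x\<bar>
     \<le> 1 * (\<Prod>i\<in>I. (1 + x i) powr (2 + 2 * g * card I))" by simp
qed (use assms in auto)


section \<open>Aomoto's recursion\<close>

text \<open>
  Both invariance statements are checked on boxes, which determine a product of sigma-finite measures.
\<close>

lemma distr_Leb_permute:
  assumes "finite I" "\<sigma> permutes I"
  shows "distr (Leb I) (Leb I) (\<lambda>x. \<lambda>i\<in>I. x (\<sigma> i)) = (Leb I :: ('i \<Rightarrow> real) measure)"
proof (rule lborel_prod.PiM_eqI)
  have meas: "(\<lambda>x. \<lambda>i\<in>I. x (\<sigma> i)) \<in> Leb I \<rightarrow>\<^sub>M Leb I"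
    using assms(2) by (intro measurable_restrict measurable_component_singleton) (auto simp: permutes_in_image)
  fix A :: "'i \<Rightarrow> real set" assume A: "\<And>i. i \<in> I \<Longrightarrow> A i \<in> sets lborel"
  have "emeasure (distr (Leb I) (Leb I) (\<lambda>x. \<lambda>i\<in>I. x (\<sigma> i))) (Pi\<^sub>E I A) =
    emeasure (Leb I) ((\<lambda>x. \<lambda>i\<in>I. x (\<sigma> i)) -` Pi\<^sub>E I A \<inter> space (Leb I))"
    using A assms(1) by (intro emeasure_distr[OF meas] sets_PiM_I_finite) auto
  also have "(\<lambda>x. \<lambda>i\<in>I. x (\<sigma> i)) -` Pi\<^sub>E I A \<inter> space (Leb I) = Pi\<^sub>E I (\<lambda>i. A (inv \<sigma> i))"
  proof -
    have "(\<forall>i\<in>I. x (\<sigma> i) \<in> A i) \<longleftrightarrow> (\<forall>i\<in>I. x i \<in> A (inv \<sigma> i))" for x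
      using permutes_in_image[OF assms(2)] permutes_in_image[OF permutes_inv[OF assms(2)]]
         permutes_inverses[OF assms(2)] by metis
    then show ?thesis by (auto simp: space_PiM PiE_iff)
  qed
  also have "emeasure (Leb I) \<dots> = (\<Prod>i\<in>I. emeasure lborel (A (inv \<sigma> i)))"
    using A assms by (intro lborel_prod.emeasure_PiM) (auto simp: permutes_in_image[OF permutes_inv])
  also have "\<dots> = (\<Prod>i\<in>I. emeasure lborel (A i))"
    by (rule prod.reindex_bij_betw[OF permutes_imp_bij[OF permutes_inv[OF assms(2)]]])
  finally show "emeasure (distr (Leb I) (Leb I) (\<lambda>x. \<lambda>i\<in>I. x (\<sigma> i))) (Pi\<^sub>E I A) = (\<Prod>i\<in>I. emeasure lborel (A i))" .
qed (use assms in auto)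

lemma distr_Leb_translate:
  assumes "finite I"
  shows "distr (Leb I) (Leb I) (\<lambda>x. \<lambda>i\<in>I. t + x i) = (Leb I :: ('i \<Rightarrow> real) measure)"
proof (rule lborel_prod.PiM_eqI)
  have meas: "(\<lambda>x. \<lambda>i\<in>I. t + x i) \<in> Leb I \<rightarrow>\<^sub>M Leb I"
    by (intro measurable_restrict) simp
  fix A :: "'i \<Rightarrow> real set" assume A: "\<And>i. i \<in> I \<Longrightarrow> A i \<in> sets lborel"
  have "emeasure (distr (Leb I) (Leb I) (\<lambda>x. \<lambda>i\<in>I. t + x i)) (Pi\<^sub>E I A) =
    emeasure (Leb I) ((\<lambda>x. \<lambda>i\<in>I. t + x i) -` Pi\<^sub>E I A \<inter> space (Leb I))"
    using A assms(1) by (intro emeasure_distr[OF meas] sets_PiM_I_finite) auto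
  also have "(\<lambda>x. \<lambda>i\<in>I. t + x i) -` Pi\<^sub>E I A \<inter> space (Leb I) = Pi\<^sub>E I (\<lambda>i. (+) t -` A i)"
    by (auto simp: space_PiM PiE_iff)
  also have "emeasure (Leb I) \<dots> = (\<Prod>i\<in>I. emeasure lborel ((+) t -` A i))"
    using A assms by (intro lborel_prod.emeasure_PiM) (auto intro!: measurable_sets_borel[where M = borel, simplified])
  also have "\<dots> = (\<Prod>i\<in>I. emeasure lborel (A i))"
  proof (intro prod.cong refl)
    fix i assume "i \<in> I"
    then have "emeasure (distr lborel borel ((+) t)) (A i) = emeasure lborel ((+) t -` A i)"
      using A by (subst emeasure_distr) auto
    then show "emeasure lborel ((+) t -` A i) = emeasure lborel (A i)" by (simp add: lborel_distr_plus)
  qed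
  finally show "emeasure (distr (Leb I) (Leb I) (\<lambda>x. \<lambda>i\<in>I. t + x i)) (Pi\<^sub>E I A) = (\<Prod>i\<in>I. emeasure lborel (A i))" .
qed (use assms in auto)

lemma integral_Leb_permute:
  fixes f :: "('i \<Rightarrow> real) \<Rightarrow> real"
  assumes "finite I" "\<sigma> permutes I" "f \<in> borel_measurable (Leb I)"
  shows "(LINT x|Leb I. f (\<lambda>i\<in>I. x (\<sigma> i))) = (LINT x|Leb I. f x)"
proof -
  have "(\<lambda>x. \<lambda>i\<in>I. x (\<sigma> i)) \<in> Leb I \<rightarrow>\<^sub>M Leb I"
    using assms(2) by (intro measurable_restrict measurable_component_singleton) (auto simp: permutes_in_image)
  from integral_distr[OF this assms(3)] show ?thesis by (simp add: distr_Leb_permute assms)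
qed

lemma prod_restrict_permute:
  assumes "\<sigma> permutes I"
  shows "(\<Prod>i\<in>I. h ((\<lambda>i\<in>I. x (\<sigma> i)) i)) = (\<Prod>i\<in>I. h (x i))"
proof -
  have "(\<Prod>i\<in>I. h ((\<lambda>i\<in>I. x (\<sigma> i)) i)) = (\<Prod>i\<in>I. h (x (\<sigma> i)))" by simp
  also have "\<dots> = (\<Prod>i\<in>I. h (x i))"
    by (rule prod.reindex_bij_betw[OF permutes_imp_bij[OF assms]])
  finally show ?thesis .
qed

lemma laguerre_wt_permute:
  assumes "\<sigma> permutes I"
  shows "laguerre_wt a b g I (\<lambda>i\<in>I. x (\<sigma> i)) = laguerre_wt a b g I x"
proof -
  have "vandermonde_powr g I (\<lambda>i\<in>I. x (\<sigma> i)) = (\<Prod>i\<in>I. \<Prod>j\<in>I-{i}. \<bar>x (\<sigma> i) - x (\<sigma> j)\<bar> powr g)"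
    unfolding vandermonde_powr_def by (intro prod.cong refl) auto
  also have "\<dots> = (\<Prod>i\<in>I. \<Prod>j\<in>I-{\<sigma> i}. \<bar>x (\<sigma> i) - x j\<bar> powr g)"
  proof (rule prod.cong[OF refl])
    fix i assume i: "i \<in> I"
    have "bij_betw \<sigma> (I - {i}) (I - {\<sigma> i})"
      using permutes_imp_bij[OF assms] i
      by (intro bij_betw_DiffI) (auto simp: permutes_in_image[OF assms])
    then show "(\<Prod>j\<in>I-{i}. \<bar>x (\<sigma> i) - x (\<sigma> j)\<bar> powr g) = (\<Prod>j\<in>I-{\<sigma> i}. \<bar>x (\<sigma> i) - x j\<bar> powr g)"
      by (rule prod.reindex_bij_betw)
  qed
  also have "\<dots> = vandermonde_powr g I x" unfolding vandermonde_powr_def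
    by (rule prod.reindex_bij_betw[OF permutes_imp_bij[OF assms]])
  finally have "vandermonde_powr g I (\<lambda>i\<in>I. x (\<sigma> i)) = vandermonde_powr g I x" .
  moreover have "(\<Prod>i\<in>I. indicator {0<..} ((\<lambda>i\<in>I. x (\<sigma> i)) i) * (((\<lambda>i\<in>I. x (\<sigma> i)) i) powr (a - 1) * exp (- (b * (\<lambda>i\<in>I. x (\<sigma> i)) i)))) =
      (\<Prod>i\<in>I. gamma_wt a b (x i))"
    by (rule prod_restrict_permute[OF assms, where h = "\<lambda>y. indicator {0<..} y * (y powr (a - 1) * exp (- (b * y)))"])
  ultimately show ?thesis unfolding laguerre_wt_def by (simp only:)
qed

lemma laguerre_wt_tie:
  assumes "finite I" "i \<in> I" "j \<in> I" "i \<noteq> j" "x i = x j"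
  shows "laguerre_wt a b g I x = 0"
proof -
  have "vandermonde_powr g I x = 0"
  proof -
    have "(\<Prod>j\<in>I - {i}. \<bar>x i - x j\<bar> powr g) = 0"
      using assms by (intro prod_zero bexI[of _ j]) auto
    then show ?thesis unfolding vandermonde_powr_def using assms(1,2) by (intro prod_zero) blast+
  qed
  then show ?thesis by (simp add: laguerre_wt_def)
qed

definition selberg_moment :: "real \<Rightarrow> real \<Rightarrow> real \<Rightarrow> 'i set \<Rightarrow> 'i set \<Rightarrow> real" where
  "selberg_moment a b g I T = (LINT x|Leb I. (\<Prod>i\<in>T. x i) * laguerre_wt a b g I x)"

lemma transposed_prod:
  assumes "finite I" "T \<subseteq> I" "p \<in> I" "p \<notin> T" "j \<in> I"
  shows "j \<notin> T \<Longrightarrow> (\<Prod>i\<in>T. (\<lambda>i\<in>I. x (Transposition.transpose p j i)) i) = (\<Prod>i\<in>T. x i)"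
    and "j \<in> T \<Longrightarrow> (\<Prod>i\<in>T. (\<lambda>i\<in>I. x (Transposition.transpose p j i)) i) = x p * (\<Prod>i\<in>T-{j}. x i)"
proof -
  have T: "finite T" using assms finite_subset by blast
  have eq: "(\<lambda>i\<in>I. x (Transposition.transpose p j i)) i = x i" if "i \<in> T" "i \<noteq> j" for i
    using that assms by (auto simp: Transposition.transpose_def)
  show "j \<notin> T \<Longrightarrow> (\<Prod>i\<in>T. (\<lambda>i\<in>I. x (Transposition.transpose p j i)) i) = (\<Prod>i\<in>T. x i)"
    by (intro prod.cong refl, rule eq) auto
  assume "j \<in> T"
  then have "(\<Prod>i\<in>T. (\<lambda>i\<in>I. x (Transposition.transpose p j i)) i) = 
     (\<lambda>i\<in>I. x (Transposition.transpose p j i)) j * (\<Prod>i\<in>T-{j}. (\<lambda>i\<in>I. x (Transposition.transpose p j i)) i)"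
    by (rule prod.remove[OF T])
  also have "(\<Prod>i\<in>T-{j}. (\<lambda>i\<in>I. x (Transposition.transpose p j i)) i) = (\<Prod>i\<in>T-{j}. x i)"
    by (intro prod.cong refl, rule eq) auto
  finally show "(\<Prod>i\<in>T. (\<lambda>i\<in>I. x (Transposition.transpose p j i)) i) = x p * (\<Prod>i\<in>T-{j}. x i)"
    using assms by simp
qed

text \<open>
  Exchange the coordinates \<open>p\<close> and \<open>j\<close>.  If \<open>j \<in> T\<close>, the integrand is antisymmetric.  Otherwise it turns into
  the same expression with \<open>x\<^sub>j / (x\<^sub>j - x\<^sub>p)\<close>, and the two fractions add up to 1; where \<open>x\<^sub>p = x\<^sub>j\<close> the weight is 0.
\<close>

lemma integral_pole:
  fixes a b g :: real
  assumes I: "finite I" "T \<subseteq> I" "p \<in> I" "p \<notin> T" "j \<in> I" "j \<noteq> p" and "a \<ge> 1" "b > 0" "g \<ge> 1/2"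
  shows "(LINT x|Leb I. (\<Prod>i\<in>T. x i) * (x p / (x p - x j)) * laguerre_wt a b g I x) =
     (if j \<in> T then 0 else selberg_moment a b g I T / 2)" (is "?B = _")
proof -
  define f where "f x = (\<Prod>i\<in>T. x i) * (x p / (x p - x j)) * laguerre_wt a b g I x" for x
  have int_f: "integrable (Leb I) f" unfolding f_def using assms
    by (intro integrable_pole_laguerre_wt) auto
  have perm: "Transposition.transpose p j permutes I" using assms by (intro permutes_swap_id) auto
  have swap: "(LINT x|Leb I. f (\<lambda>i\<in>I. x (Transposition.transpose p j i))) = (LINT x|Leb I. f x)"
    by (rule integral_Leb_permute[OF I(1) perm borel_measurable_integrable[OF int_f]])
  have B: "?B = (LINT x|Leb I. f x)" by (simp only: f_def)
  have int_swap: "integrable (Leb I) (\<lambda>x. f (\<lambda>i\<in>I. x (Transposition.transpose p j i)))"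
  proof -
    have "(\<lambda>x. \<lambda>i\<in>I. x (Transposition.transpose p j i)) \<in> Leb I \<rightarrow>\<^sub>M Leb I"
      using perm by (intro measurable_restrict measurable_component_singleton) (auto simp: permutes_in_image)
    moreover have "integrable (distr (Leb I) (Leb I) (\<lambda>x. \<lambda>i\<in>I. x (Transposition.transpose p j i))) f"
      using int_f by (simp add: distr_Leb_permute I(1) perm)
    ultimately show ?thesis by (rule integrable_distr)
  qed
  show ?thesis
  proof (cases "j \<in> T")
    case True
    have "finite T" using I finite_subset by blast
    have "f (\<lambda>i\<in>I. x (Transposition.transpose p j i)) = - f x" for x
      unfolding f_def laguerre_wt_permute[OF perm] transposed_prod(2)[OF I(1-5) True] prod.remove[OF \<open>finite T\<close> True, where g = x]
      using I by (cases "x p = x j") (auto simp: field_simps)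
    then have "(LINT x|Leb I. f x) = - (LINT x|Leb I. f x)" using swap by simp
    then show ?thesis using True B by simp
  next
    case False
    have "f (\<lambda>i\<in>I. x (Transposition.transpose p j i)) + f x = (\<Prod>i\<in>T. x i) * laguerre_wt a b g I x" for x
    proof (cases "x p = x j")
      case True
      then have "laguerre_wt a b g I x = 0" using I by (intro laguerre_wt_tie[of _ p j]) auto
      then show ?thesis unfolding f_def laguerre_wt_permute[OF perm] by simp
    next
      case ne: False
      define D where "D = x p - x j"
      have D: "D \<noteq> 0" "x j - x p = - D" "x p - x j = D" "x p = D + x j" using ne by (auto simp: D_def)
      have "x j / (x j - x p) + x p / (x p - x j) = 1" unfolding D(2,3)
        by (subst D(4)) (simp add: add_divide_distrib D(1))
      moreover have "f (\<lambda>i\<in>I. x (Transposition.transpose p j i)) + f x = 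
         (\<Prod>i\<in>T. x i) * laguerre_wt a b g I x * (x j / (x j - x p) + x p / (x p - x j))"
        unfolding f_def laguerre_wt_permute[OF perm] transposed_prod(1)[OF I(1-5) False]
        using I by (simp add: algebra_simps)
      ultimately show ?thesis by simp
    qed
    then have "selberg_moment a b g I T = (LINT x|Leb I. f (\<lambda>i\<in>I. x (Transposition.transpose p j i)) + f x)"
      by (simp add: selberg_moment_def)
    also have "\<dots> = (LINT x|Leb I. f x) + (LINT x|Leb I. f x)"
      using Bochner_Integration.integral_add[OF int_swap int_f] swap by simp
    finally show ?thesis using False B by simp
  qed
qed

text \<open>
  Integrate in the coordinate \<open>p\<close> first; the inner integral is that of a derivative.
\<close>

lemma aomoto_ibp:
  fixes a b g :: real
  assumes I: "finite I" "T \<subseteq> I" "p \<notin> I" and "a \<ge> 1" "b > 0" "g > 1/2"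
  shows "(LINT x|Leb (insert p I). (\<Prod>i\<in>T. x i) * (a - b * x p + (\<Sum>j\<in>I. 2 * g * x p / (x p - x j))) *
      laguerre_wt a b g (insert p I) x) = 0"
    (is "(LINT x|_. ?f x) = 0")
proof (cases "integrable (Leb (insert p I)) ?f")
  case False
  then show ?thesis by (rule not_integrable_integral_eq)
next
  case True
  have "(LINT t|lborel. ?f (x(p := t))) = 0" for x
  proof -
    define C where "C = (\<Prod>i\<in>T. x i) * laguerre_wt a b g I x"
    have T: "(\<Prod>i\<in>T. (x(p := t)) i) = (\<Prod>i\<in>T. x i)" for t using I by (intro prod.cong) auto
    have S: "(\<Sum>j\<in>I. 2 * g * (x(p := t)) p / ((x(p := t)) p - (x(p := t)) j)) = (\<Sum>j\<in>I. 2 * g * t / (t - x j))" for t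
      using I by (intro sum.cong) auto
    have E: "(\<Prod>i\<in>I. indicator {0<..} ((x(p:=t)) i) * ((x(p:=t)) i powr (a - 1) * exp (- (b * (x(p:=t)) i)))) =
           (\<Prod>i\<in>I. gamma_wt a b (x i))"
      "(\<Prod>j\<in>I. \<bar>(x(p:=t)) p - (x(p:=t)) j\<bar> powr (2 * g)) = (\<Prod>j\<in>I. \<bar>t - x j\<bar> powr (2 * g))"
      "vandermonde_powr g I (x(p:=t)) = vandermonde_powr g I x" for t
      unfolding vandermonde_powr_def by (intro prod.cong refl; use I(3) in auto)+
    have W: "laguerre_wt a b g (insert p I) (x(p := t)) = 
        indicator {0<..} t * (t powr (a - 1) * exp (- (b * t)) * (\<Prod>j\<in>I. \<bar>t - x j\<bar> powr (2 * g))) * laguerre_wt a b g I x" for t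
      unfolding laguerre_wt_def vandermonde_powr_insert[OF I(1,3)] prod.insert[OF I(1,3)] E by simp
    have "?f (x(p := t)) = C * (indicator {0<..} t * ((a - b * t + (\<Sum>j\<in>I. 2 * g * t / (t - x j))) *
           (t powr (a - 1) * exp (- (b * t)) * (\<Prod>j\<in>I. \<bar>t - x j\<bar> powr (2 * g)))))" for t
      unfolding T S W C_def by simp
    then have "(LINT t|lborel. ?f (x(p := t))) = C * (LINT t|lborel. (indicator {0<..} t * ((a - b * t + (\<Sum>j\<in>I. 2 * g * t / (t - x j))) *
           (t powr (a - 1) * exp (- (b * t)) * (\<Prod>j\<in>I. \<bar>t - x j\<bar> powr (2 * g))))))"
      by (simp only: integral_mult_right_zero)
    also have "\<dots> = 0"
      using assms by (subst halfline_derivative_integral_0) auto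
    finally show ?thesis .
  qed
  then show ?thesis using lborel_prod.product_integral_insert[OF I(1,3) True] by simp
qed

text \<open>
  Expanding the integral of the derivative of \<open>x\<^sub>p \<Prod>x\<^sub>i\<close> times the weight: each \<open>j\<close> outside \<open>T\<close> contributes
  \<open>2g\<close> times one half of the moment, each \<open>j \<in> T\<close> contributes nothing.
\<close>

lemma aomoto_recursion:
  fixes a b g :: real
  assumes I: "finite I" "T \<subseteq> I" "p \<in> I" "p \<notin> T" and "a \<ge> 1" "b > 0" "g > 1/2"
  shows "b * selberg_moment a b g I (insert p T) = (a + g * (real (card I) - 1 - real (card T))) * selberg_moment a b g I T"
proof -
  define w where "w = laguerre_wt a b g I"
  define J where "J = I - {p}"
  have J: "finite J" "insert p J = I" "p \<notin> J" "T \<subseteq> J" using I by (auto simp: J_def)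
  define B where "B j x = (\<Prod>i\<in>T. x i) * (x p / (x p - x j)) * w x" for j and x :: "'a \<Rightarrow> real"
  have int_B: "integrable (Leb I) (B j)" if "j \<in> J" for j
    unfolding B_def w_def using that I assms by (intro integrable_pole_laguerre_wt) (auto simp: J_def)
  have int_T: "integrable (Leb I) (\<lambda>x. (\<Prod>i\<in>T. x i) * w x)"
    unfolding w_def using assms by (intro integrable_prod_laguerre_wt) auto
  have int_pT: "integrable (Leb I) (\<lambda>x. (\<Prod>i\<in>insert p T. x i) * w x)"
    unfolding w_def using assms by (intro integrable_prod_laguerre_wt) auto
  have T: "finite T" using I finite_subset by blast
  have "0 = (LINT x|Leb I. (\<Prod>i\<in>T. x i) * (a - b * x p + (\<Sum>j\<in>J. 2 * g * x p / (x p - x j))) * w x)"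
    using aomoto_ibp[of J T p a b g] J assms by (simp add: w_def)
  also have "\<dots> = (LINT x|Leb I. a * ((\<Prod>i\<in>T. x i) * w x) - b * ((\<Prod>i\<in>insert p T. x i) * w x) + 2 * g * (\<Sum>j\<in>J. B j x))"
    using I T by (intro Bochner_Integration.integral_cong refl) (simp add: B_def algebra_simps sum_distrib_left)
  also have "\<dots> = a * selberg_moment a b g I T - b * selberg_moment a b g I (insert p T) + 2 * g * (\<Sum>j\<in>J. LINT x|Leb I. B j x)"
    using int_B int_T int_pT by (simp add: selberg_moment_def w_def)
  also have "(\<Sum>j\<in>J. LINT x|Leb I. B j x) = (\<Sum>j\<in>J. if j \<in> T then 0 else selberg_moment a b g I T / 2)"
    unfolding B_def w_def using assms by (intro sum.cong refl integral_pole) (auto simp: J_def)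
  also have "\<dots> = (\<Sum>j\<in>J - T. selberg_moment a b g I T / 2)"
    using J by (intro sum.mono_neutral_cong_right) auto
  also have "\<dots> = (real (card I) - 1 - real (card T)) * (selberg_moment a b g I T / 2)"
  proof -
    have "card (J - T) = card J - card T" using J T by (simp add: card_Diff_subset)
    moreover have "card J = card I - 1" "card I \<ge> 1" "card T \<le> card J"
      using I card_mono[OF J(1) J(4)] by (auto simp: J_def card_gt_0_iff Suc_le_eq)
    ultimately show ?thesis by (simp add: of_nat_diff)
  qed
  finally show ?thesis by (simp add: field_simps)
qed


section \<open>Positivity and log-convexity in the Laguerre parameter\<close>

definition selberg :: "real \<Rightarrow> real \<Rightarrow> real \<Rightarrow> 'i set \<Rightarrow> real" where
  "selberg a b g I = (LINT x|Leb I. laguerre_wt a b g I x)"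

lemma selberg_moment_eq_prod:
  assumes "finite I" "a \<ge> 1" "b > 0" "g > 1/2" "T \<subseteq> I"
  shows "selberg_moment a b g I T = selberg a b g I * (\<Prod>k<card T. (a + g * (real (card I) - 1 - real k)) / b)"
proof -
  have "finite T" using assms finite_subset by blast
  then show ?thesis using assms(5)
  proof (induction T)
    case empty
    then show ?case by (simp add: selberg_moment_def selberg_def)
  next
    case (insert p T)
    have "b * selberg_moment a b g I (insert p T) = (a + g * (real (card I) - 1 - real (card T))) * selberg_moment a b g I T"
      using insert assms by (intro aomoto_recursion) auto
    then show ?case using insert assms by (simp add: field_simps)
  qed
qed

lemma selberg_moment_full:
  assumes "finite I"
  shows "selberg_moment a b g I I = selberg (a + 1) b g I"
proof -
  have "(\<Prod>i\<in>I. x i) * laguerre_wt a b g I x = laguerre_wt (a + 1) b g I x" for x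
  proof (cases "\<forall>i\<in>I. x i > 0")
    case True
    then have eq: "(\<Prod>i\<in>I. gamma_wt (a + 1) b (x i)) =
       (\<Prod>i\<in>I. x i * (gamma_wt a b (x i)))"
      by (intro prod.cong refl) (auto simp: powr_diff)
    show ?thesis unfolding laguerre_wt_def by (subst eq) (simp only: prod.distrib mult.assoc)
  next
    case False
    then obtain i where "i \<in> I" "x i \<le> 0" by force
    then show ?thesis using assms by (simp add: laguerre_wt_eq_0)
  qed
  then show ?thesis by (simp add: selberg_moment_def selberg_def)
qed

text \<open>
  Multiplying the weight by all coordinates raises the parameter \<open>a\<close> by 1, so this is the recursion
  iterated from the empty to the full set of coordinates.
\<close>

lemma selberg_plus1:
  assumes "finite I" "a \<ge> 1" "b > 0" "g > 1/2"
  shows "selberg (a + 1) b g I = selberg a b g I * (\<Prod>k<card I. (a + g * real k) / b)"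
proof -
  have "(\<Prod>k<card I. (a + g * (real (card I) - 1 - real k)) / b) = (\<Prod>k<card I. (a + g * real k) / b)"
    by (rule prod.reindex_bij_witness[of _ "\<lambda>k. card I - 1 - k" "\<lambda>k. card I - 1 - k"])
       (auto simp: of_nat_diff)
  then show ?thesis
    using selberg_moment_eq_prod[of I a b g I] selberg_moment_full[of I a b g] assms by simp
qed

text \<open>
  On a box of side 1 whose sides in different coordinates are disjoint subsets of the positive axis
  the weight is positive.
\<close>

lemma selberg_pos:
  assumes "finite I" "a \<ge> 1" "b > 0" "g \<ge> 0"
  shows "selberg a b g I > 0"
proof -
  obtain f :: "'a \<Rightarrow> nat" where f: "inj_on f I" using finite_imp_inj_to_nat_seg[OF assms(1)] by auto
  \<comment> \<open>Consecutive intervals are separated by gaps of length 1 and start at 1 or later.\<close>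
  define A where "A = (\<lambda>i. {real (2 * f i + 1) .. real (2 * f i + 2)})"
  define B where "B = Pi\<^sub>E I A"
  have B: "B \<in> sets (Leb I)" unfolding B_def A_def using assms(1) by (intro sets_PiM_I_finite) auto
  have "emeasure (Leb I) B = (\<Prod>i\<in>I. emeasure lborel (A i))" unfolding B_def
    using assms(1) by (intro lborel_prod.emeasure_PiM) (auto simp: A_def)
  then have emB: "emeasure (Leb I) B = 1" by (simp add: A_def)
  have pos: "laguerre_wt a b g I x > 0" if "x \<in> B" for x
  proof -
    have 1: "x i \<ge> real (2 * f i + 1)" "x i \<le> real (2 * f i + 2)" if "i \<in> I" for i
      using that \<open>x \<in> B\<close> by (auto simp: B_def A_def PiE_iff)
    have "x i \<noteq> x j" if "i \<in> I" "j \<in> I" "i \<noteq> j" for i j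
      using 1[OF that(1)] 1[OF that(2)] inj_onD[OF f _ that(1,2)] that(3) by (cases "f i < f j") force+
    moreover have "x i > 0" if "i \<in> I" for i using 1[OF that] by simp
    ultimately show ?thesis unfolding laguerre_wt_def vandermonde_powr_def
      by (intro mult_pos_pos prod_pos) (auto simp: less_imp_neq[symmetric])
  qed
  have "selberg a b g I \<ge> 0" unfolding selberg_def by (intro integral_nonneg_AE AE_I2 laguerre_wt_nonneg)
  moreover have "selberg a b g I \<noteq> 0"
  proof
    assume "selberg a b g I = 0"
    then have "AE x in Leb I. laguerre_wt a b g I x = 0"
      using integral_nonneg_eq_0_iff_AE[OF integrable_laguerre_wt[OF assms]] laguerre_wt_nonneg[of a b g I]
      by (auto simp: selberg_def)
    then have "AE x in Leb I. x \<notin> B" by eventually_elim (use pos in force)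
    then have "emeasure (Leb I) B = 0" using B by (simp add: AE_iff_measurable[OF B] sets.sets_into_space[OF B] 
       AE_iff_null[OF _] null_sets_def Int_absorb1 Collect_conj_eq)
    then show False using emB by simp
  qed
  ultimately show ?thesis by simp
qed

text \<open>
  Hoelder's inequality for the weights, which are geometric interpolations of each other; it is
  obtained by normalising both weights and integrating Young's inequality.
\<close>

lemma selberg_log_convex:
  assumes "finite I" "a \<ge> 1" "a' \<ge> 1" "b > 0" "g \<ge> 0" "u \<ge> 0" "v \<ge> 0" "u + v = 1"
  shows "ln (selberg (u * a + v * a') b g I) \<le> u * ln (selberg a b g I) + v * ln (selberg a' b g I)"
proof -
  define c where "c = u * a + v * a'"
  have c: "c \<ge> 1"
  proof -
    have "u * 1 + v * 1 \<le> c" unfolding c_def using assms by (intro add_mono mult_left_mono) auto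
    then show ?thesis using assms by simp
  qed
  define S S' where "S = selberg a b g I" and "S' = selberg a' b g I"
  have S: "S > 0" "S' > 0" using selberg_pos assms by (auto simp: S_def S'_def)
  have ineq: "laguerre_wt c b g I x \<le> S powr u * S' powr v * (u * (laguerre_wt a b g I x / S) + v * (laguerre_wt a' b g I x / S'))" for x
  proof (cases "laguerre_wt c b g I x = 0")
    case True
    then show ?thesis using S assms laguerre_wt_nonneg[of a b g I x] laguerre_wt_nonneg[of a' b g I x]
      by (auto intro!: mult_nonneg_nonneg add_nonneg_nonneg divide_nonneg_nonneg)
  next
    case False
    then have pos: "x i > 0" if "i \<in> I" for i using that laguerre_wt_eq_0 assms(1) by (meson not_le)
    have vp: "vandermonde_powr g I x > 0" using False vandermonde_powr_nonneg[of g I x] 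
      by (auto simp: laguerre_wt_def less_le)
    define w where "w d = (\<Prod>i\<in>I. x i powr (d - 1) * exp (- (b * x i)))" for d
    have w: "laguerre_wt d b g I x = w d * vandermonde_powr g I x" for d
      unfolding laguerre_wt_def w_def using pos by (auto intro!: prod.cong)
    have w_pos: "w d > 0" for d unfolding w_def using pos by (intro prod_pos mult_pos_pos) (auto simp: less_imp_neq[symmetric])
    have "w c = (\<Prod>i\<in>I. (x i powr (a - 1) * exp (- (b * x i))) powr u * (x i powr (a' - 1) * exp (- (b * x i))) powr v)"
      unfolding w_def
    proof (intro prod.cong refl)
      fix i assume "i \<in> I"
      then have "x i > 0" by (rule pos)
      have e: "(x i powr (d - 1) * exp (- (b * x i))) powr r = exp (r * ((d - 1) * ln (x i) - b * x i))" for d r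
        using \<open>x i > 0\<close> by (simp add: powr_def mult_exp_exp)
      have v: "v = 1 - u" using assms(8) by simp
      have "(c - 1) * ln (x i) - b * x i = u * ((a - 1) * ln (x i) - b * x i) + v * ((a' - 1) * ln (x i) - b * x i)"
        unfolding c_def v by (simp add: algebra_simps)
      then show "x i powr (c - 1) * exp (- (b * x i)) = 
         (x i powr (a - 1) * exp (- (b * x i))) powr u * (x i powr (a' - 1) * exp (- (b * x i))) powr v"
        using e[of c 1] by (simp add: e exp_add)
    qed
    also have "\<dots> = w a powr u * w a' powr v"
      unfolding w_def by (subst prod.distrib) (simp add: prod_powr_distrib)
    finally have wc: "w c = w a powr u * w a' powr v" .
    define p q where "p = laguerre_wt a b g I x / S" and "q = laguerre_wt a' b g I x / S'"
    have pq: "p > 0" "q > 0" using w_pos vp S by (auto simp: p_def q_def w)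
    have "p powr u * q powr v \<le> u * p + v * q"
      using assms pq by (intro Youngs_inequality_0) auto
    then have "S powr u * S' powr v * (p powr u * q powr v) \<le> S powr u * S' powr v * (u * p + v * q)"
      by (intro mult_left_mono) auto
    also have "S powr u * S' powr v * (p powr u * q powr v) = (S * p) powr u * (S' * q) powr v"
      using S pq by (simp add: powr_mult mult_ac)
    also have "S * p = laguerre_wt a b g I x"
      using S by (auto simp: p_def)
    also have "S' * q = laguerre_wt a' b g I x"
      using S by (auto simp: q_def)
    also have "laguerre_wt a b g I x powr u * laguerre_wt a' b g I x powr v = 
       w a powr u * w a' powr v * (vandermonde_powr g I x powr (u + v))"
      using w_pos[THEN less_imp_le] vp by (simp add: w powr_mult powr_add mult_ac)
    also have "\<dots> = laguerre_wt c b g I x" using vp by (simp add: assms(8) w wc)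
    finally show ?thesis by (simp only: p_def q_def)
  qed
  have int: "integrable (Leb I) (laguerre_wt d b g I)" if "d \<ge> 1" for d
    using assms that by (intro integrable_laguerre_wt)
  have "selberg c b g I \<le> (LINT x|Leb I. S powr u * S' powr v * (u * (laguerre_wt a b g I x / S) + v * (laguerre_wt a' b g I x / S')))"
    unfolding selberg_def using int c assms by (intro integral_mono ineq) auto
  also have "\<dots> = S powr u * S' powr v * (u * (S / S) + v * (S' / S'))"
    using int assms by (simp add: S_def S'_def selberg_def)
  also have "\<dots> = S powr u * S' powr v" using S assms by simp
  finally have "ln (selberg c b g I) \<le> ln (S powr u * S' powr v)"
    using selberg_pos[of I c b g] assms c by (subst ln_le_cancel_iff) (auto simp: S less_imp_neq[symmetric])
  also have "\<dots> = u * ln S + v * ln S'" using S by (simp add: ln_mult ln_powr)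
  finally show ?thesis by (simp add: c_def S_def S'_def)
qed


section \<open>A Bohr-Mollerup argument\<close>

text \<open>
  A convex function whose unit increments are given by \<open>D\<close> has increments between \<open>t D (y - 1)\<close> and \<open>t D y\<close> over
  \<open>[y, y + t]\<close>.  Two such functions differ by a function of period 1, and far out the bounds leave no
  room for this difference to vary.
\<close>

lemma bohr_mollerup_unique:
  fixes L G D :: "real \<Rightarrow> real"
  assumes L: "convex_on {1..} L" "\<And>a. a \<ge> 1 \<Longrightarrow> L (a + 1) = L a + D a"
    and G: "convex_on {1..} G" "\<And>a. a \<ge> 1 \<Longrightarrow> G (a + 1) = G a + D a"
    and D: "(\<lambda>m. D (2 + real m) - D (1 + real m)) \<longlonglongrightarrow> 0"
    and a: "a \<ge> 1"
  shows "L a - L 1 = G a - G 1"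
proof -
  have period: "L (a + real m) - G (a + real m) = L a - G a" if "a \<ge> 1" for a m
  proof (induction m)
    case (Suc m)
    then show ?case using L(2)[of "a + real m"] G(2)[of "a + real m"] that by (simp add: algebra_simps)
  qed simp
  have slopes: "t * D (y - 1) \<le> H (y + t) - H y \<and> H (y + t) - H y \<le> t * D y"
    if H: "convex_on {1..} H" "\<And>a. a \<ge> 1 \<Longrightarrow> H (a + 1) = H a + D a" and y: "y \<ge> 2" and t: "0 \<le> t" "t \<le> 1" 
    for H t and y :: real
  proof
    have "H ((1 - t) *\<^sub>R y + t *\<^sub>R (y + 1)) \<le> (1 - t) * H y + t * H (y + 1)"
      using H(1) y t by (intro convex_onD) auto
    then show "H (y + t) - H y \<le> t * D y" using H(2)[of y] y by (simp add: algebra_simps)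
    \<comment> \<open>\<open>y\<close> is the convex combination of \<open>y - 1\<close> and \<open>y + t\<close> with weights \<open>1 - s\<close> and \<open>s\<close>.\<close>
    define s where "s = 1 / (1 + t)"
    have s: "0 \<le> s" "s \<le> 1" "s * (1 + t) = 1" using t by (auto simp: s_def)
    have "H ((1 - s) *\<^sub>R (y - 1) + s *\<^sub>R (y + t)) \<le> (1 - s) * H (y - 1) + s * H (y + t)"
      using H(1) y t s by (intro convex_onD) auto
    also have "(1 - s) *\<^sub>R (y - 1) + s *\<^sub>R (y + t) = y + (s * (1 + t) - 1)" by (simp add: algebra_simps)
    finally have "(1 + t) * H y \<le> (1 + t) * ((1 - s) * H (y - 1) + s * H (y + t))"
      using t s by (intro mult_left_mono) auto
    also have "\<dots> = (1 + t - s * (1 + t)) * H (y - 1) + s * (1 + t) * H (y + t)" by (simp add: algebra_simps)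
    also have "\<dots> = t * H (y - 1) + H (y + t)" using s by simp
    finally show "t * D (y - 1) \<le> H (y + t) - H y" using H(2)[of "y - 1"] y by (simp add: algebra_simps)
  qed
  define m where "m = nat \<lfloor>a - 1\<rfloor>"
  define t where "t = a - 1 - real m"
  have t: "0 \<le> t" "t \<le> 1" using a unfolding t_def m_def by linarith+
  have "L a - G a = L (1 + t) - G (1 + t)"
    using period[of "1 + t" m] t by (simp add: t_def)
  moreover have "L (1 + t) - G (1 + t) = L 1 - G 1"
  proof -
    define d where "d = L (1 + t) - G (1 + t) - (L 1 - G 1)"
    have "\<bar>d\<bar> \<le> t * (D (2 + real k) - D (1 + real k))" for k
    proof -
      have "d = (L (2 + real k + t) - L (2 + real k)) - (G (2 + real k + t) - G (2 + real k))"
        using period[of "1 + t" "Suc k"] period[of 1 "Suc k"] t by (simp add: d_def algebra_simps)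
      then show ?thesis using slopes[OF L(1,2), of "2 + real k" t] slopes[OF G(1,2), of "2 + real k" t] t
        unfolding abs_le_iff right_diff_distrib by (simp add: algebra_simps)
    qed
    moreover have "(\<lambda>k. t * (D (2 + real k) - D (1 + real k))) \<longlonglongrightarrow> t * 0"
      by (intro tendsto_mult D tendsto_const)
    ultimately have "\<bar>d\<bar> \<le> 0" by (intro LIMSEQ_le_const[of "\<lambda>k. t * (D (2 + real k) - D (1 + real k))"]) auto
    then show ?thesis by (simp add: d_def)
  qed
  ultimately show ?thesis by simp
qed

text \<open>
  The logarithms of both sides are convex in \<open>a\<close> and have the same unit increments.
\<close>

lemma selberg_eq_selberg_1:
  assumes I: "finite I" and "a \<ge> 1" "b > 0" "g > 1/2"
  shows "selberg a b g I = selberg 1 b g I * (\<Prod>k<card I. Gamma (a + g * real k) / Gamma (1 + g * real k)) * 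
            b powr (- (real (card I) * (a - 1)))"
proof -
  define n where "n = card I"
  define L where "L a = ln (selberg a b g I)" for a
  define G where "G a = (\<Sum>k<n. ln (Gamma (a + g * real k))) - real n * a * ln b" for a
  define D where "D a = (\<Sum>k<n. ln (a + g * real k) - ln b)" for a
  have "L a - L 1 = G a - G 1"
  proof (rule bohr_mollerup_unique[where D = D])
    show "convex_on {1..} L"
    proof (rule convex_onI)
      fix u x y :: real assume "0 < u" "u < 1" "x \<in> {1..}" "y \<in> {1..}"
      then show "L ((1 - u) *\<^sub>R x + u *\<^sub>R y) \<le> (1 - u) * L x + u * L y"
        using selberg_log_convex[of I x y b g "1 - u" u] assms by (simp add: L_def)
    qed auto
    show "convex_on {1..} G"
    proof (rule convex_onI)
      fix u x y :: real assume u: "0 < u" "u < 1" "x \<in> {1..}" "y \<in> {1..}"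
      have "ln (Gamma ((1 - u) * x + u * y + g * real k)) \<le> (1 - u) * ln (Gamma (x + g * real k)) + u * ln (Gamma (y + g * real k))" for k
      proof -
        have "(ln \<circ> Gamma) ((1 - u) *\<^sub>R (x + g * real k) + u *\<^sub>R (y + g * real k)) \<le> 
            (1 - u) * (ln \<circ> Gamma) (x + g * real k) + u * (ln \<circ> Gamma) (y + g * real k)"
          using u assms by (intro convex_onD[OF log_convex_Gamma_real]) (auto intro!: add_pos_nonneg)
        then show ?thesis by (simp add: algebra_simps)
      qed
      then have "(\<Sum>k<n. ln (Gamma ((1 - u) * x + u * y + g * real k))) \<le> 
         (1 - u) * (\<Sum>k<n. ln (Gamma (x + g * real k))) + u * (\<Sum>k<n. ln (Gamma (y + g * real k)))"
        unfolding sum_distrib_left sum.distrib[symmetric] by (intro sum_mono)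
      then show "G ((1 - u) *\<^sub>R x + u *\<^sub>R y) \<le> (1 - u) * G x + u * G y"
        by (simp add: G_def algebra_simps)
    qed auto
    fix a :: real assume a: "a \<ge> 1"
    have pos: "a + g * real k > 0" for k using a assms by (intro add_pos_nonneg) auto
    have "selberg a b g I > 0" using selberg_pos[of I a b g] assms a by simp
    moreover have "(\<Prod>k<n. (a + g * real k) / b) > 0" using pos assms by (intro prod_pos) auto
    ultimately show "L (a + 1) = L a + D a"
      using a assms pos less_imp_neq[OF pos]
      by (simp add: L_def D_def n_def selberg_plus1 ln_mult ln_prod ln_div)
    have "Gamma (a + 1 + g * real k) = (a + g * real k) * Gamma (a + g * real k)" for k
      using Gamma_plus1[of "a + g * real k"] pos[of k] by (simp add: add_ac nonpos_Ints_def)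
    then have "ln (Gamma (a + 1 + g * real k)) = ln (a + g * real k) + ln (Gamma (a + g * real k))" for k
      using less_imp_neq[OF pos, THEN not_sym] less_imp_neq[OF Gamma_real_pos[OF pos], THEN not_sym]
      by (simp add: ln_mult)
    then show "G (a + 1) = G a + D a"
      unfolding G_def D_def by (simp add: sum.distrib sum_subtractf distrib_left distrib_right)
  next
    have "(\<lambda>m. \<Sum>k<n. ln (2 + real m + g * real k) - ln (1 + real m + g * real k)) \<longlonglongrightarrow> (\<Sum>k<n. 0)"
    proof (rule tendsto_sum)
      fix k
      define c where "c = g * real k"
      show "(\<lambda>m. ln (2 + real m + g * real k) - ln (1 + real m + g * real k)) \<longlonglongrightarrow> 0"
        unfolding c_def[symmetric] by real_asymp
    qed
    then show "(\<lambda>m. D (2 + real m) - D (1 + real m)) \<longlonglongrightarrow> 0"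
      by (simp add: D_def sum_subtractf)
  qed fact
  then have "L a = L 1 + ((\<Sum>k<n. ln (Gamma (a + g * real k)) - ln (Gamma (1 + g * real k))) - real n * (a - 1) * ln b)"
    by (simp add: G_def sum_subtractf algebra_simps)
  then have "exp (L a) = exp (L 1) * (exp (\<Sum>k<n. ln (Gamma (a + g * real k)) - ln (Gamma (1 + g * real k))) * exp (- (real n * (a - 1) * ln b)))"
    by (simp flip: exp_add)
  moreover have "exp (L a) = selberg a b g I" "exp (L 1) = selberg 1 b g I"
    using selberg_pos[of I _ b g] assms by (auto simp: L_def)
  moreover have "exp (\<Sum>k<n. ln (Gamma (a + g * real k)) - ln (Gamma (1 + g * real k))) = 
     (\<Prod>k<n. Gamma (a + g * real k) / Gamma (1 + g * real k))"
  proof -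
    have "Gamma (a + g * real k) > 0" "Gamma (1 + g * real k) > 0" for k
      using assms by (auto intro!: Gamma_real_pos add_pos_nonneg)
    then show ?thesis by (simp add: exp_sum exp_diff)
  qed
  moreover have "exp (- (real n * (a - 1) * ln b)) = b powr (- (real n * (a - 1)))"
    using assms by (simp add: powr_def)
  ultimately show ?thesis by (simp add: n_def)
qed


section \<open>The Selberg-Laguerre integral\<close>

lemma nn_integral_Leb_translate:
  assumes "finite I" "f \<in> borel_measurable (Leb I)"
  shows "(\<integral>\<^sup>+x. f (\<lambda>i\<in>I. t + x i) \<partial>Leb I) = (\<integral>\<^sup>+x. f x \<partial>Leb I)"
proof -
  have "(\<lambda>x. \<lambda>i\<in>I. t + x i) \<in> Leb I \<rightarrow>\<^sub>M Leb I"
    by (intro measurable_restrict) simp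
  from nn_integral_distr[OF this, of f] assms(2) show ?thesis by (simp add: distr_Leb_translate assms(1))
qed

text \<open>
  As a product of indicators this is measurable by construction.
\<close>

definition min_at :: "'i \<Rightarrow> 'i set \<Rightarrow> ('i \<Rightarrow> real) \<Rightarrow> real" where
  "min_at p J x = (\<Prod>j\<in>J. indicator {0<..} (x j - x p))"

lemma min_at_01: "min_at p J x = 0 \<or> min_at p J x = 1"
  unfolding min_at_def by (induction J rule: infinite_finite_induct) (auto simp: indicator_def)

lemma min_at_eq_1_iff: "finite J \<Longrightarrow> min_at p J x = 1 \<longleftrightarrow> (\<forall>j\<in>J. x p < x j)"
proof -
  assume J: "finite J"
  show ?thesis
  proof
    assume "min_at p J x = 1"
    show "\<forall>j\<in>J. x p < x j"
    proof (rule ccontr)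
      assume "\<not> ?thesis"
      then obtain j where "j \<in> J" "\<not> x p < x j" by auto
      then have "min_at p J x = 0" unfolding min_at_def using J by (intro prod_zero bexI[of _ j]) auto
      with \<open>min_at p J x = 1\<close> show False by simp
    qed
  qed (auto simp: min_at_def)
qed

text \<open>
  For \<open>a = 1\<close> the only dependence on absolute position is exponential.  With \<open>t\<close> the smallest coordinate and the
  others measured from \<open>t\<close>, the differences to \<open>t\<close> become powers \<open>y\<^sub>i\<close> to the \<open>2g\<close>, which raises the Laguerre
  parameter of the remaining particles to \<open>1 + 2g\<close>.
\<close>

lemma laguerre_wt_shifted:
  fixes t :: real
  assumes J: "finite J" "p \<notin> J" and y: "y \<in> extensional J"
  defines "x \<equiv> (\<lambda>i\<in>J. t + y i)(p := t)"
  shows "min_at p J x * laguerre_wt 1 b g (insert p J) x =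
     indicator {0<..} t * exp (- (b * real (Suc (card J)) * t)) * laguerre_wt (1 + 2 * g) b g J y"
proof -
  have x: "x p = t" "\<And>j. j \<in> J \<Longrightarrow> x j = t + y j" using J by (auto simp: x_def)
  have V: "vandermonde_powr g J x = vandermonde_powr g J y"
    unfolding vandermonde_powr_def by (intro prod.cong refl) (auto simp: x)
  show ?thesis
  proof (cases "t > 0 \<and> (\<forall>j\<in>J. y j > 0)")
    case True
    have 1: "min_at p J x = 1" using True x J by (simp add: min_at_eq_1_iff)
    have "(\<Prod>i\<in>J. gamma_wt 1 b (x i)) * (\<Prod>j\<in>J. \<bar>t - x j\<bar> powr (2 * g)) =
        (\<Prod>i\<in>J. exp (- (b * t)) * (gamma_wt (1 + 2 * g) b (y i)))"
      unfolding prod.distrib[symmetric]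
    proof (intro prod.cong refl)
      fix i assume i: "i \<in> J"
      then have "y i > 0" "t > 0" using True by auto
      then show "gamma_wt 1 b (x i) * \<bar>t - x i\<bar> powr (2 * g) =
         exp (- (b * t)) * (gamma_wt (1 + 2 * g) b (y i))"
        using i by (simp add: x exp_diff ring_distribs exp_minus field_simps exp_add)
    qed
    also have "\<dots> = exp (- (b * t)) ^ card J * (\<Prod>i\<in>J. gamma_wt (1 + 2 * g) b (y i))"
      by (simp add: prod.distrib)
    finally have E: "(\<Prod>i\<in>J. gamma_wt 1 b (x i)) * (\<Prod>j\<in>J. \<bar>t - x j\<bar> powr (2 * g)) = \<dots>" .
    have "laguerre_wt 1 b g (insert p J) x = exp (- (b * t)) * ((\<Prod>i\<in>J. gamma_wt 1 b (x i)) * (\<Prod>j\<in>J. \<bar>t - x j\<bar> powr (2 * g))) * vandermonde_powr g J x"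
      unfolding laguerre_wt_def vandermonde_powr_insert[OF J] prod.insert[OF J] using True by (simp add: x)
    also have "\<dots> = exp (- (b * t)) ^ Suc (card J) * laguerre_wt (1 + 2 * g) b g J y"
      unfolding E V laguerre_wt_def by simp
    also have "exp (- (b * t)) ^ Suc (card J) = exp (- (b * real (Suc (card J)) * t))"
      by (simp add: exp_of_nat_mult[symmetric] algebra_simps flip: exp_add)
    finally show ?thesis using 1 True by simp
  next
    case False
    then consider "t \<le> 0" | j where "t > 0" "j \<in> J" "y j \<le> 0" by force
    then show ?thesis
    proof cases
      case 1
      then show ?thesis using laguerre_wt_eq_0[of p "insert p J" x] J x by simp
    next
      case 2
      then have "min_at p J x \<noteq> 1" using x J by (auto simp: min_at_eq_1_iff not_less intro!: bexI[of _ j])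
      then have "min_at p J x = 0" using min_at_01[of p J x] by blast
      then show ?thesis using laguerre_wt_eq_0[of j J y] 2 J by simp
    qed
  qed
qed

lemma integrable_min_at_laguerre_wt:
  assumes J: "finite J" "p \<notin> J" and "b > 0" "g \<ge> 0"
  shows "integrable (Leb (insert p J)) (\<lambda>x. min_at p J x * laguerre_wt 1 b g (insert p J) x)"
proof (rule Bochner_Integration.integrable_bound)
  show "integrable (Leb (insert p J)) (laguerre_wt 1 b g (insert p J))"
    using assms by (intro integrable_laguerre_wt) auto
  show "(\<lambda>x. min_at p J x * laguerre_wt 1 b g (insert p J) x) \<in> borel_measurable (Leb (insert p J))"
    unfolding min_at_def by measurable
  show "AE x in Leb (insert p J). norm (min_at p J x * laguerre_wt 1 b g (insert p J) x) \<le> norm (laguerre_wt 1 b g (insert p J) x)"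
  proof (rule AE_I2)
    fix x show "norm (min_at p J x * laguerre_wt 1 b g (insert p J) x) \<le> norm (laguerre_wt 1 b g (insert p J) x)"
      using min_at_01[of p J x] by auto
  qed
qed

lemma selberg_min_at:
  assumes J: "finite J" "p \<notin> J" and "b > 0" "g \<ge> 0"
  shows "(LINT x|Leb (insert p J). min_at p J x * laguerre_wt 1 b g (insert p J) x) =
    selberg (1 + 2 * g) b g J / (b * real (Suc (card J)))"
proof -
  define f where "f x = min_at p J x * laguerre_wt 1 b g (insert p J) x" for x
  define c where "c = b * real (Suc (card J))"
  have c: "c > 0" using assms by (simp add: c_def)
  have int_f: "integrable (Leb (insert p J)) f"
    unfolding f_def using assms by (rule integrable_min_at_laguerre_wt)
  then have [measurable]: "f \<in> borel_measurable (Leb (insert p J))" by simp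
  have f_nn: "f x \<ge> 0" for x
    using min_at_01[of p J x] laguerre_wt_nonneg[of 1 b g "insert p J" x] by (auto simp: f_def)
  have int_w: "integrable (Leb J) (laguerre_wt (1 + 2 * g) b g J)"
    using assms by (intro integrable_laguerre_wt) auto
  have "ennreal (LINT x|Leb (insert p J). f x) = (\<integral>\<^sup>+x. f x \<partial>Leb (insert p J))"
    using int_f f_nn by (intro nn_integral_eq_integral[symmetric]) auto
  also have "\<dots> = (\<integral>\<^sup>+t. (\<integral>\<^sup>+y. f (y(p := t)) \<partial>Leb J) \<partial>lborel)"
    using J by (intro lborel_prod.product_nn_integral_insert_rev) auto
  also have "\<dots> = (\<integral>\<^sup>+t. ennreal (indicator {0<..} t * exp (- (c * t))) * ennreal (selberg (1 + 2 * g) b g J) \<partial>lborel)"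
  proof (intro nn_integral_cong)
    fix t :: real
    have "(\<lambda>y. y(p := t)) \<in> Leb J \<rightarrow>\<^sub>M Leb (insert p J)"
      by (rule measurable_fun_upd[where J = J]) auto
    then have meas: "(\<lambda>y. ennreal (f (y(p := t)))) \<in> borel_measurable (Leb J)" by measurable
    have "(\<integral>\<^sup>+y. f (y(p := t)) \<partial>Leb J) = (\<integral>\<^sup>+y. f ((\<lambda>i\<in>J. t + y i)(p := t)) \<partial>Leb J)"
      using nn_integral_Leb_translate[OF J(1) meas, of t] by simp
    also have "\<dots> = (\<integral>\<^sup>+y. ennreal (indicator {0<..} t * exp (- (c * t))) * ennreal (laguerre_wt (1 + 2 * g) b g J y) \<partial>Leb J)"
    proof (intro nn_integral_cong)
      fix y assume "y \<in> space (Leb J)"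
      then have "y \<in> extensional J" by (auto simp: space_PiM PiE_def)
      from laguerre_wt_shifted[OF J this, of t b g]
      show "ennreal (f ((\<lambda>i\<in>J. t + y i)(p := t))) = ennreal (indicator {0<..} t * exp (- (c * t))) * ennreal (laguerre_wt (1 + 2 * g) b g J y)"
        by (simp add: f_def c_def ennreal_mult[symmetric] laguerre_wt_nonneg)
    qed
    also have "\<dots> = ennreal (indicator {0<..} t * exp (- (c * t))) * (\<integral>\<^sup>+y. laguerre_wt (1 + 2 * g) b g J y \<partial>Leb J)"
      by (intro nn_integral_cmult) measurable
    also have "(\<integral>\<^sup>+y. laguerre_wt (1 + 2 * g) b g J y \<partial>Leb J) = selberg (1 + 2 * g) b g J"
      unfolding selberg_def using int_w by (intro nn_integral_eq_integral) (auto simp: laguerre_wt_nonneg)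
    finally show "(\<integral>\<^sup>+y. f (y(p := t)) \<partial>Leb J) = ennreal (indicator {0<..} t * exp (- (c * t))) * ennreal (selberg (1 + 2 * g) b g J)" .
  qed
  also have "\<dots> = (\<integral>\<^sup>+t. ennreal (indicator {0<..} t * exp (- (c * t))) \<partial>lborel) * ennreal (selberg (1 + 2 * g) b g J)"
    by (intro nn_integral_multc) measurable
  also have "(\<integral>\<^sup>+t. ennreal (indicator {0<..} t * exp (- (c * t))) \<partial>lborel) = ennreal (1 / c)"
    using integrable_exp_halfline[OF c] by (subst nn_integral_eq_integral) (auto simp: integral_exp_halfline[OF c])
  also have "\<dots> * ennreal (selberg (1 + 2 * g) b g J) = ennreal (selberg (1 + 2 * g) b g J / c)"
    using c by (subst ennreal_mult'[symmetric]) auto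
  finally have "ennreal (LINT x|Leb (insert p J). f x) = ennreal (selberg (1 + 2 * g) b g J / c)" .
  moreover have "(LINT x|Leb (insert p J). f x) \<ge> 0" using f_nn by (intro integral_nonneg_AE AE_I2)
  moreover have "selberg (1 + 2 * g) b g J \<ge> 0" 
    unfolding selberg_def by (intro integral_nonneg_AE AE_I2 laguerre_wt_nonneg)
  ultimately have "(LINT x|Leb (insert p J). f x) = selberg (1 + 2 * g) b g J / c"
    using c by (simp add: ennreal_inj)
  then show ?thesis by (simp add: f_def c_def)
qed

text \<open>
  The weight vanishes at points with equal coordinates, so the smallest coordinate is unique
  wherever it matters.
\<close>

lemma laguerre_wt_eq_sum_min_at:
  assumes I: "finite I" "I \<noteq> {}"
  shows "laguerre_wt a b g I x = (\<Sum>p\<in>I. min_at p (I - {p}) x * laguerre_wt a b g I x)"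
proof (cases "laguerre_wt a b g I x = 0")
  case False
  then have ne: "x i \<noteq> x j" if "i \<in> I" "j \<in> I" "i \<noteq> j" for i j
    using laguerre_wt_tie[OF I(1) that] by blast
  obtain p where p: "p \<in> I" "\<And>j. j \<in> I \<Longrightarrow> x p \<le> x j"
    using ex_is_arg_min_if_finite[OF I, of x] by (auto simp: is_arg_min_linorder)
  have "min_at q (I - {q}) x = (if q = p then 1 else 0)" if "q \<in> I" for q
  proof (cases "q = p")
    case True
    then show ?thesis using p ne I by (force simp: min_at_eq_1_iff less_le)
  next
    case False
    then have "\<not> (\<forall>j\<in>I - {q}. x q < x j)" using p(1) p(2)[OF that] by (auto simp: not_less intro!: bexI[of _ p])
    then show ?thesis using False min_at_eq_1_iff[of "I - {q}" q x] min_at_01[of q "I - {q}" x] I by auto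
  qed
  then have "(\<Sum>q\<in>I. min_at q (I - {q}) x * laguerre_wt a b g I x) = (\<Sum>q\<in>I. if q = p then laguerre_wt a b g I x else 0)"
    by (intro sum.cong) auto
  also have "\<dots> = laguerre_wt a b g I x" using I p by simp
  finally show ?thesis by simp
qed simp

lemma selberg_1_eq:
  assumes I: "finite I" "I \<noteq> {}" and "b > 0" "g \<ge> 0"
  shows "selberg 1 b g I = (\<Sum>p\<in>I. selberg (1 + 2 * g) b g (I - {p}) / (b * real (card I)))"
proof -
  have *: "insert p (I - {p}) = I" "Suc (card (I - {p})) = card I" if "p \<in> I" for p
    using that card_Suc_Diff1[OF I(1) that] by (auto simp only: insert_Diff)
  have int: "integrable (Leb I) (\<lambda>x. min_at p (I - {p}) x * laguerre_wt 1 b g I x)" if "p \<in> I" for p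
    using integrable_min_at_laguerre_wt[of "I - {p}" p b g] assms unfolding *(1)[OF that] by simp
  have "selberg 1 b g I = (LINT x|Leb I. (\<Sum>p\<in>I. min_at p (I - {p}) x * laguerre_wt 1 b g I x))"
    unfolding selberg_def using laguerre_wt_eq_sum_min_at[OF I] by (intro Bochner_Integration.integral_cong) auto
  also have "\<dots> = (\<Sum>p\<in>I. LINT x|Leb I. min_at p (I - {p}) x * laguerre_wt 1 b g I x)"
    by (rule Bochner_Integration.integral_sum[OF int])
  also have "\<dots> = (\<Sum>p\<in>I. selberg (1 + 2 * g) b g (I - {p}) / (b * real (card I)))"
  proof (intro sum.cong refl)
    fix p assume p: "p \<in> I"
    show "(LINT x|Leb I. min_at p (I - {p}) x * laguerre_wt 1 b g I x) = selberg (1 + 2 * g) b g (I - {p}) / (b * real (card I))"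
      using selberg_min_at[of "I - {p}" p b g] assms unfolding *[OF p] by simp
  qed
  finally show ?thesis .
qed

text \<open>
  Induction on the number of particles.  In the step, \<open>selberg_1_eq\<close> gives the value at \<open>a = 1\<close>; the factors
  \<open>Gamma (1 + 2g + g k)\<close> of the smaller system cancel against the denominators from
  \<open>selberg_eq_selberg_1\<close> up to an index shift.
\<close>

theorem selberg_laguerre:
  assumes "finite I" "a \<ge> 1" "b > 0" "g > 1/2"
  shows "selberg a b g I = b powr (- (real (card I) * a + real (card I) * (real (card I) - 1) * g)) *
     (\<Prod>k<card I. Gamma (a + g * real k) * Gamma (1 + g * real (Suc k)) / Gamma (1 + g))"
  using assms(1,2)
proof (induction "card I" arbitrary: I a)
  case 0
  then have "I = {}" by simp
  then show ?case using assms(3) by (simp add: selberg_def laguerre_wt_def vandermonde_powr_def PiM_empty) 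
next
  case (Suc n)
  \<comment> \<open>The value of the smaller system at parameter \<open>1 + 2g\<close>.\<close>
  define S where "S = b powr (- (real n * (1 + 2 * g) + real n * (real n - 1) * g)) *
     (\<Prod>k<n. Gamma (1 + 2 * g + g * real k) * Gamma (1 + g * real (Suc k)) / Gamma (1 + g))"
  have n: "card I = Suc n" "I \<noteq> {}" using Suc.hyps(2) by auto
  note I = Suc.prems
  have Gpos: "Gamma (c + g * real k) > 0" if "c > 0" for c k
    using assms that by (intro Gamma_real_pos add_pos_nonneg) auto
  have "selberg 1 b g I = (\<Sum>p\<in>I. S / (b * real (card I)))"
  proof (subst selberg_1_eq)
    show "(\<Sum>p\<in>I. selberg (1 + 2 * g) b g (I - {p}) / (b * real (card I))) = (\<Sum>p\<in>I. S / (b * real (card I)))"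
    proof (intro sum.cong refl)
      fix p assume "p \<in> I"
      then have "card (I - {p}) = n" using n I by simp
      then have "selberg (1 + 2 * g) b g (I - {p}) = S"
        using Suc.hyps(1)[of "I - {p}" "1 + 2 * g"] I assms(4) by (simp add: S_def)
      then show "selberg (1 + 2 * g) b g (I - {p}) / (b * real (card I)) = S / (b * real (card I))" by simp
    qed
  qed (use assms(3,4) I n in auto)
  also have "\<dots> = S / b" using n by simp
  finally have S1: "selberg 1 b g I = S / b" .
  have "selberg a b g I = S / b * (\<Prod>k<Suc n. Gamma (a + g * real k) / Gamma (1 + g * real k)) * b powr (- (real (Suc n) * (a - 1)))"
    by (subst selberg_eq_selberg_1[OF I assms(3,4)]) (simp only: S1 n)
  also have "\<dots> = (b powr (- (real n * (1 + 2 * g) + real n * (real n - 1) * g)) * b powr (-1) * b powr (- (real (Suc n) * (a - 1)))) *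
      ((\<Prod>k<n. Gamma (1 + 2 * g + g * real k)) * (\<Prod>k<n. Gamma (1 + g * real (Suc k)) / Gamma (1 + g)) *
       (\<Prod>k<Suc n. Gamma (a + g * real k) / Gamma (1 + g * real k)))"
    using assms by (simp add: S_def prod.distrib prod_dividef powr_minus field_simps)
  also have "b powr (- (real n * (1 + 2 * g) + real n * (real n - 1) * g)) * b powr (-1) * b powr (- (real (Suc n) * (a - 1))) =
     b powr (- (real (Suc n) * a + real (Suc n) * (real (Suc n) - 1) * g))"
    unfolding powr_add[symmetric] by (rule arg_cong[where f = "\<lambda>x. b powr x"]) (simp add: algebra_simps)
  also have "(\<Prod>k<n. Gamma (1 + 2 * g + g * real k)) * (\<Prod>k<n. Gamma (1 + g * real (Suc k)) / Gamma (1 + g)) *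
       (\<Prod>k<Suc n. Gamma (a + g * real k) / Gamma (1 + g * real k)) = 
     (\<Prod>k<Suc n. Gamma (a + g * real k) * Gamma (1 + g * real (Suc k)) / Gamma (1 + g))"
  proof -
    have 1: "(\<Prod>k<Suc n. Gamma (1 + g * real k)) = (\<Prod>k<n. Gamma (1 + g * real (Suc k)))"
      by (subst prod.lessThan_Suc_shift) simp
    have 2: "(\<Prod>k<n. Gamma (1 + 2 * g + g * real k)) * Gamma (1 + g) = (\<Prod>k<Suc n. Gamma (1 + g * real (Suc k)))"
      unfolding prod.lessThan_Suc_shift[of "\<lambda>k. Gamma (1 + g * real (Suc k))"] by (simp add: algebra_simps)
    have pos: "(\<Prod>k<n. Gamma (1 + g * real (Suc k))) \<noteq> 0" "Gamma (1 + g) \<noteq> 0"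
      using Gpos[of 1, THEN less_imp_neq[THEN not_sym]] Gpos[of 1 1] by (auto simp del: of_nat_Suc) simp
    show ?thesis unfolding prod_dividef prod.distrib 1 2[symmetric] 
      using pos by (simp add: field_simps)
  qed
  finally show ?case by (simp only: n)
qed


section \<open>The trigamma function in the right half-plane\<close>

text \<open>
  Compare \<open>1 / (w + k + 1)\<^sup>2\<close> with the increments of \<open>1/w - 1/(2w\<^sup>2)\<close>; the difference is half the square of
  \<open>1/(w + k) - 1/(w + k + 1)\<close>.
\<close>

lemma trigamma_remainder_sums:
  fixes w :: complex
  assumes "Re w > 0"
  shows "(\<lambda>k. 1 / (2 * ((w + of_nat k) * (w + of_nat k + 1))\<^sup>2)) sums (Polygamma 1 (1 + w) - (1 / w - 1 / (2 * w\<^sup>2)))"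
proof -
  define f where "f k = 1 / (w + of_nat k) - 1 / (2 * (w + of_nat k)\<^sup>2)" for k
  have ne: "w + of_nat k \<noteq> 0" "w + of_nat k + 1 \<noteq> 0" for k
    using assms by (auto simp: complex_eq_iff)
  have "filterlim (\<lambda>k. w + of_nat k) at_infinity sequentially"
    by (intro tendsto_add_filterlim_at_infinity[OF tendsto_const] tendsto_of_nat)
  then have inv: "(\<lambda>k. 1 / (w + of_nat k)) \<longlonglongrightarrow> 0"
    by (intro tendsto_divide_0[OF tendsto_const])
  have "f \<longlonglongrightarrow> 0 - (1/2) * 0\<^sup>2"
    unfolding f_def using tendsto_diff[OF inv tendsto_mult[OF tendsto_const[of "1/2"] tendsto_power[OF inv, of 2]]]
    by (simp add: power_one_over)
  then have "f \<longlonglongrightarrow> 0" by simp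
  then have "(\<lambda>k. f k - f (Suc k)) sums (f 0 - 0)" by (rule telescope_sums')
  moreover have "(\<lambda>k. inverse ((1 + w + of_nat k) ^ Suc 1)) sums ((-1) ^ Suc 1 * Polygamma 1 (1 + w) / fact 1)"
    using assms by (intro Polygamma_LIMSEQ) (auto simp: complex_eq_iff)
  from sums_diff[OF this calculation] have "(\<lambda>k. inverse ((1 + w + of_nat k) ^ Suc 1) - (f k - f (Suc k))) sums 
      ((-1) ^ Suc 1 * Polygamma 1 (1 + w) / fact 1 - (f 0 - 0))" .
  moreover have "inverse ((1 + w + of_nat k) ^ Suc 1) - (f k - f (Suc k)) = 1 / (2 * ((w + of_nat k) * (w + of_nat k + 1))\<^sup>2)" for k
  proof -
    define z where "z = w + of_nat k"
    have z: "z \<noteq> 0" "z + 1 \<noteq> 0" using ne[of k] by (auto simp: z_def)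
    have e: "f k = 1 / z - 1 / (2 * z\<^sup>2)" "f (Suc k) = 1 / (z + 1) - 1 / (2 * (z + 1)\<^sup>2)" "1 + w + of_nat k = z + 1"
      by (auto simp: f_def z_def add_ac)
    have d: "1 / z - 1 / (z + 1) = 1 / (z * (z + 1))" using z by (simp add: field_simps)
    have "inverse ((z + 1) ^ Suc 1) - (1 / z - 1 / (2 * z\<^sup>2) - (1 / (z + 1) - 1 / (2 * (z + 1)\<^sup>2))) = (1 / z - 1 / (z + 1))\<^sup>2 / 2"
      using z by (simp add: divide_simps power2_eq_square) (simp add: algebra_simps)
    also have "\<dots> = 1 / (2 * (z * (z + 1))\<^sup>2)" unfolding d by (simp add: power_divide)
    finally show ?thesis unfolding e z_def by simp
  qed
  ultimately show ?thesis by (simp add: f_def)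
qed

text \<open>
  Each term of the remainder series is dominated by the product of its largest factor, taken at
  \<open>k = 0\<close>, with a telescoping term.
\<close>

lemma trigamma_asymp_bound:
  fixes w :: complex
  assumes "Re w > 0"
  shows "norm (Polygamma 1 (1 + w) - (1 / w - 1 / (2 * w\<^sup>2))) \<le> 1 / (2 * (Re w)\<^sup>2 * (Re w + 1))"
proof -
  define v where "v = Re w"
  have v: "v > 0" using assms by (simp add: v_def)
  define e where "e k = (1 / (2 * v * (v + 1))) * (1 / (v + real k) - 1 / (v + real (Suc k)))" for k
  have "(\<lambda>k. 1 / (v + real k)) \<longlonglongrightarrow> 0" by real_asymp
  then have "(\<lambda>k. 1 / (v + real k) - 1 / (v + real (Suc k))) sums (1 / (v + real 0) - 0)" by (rule telescope_sums')
  then have "e sums ((1 / (2 * v * (v + 1))) * (1 / (v + real 0) - 0))" unfolding e_def by (rule sums_mult)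
  then have e: "e sums (1 / (2 * v\<^sup>2 * (v + 1)))" by (simp add: power2_eq_square mult_ac)
  have "norm (1 / (2 * ((w + of_nat k) * (w + of_nat k + 1))\<^sup>2)) \<le> e k" for k
  proof -
    have 1: "v + real k \<le> norm (w + of_nat k)" "v + real k + 1 \<le> norm (w + of_nat k + 1)"
      using complex_Re_le_cmod[of "w + of_nat k"] complex_Re_le_cmod[of "w + of_nat k + 1"] by (auto simp: v_def)
    have "v * (v + 1) * ((v + real k) * (v + real k + 1)) \<le> (norm (w + of_nat k) * norm (w + of_nat k + 1)) * (norm (w + of_nat k) * norm (w + of_nat k + 1))"
      using 1 v by (intro mult_mono) (auto intro: order.trans[OF _ 1(1)] order.trans[OF _ 1(2)])
    then have "1 / (2 * (norm (w + of_nat k) * norm (w + of_nat k + 1))\<^sup>2) \<le> 1 / (2 * (v * (v + 1) * ((v + real k) * (v + real k + 1))))"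
      using v by (intro divide_left_mono mult_pos_pos) (auto simp: power2_eq_square intro!: mult_pos_pos order.strict_trans2[OF _ 1(1)] order.strict_trans2[OF _ 1(2)])
    also have "\<dots> = e k" using v by (simp add: e_def divide_simps)
    finally show ?thesis by (simp add: norm_divide norm_mult norm_power)
  qed
  then have "norm (\<Sum>k. 1 / (2 * ((w + of_nat k) * (w + of_nat k + 1))\<^sup>2)) \<le> suminf e"
    by (rule norm_suminf_le) (rule sums_summable[OF e])
  then show ?thesis using sums_unique[OF trigamma_remainder_sums[OF assms]] sums_unique[OF e] 
    by (simp add: v_def)
qed

lemma trigamma_real_bound:
  fixes u :: real
  assumes "u > 0"
  shows "\<bar>Polygamma 1 (1 + u) - (1 / u - 1 / (2 * u\<^sup>2))\<bar> \<le> 1 / (2 * u\<^sup>2 * (u + 1))"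
proof -
  have "Polygamma 1 (1 + complex_of_real u) - (1 / complex_of_real u - 1 / (2 * (complex_of_real u)\<^sup>2)) =
      of_real (Polygamma 1 (1 + u) - (1 / u - 1 / (2 * u\<^sup>2)))"
    using assms Polygamma_of_real[of "1 + u" 1, where 'a = complex] by simp
  with trigamma_asymp_bound[of "of_real u"] assms show ?thesis
    by (simp only: norm_of_real Re_complex_of_real)
qed

text \<open>
  This strict bound is what makes the limiting variance positive.
\<close>

lemma trigamma_less_inverse:
  fixes u :: real
  assumes "u > 0"
  shows "Polygamma 1 (1 + u) < 1 / u"
proof -
  have "1 / (2 * u\<^sup>2 * (u + 1)) < 1 / (2 * u\<^sup>2)"
    using assms by (intro divide_strict_left_mono) auto
  then show ?thesis using trigamma_real_bound[OF assms] by (simp add: abs_le_iff)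
qed


section \<open>Stirling's formula\<close>

definition stirling_approx :: "nat \<Rightarrow> real" where
  "stirling_approx n = real n * ln (real n) - real n + ln (2 * pi * real n) / 2"

text \<open>
  The error in Stirling's formula after applying \<open>u d/du - 1\<close>, which annihilates
  multiples of \<open>u\<close>.
\<close>

definition digamma_defect :: "real \<Rightarrow> real" where
  "digamma_defect u = u * Digamma (1 + u) - ln_Gamma (1 + u) - (u + 1 / 2 - ln (2 * pi * u) / 2)"

lemma has_field_derivative_digamma_defect:
  assumes "u > 0"
  shows "(digamma_defect has_real_derivative u * (Polygamma 1 (1 + u) - (1 / u - 1 / (2 * u\<^sup>2)))) (at u)"
proof -
  have 1: "1 + u \<notin> \<int>\<^sub>\<le>\<^sub>0" using assms by (auto elim!: nonpos_Ints_cases)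
  have "((\<lambda>u. u * Digamma (1 + u) - ln_Gamma (1 + u) - (u + 1 / 2 - ln (2 * pi * u) / 2)) has_real_derivative
     (Digamma (1 + u) + u * Polygamma 1 (1 + u) - Digamma (1 + u) - (1 - 1 / u / 2))) (at u)"
    using assms 1 by (auto intro!: derivative_eq_intros simp: field_simps)
  also have "Digamma (1 + u) + u * Polygamma 1 (1 + u) - Digamma (1 + u) - (1 - 1 / u / 2) = 
     u * (Polygamma 1 (1 + u) - (1 / u - 1 / (2 * u\<^sup>2)))"
    using assms by (simp add: field_simps power2_eq_square)
  finally show ?thesis unfolding digamma_defect_def[abs_def] .
qed

lemma digamma_defect_deriv_bound:
  fixes u :: real
  assumes "u > 0"
  shows "\<bar>u * (Polygamma 1 (1 + u) - (1 / u - 1 / (2 * u\<^sup>2)))\<bar> \<le> 1 / (2 * u\<^sup>2)"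
proof -
  have "\<bar>u * (Polygamma 1 (1 + u) - (1 / u - 1 / (2 * u\<^sup>2)))\<bar> \<le> u * (1 / (2 * u\<^sup>2 * (u + 1)))"
    unfolding abs_mult using trigamma_real_bound[OF assms] assms by (intro mult_mono) auto
  also have "\<dots> = 1 / (2 * u\<^sup>2) * (u / (u + 1))" by simp
  also have "\<dots> \<le> 1 / (2 * u\<^sup>2) * 1" using assms by (intro mult_left_mono) auto
  finally show ?thesis by simp
qed

text \<open>
  The derivative of the error is bounded by that of \<open>1 / (2u)\<close>, so adding or subtracting this function
  gives a monotone function.
\<close>

lemma digamma_defect_mono:
  assumes "0 < u" "u \<le> v"
  shows "digamma_defect v + 1 / (2 * v) \<le> digamma_defect u + 1 / (2 * u)"
    and "digamma_defect u - 1 / (2 * u) \<le> digamma_defect v - 1 / (2 * v)"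
proof -
  have inv: "((\<lambda>x. 1 / (2 * x)) has_real_derivative - (1 / (2 * x\<^sup>2))) (at x)" if "x > 0" for x :: real
    using that by (auto intro!: derivative_eq_intros simp: power2_eq_square)
  show "digamma_defect v + 1 / (2 * v) \<le> digamma_defect u + 1 / (2 * u)"
  proof (rule DERIV_nonpos_imp_nonincreasing[OF assms(2)])
    fix x assume "u \<le> x" "x \<le> v"
    then have "x > 0" using assms by simp
    from DERIV_add[OF has_field_derivative_digamma_defect[OF this] inv[OF this]] digamma_defect_deriv_bound[OF this]
    show "\<exists>y. ((\<lambda>x. digamma_defect x + 1 / (2 * x)) has_real_derivative y) (at x) \<and> y \<le> 0"
      by (intro exI conjI) (assumption, simp only: abs_le_iff, linarith)
  qed
  show "digamma_defect u - 1 / (2 * u) \<le> digamma_defect v - 1 / (2 * v)"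
  proof (rule DERIV_nonneg_imp_nondecreasing[OF assms(2)])
    fix x assume "u \<le> x" "x \<le> v"
    then have "x > 0" using assms by simp
    from DERIV_diff[OF has_field_derivative_digamma_defect[OF this] inv[OF this]] digamma_defect_deriv_bound[OF this]
    show "\<exists>y. ((\<lambda>x. digamma_defect x - 1 / (2 * x)) has_real_derivative y) (at x) \<and> y \<ge> 0"
      by (intro exI conjI) (assumption, simp only: abs_le_iff, linarith)
  qed
qed

lemma digamma_defect_convergent: "convergent (\<lambda>n. digamma_defect (real n))"
proof -
  define a where "a n = digamma_defect (real (Suc n)) - 1 / (2 * real (Suc n))" for n
  have "incseq a" unfolding a_def by (intro monoI digamma_defect_mono(2)) auto
  moreover have "a n \<le> digamma_defect 1 + 1 / 2" for n
  proof -
    have "a n \<le> digamma_defect (real (Suc n)) + 1 / (2 * real (Suc n))" by (simp add: a_def add_nonneg_nonneg)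
    also have "\<dots> \<le> digamma_defect 1 + 1 / (2 * 1)" by (intro digamma_defect_mono(1)) auto
    finally show ?thesis by simp
  qed
  ultimately obtain L where "a \<longlonglongrightarrow> L" using incseq_convergent[of a "digamma_defect 1 + 1/2"] by blast
  moreover have "(\<lambda>n. 1 / (2 * real (Suc n))) \<longlonglongrightarrow> 0" by real_asymp
  ultimately have "(\<lambda>n. a n + 1 / (2 * real (Suc n))) \<longlonglongrightarrow> L + 0" by (rule tendsto_add)
  then have "(\<lambda>n. digamma_defect (real (Suc n))) \<longlonglongrightarrow> L" by (simp add: a_def)
  then show ?thesis using filterlim_sequentially_Suc[of "\<lambda>n. digamma_defect (real n)"] by (auto simp: convergent_def)
qed

lemma wallis_closed_form:
  "(\<Prod>k=1..n. (4 * real k ^ 2) / (4 * real k ^ 2 - 1)) = 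
     (2 ^ (4 * n) * fact n ^ 4) / ((fact (2 * n))\<^sup>2 * (2 * real n + 1))"
proof (induction n)
  case (Suc n)
  have f: "fact (2 * Suc n) = (2 * real n + 2) * ((2 * real n + 1) * fact (2 * n))"
    by (simp add: algebra_simps)
  have g: "fact (Suc n) = (real n + 1) * fact n" by (simp add: algebra_simps)
  have h: "4 * real (Suc n) ^ 2 - 1 = (2 * real n + 1) * (2 * real n + 3)"
    by (simp add: power2_eq_square algebra_simps)
  have pos: "2 * real n + 1 > 0" "2 * real n + 3 > 0" "real n + 1 > 0" "fact (2 * n) > (0::real)" by auto
  have "(\<Prod>k=1..Suc n. (4 * real k ^ 2) / (4 * real k ^ 2 - 1)) =
    (2 ^ (4 * n) * fact n ^ 4) / ((fact (2 * n))\<^sup>2 * (2 * real n + 1)) * ((4 * (real n + 1) ^ 2) / ((2 * real n + 1) * (2 * real n + 3)))"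
    using Suc h by (simp add: add_ac)
  also have "\<dots> = (2 ^ (4 * Suc n) * fact (Suc n) ^ 4) / ((fact (2 * Suc n))\<^sup>2 * (2 * real (Suc n) + 1))"
  proof -
    have "(P * F ^ 4) / (H\<^sup>2 * m) * ((4 * y\<^sup>2) / (m * k)) = (P * 16 * (y * F) ^ 4) / ((2 * y * (m * H))\<^sup>2 * k)"
      if "y \<noteq> 0" "m \<noteq> 0" "k \<noteq> 0" "H \<noteq> 0" for P F H y m k :: real
      using that by (simp add: divide_simps) (simp add: power2_eq_square power4_eq_xxxx algebra_simps)
    from this[of "real n + 1" "2 * real n + 1" "2 * real n + 3" "fact (2 * n)" "2 ^ (4 * n)" "fact n"] pos
    show ?thesis unfolding f g by (simp add: power_add algebra_simps)
  qed
  finally show ?case .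
qed simp


text \<open>
  At integers the digamma function is a harmonic number, and the bounds for Euler's constant give
  \<open>n (\<psi>(1+n) - ln n) \<longlonglongrightarrow> 1/2\<close>.
\<close>

lemma stirling_fact_defect:
  "(\<lambda>n. (ln (fact n) - stirling_approx n) + digamma_defect (real n)) \<longlonglongrightarrow> 0"
proof -
  define e where "e n = real n * Digamma (1 + real n) - real n * ln (real n)" for n
  have lim: "e \<longlonglongrightarrow> 1 / 2"
  proof (rule real_tendsto_sandwich)
    have b: "real n * (ln (real (Suc n)) - 1 / (2 * real n)) - real n * ln (real n) \<le> e n"
            "e n \<le> real n * (ln (real (Suc n)) - 1 / (2 * (real n + 1))) - real n * ln (real n)" if "n \<ge> 1" for n
    proof -
      have D: "Digamma (1 + real n) = harm n - euler_mascheroni"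
        using Digamma_of_nat[of n, where 'a = real] by (simp add: add_ac)
      have "ln (real (Suc n)) - 1 / (2 * real n) \<le> Digamma (1 + real n)"
           "Digamma (1 + real n) \<le> ln (real (Suc n)) - 1 / (2 * (real n + 1))"
        using euler_mascheroni_bounds[OF that] unfolding D by (auto simp: field_simps inverse_eq_divide)
      then show "real n * (ln (real (Suc n)) - 1 / (2 * real n)) - real n * ln (real n) \<le> e n"
            "e n \<le> real n * (ln (real (Suc n)) - 1 / (2 * (real n + 1))) - real n * ln (real n)"
        unfolding e_def by (auto intro!: diff_right_mono mult_left_mono)
    qed
    show "\<forall>\<^sub>F n in sequentially. real n * (ln (real (Suc n)) - 1 / (2 * real n)) - real n * ln (real n) \<le> e n"
      using eventually_ge_at_top[of 1] by eventually_elim (rule b)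
    show "\<forall>\<^sub>F n in sequentially. e n \<le> real n * (ln (real (Suc n)) - 1 / (2 * (real n + 1))) - real n * ln (real n)"
      using eventually_ge_at_top[of 1] by eventually_elim (rule b)
    show "(\<lambda>n. real n * (ln (real (Suc n)) - 1 / (2 * real n)) - real n * ln (real n)) \<longlonglongrightarrow> 1 / 2"
      by real_asymp
    show "(\<lambda>n. real n * (ln (real (Suc n)) - 1 / (2 * (real n + 1))) - real n * ln (real n)) \<longlonglongrightarrow> 1 / 2"
      by real_asymp
  qed
  have "(ln (fact n) - stirling_approx n) + digamma_defect (real n) = e n - 1 / 2" for n
  proof -
    have "ln_Gamma (1 + real n) = ln (fact n)"
      using ln_Gamma_real_conv_fact[of "Suc n"] by (simp add: add_ac)
    then show ?thesis by (simp add: stirling_approx_def digamma_defect_def e_def)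
  qed
  then show ?thesis using tendsto_diff[OF lim tendsto_const[of "1/2"]] by simp
qed

text \<open>
  The limit \<open>c\<close> exists by monotonicity.  Its value follows from Wallis' product, whose logarithm is
  \<open>4 ln n! - 2 ln (2n)!\<close> up to elementary terms, hence contains \<open>c\<close> with coefficient \<open>-4 + 2\<close>.
\<close>

lemma digamma_defect_tendsto_0: "(\<lambda>n. digamma_defect (real n)) \<longlonglongrightarrow> 0"
proof -
  obtain c where c: "(\<lambda>n. digamma_defect (real n)) \<longlonglongrightarrow> c"
    using digamma_defect_convergent by (auto simp: convergent_def)
  define s where "s n = ln (fact n) - stirling_approx n" for n
  have s: "s \<longlonglongrightarrow> - c"
    using tendsto_diff[OF stirling_fact_defect c] by (simp add: s_def[abs_def])
  have s2: "(\<lambda>n. s (2 * n)) \<longlonglongrightarrow> - c"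
    using filterlim_compose[OF s, of "\<lambda>n. 2 * n" sequentially] 
    by (simp add: filterlim_subseq strict_mono_def)
  have w: "(\<lambda>n. ln (\<Prod>k=1..n. (4 * real k ^ 2) / (4 * real k ^ 2 - 1))) \<longlonglongrightarrow> ln (pi / 2)"
    by (intro tendsto_ln wallis) auto
  have eq: "ln (\<Prod>k=1..n. (4 * real k ^ 2) / (4 * real k ^ 2 - 1)) = 
      4 * s n - 2 * s (2 * n) + (ln (pi * real n) - ln (2 * real n + 1))" if "n \<ge> 1" for n
  proof -
    have "ln (\<Prod>k=1..n. (4 * real k ^ 2) / (4 * real k ^ 2 - 1)) = 
        4 * real n * ln 2 + 4 * ln (fact n) - (2 * ln (fact (2 * n)) + ln (2 * real n + 1))"
      unfolding wallis_closed_form by (simp add: ln_div ln_mult ln_realpow)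
    moreover have "4 * stirling_approx n - 2 * stirling_approx (2 * n) + 4 * real n * ln 2 = ln (pi * real n)"
    proof -
      have "ln (4::real) = 2 * ln 2" using ln_realpow[of 2 2] by simp
      then show ?thesis using that by (simp add: stirling_approx_def ln_mult algebra_simps)
    qed
    ultimately show ?thesis by (simp add: s_def algebra_simps)
  qed
  have "(\<lambda>n. 4 * s n - 2 * s (2 * n) + (ln (pi * real n) - ln (2 * real n + 1))) \<longlonglongrightarrow> 4 * (- c) - 2 * (- c) + ln (pi / 2)"
  proof (intro tendsto_intros s s2)
    show "(\<lambda>n. ln (pi * real n) - ln (2 * real n + 1)) \<longlonglongrightarrow> ln (pi / 2)" 
      using pi_gt_zero by (real_asymp simp: ln_div)
  qed
  then have "(\<lambda>n. ln (\<Prod>k=1..n. (4 * real k ^ 2) / (4 * real k ^ 2 - 1))) \<longlonglongrightarrow> 4 * (- c) - 2 * (- c) + ln (pi / 2)"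
    by (rule Lim_transform_eventually) (use eventually_ge_at_top[of 1] in \<open>eventually_elim, simp only: eq\<close>)
  from LIMSEQ_unique[OF this w] have "c = 0" by simp
  with c show ?thesis by simp
qed

lemma digamma_defect_bound:
  assumes "u > 0"
  shows "\<bar>digamma_defect u\<bar> \<le> 1 / (2 * u)"
proof -
  have inv: "(\<lambda>n. 1 / (2 * real n)) \<longlonglongrightarrow> 0" by real_asymp
  have ev: "\<forall>\<^sub>F n in sequentially. u \<le> real n"
    using filterlim_real_sequentially by (simp add: filterlim_at_top)
  have "(\<lambda>n. digamma_defect (real n) + 1 / (2 * real n)) \<longlonglongrightarrow> 0 + 0"
    by (intro tendsto_add digamma_defect_tendsto_0 inv)
  moreover have "\<forall>\<^sub>F n in sequentially. digamma_defect (real n) + 1 / (2 * real n) \<le> digamma_defect u + 1 / (2 * u)"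
    using ev by eventually_elim (intro digamma_defect_mono(1) assms)
  ultimately have 1: "0 + 0 \<le> digamma_defect u + 1 / (2 * u)"
    by (rule tendsto_upperbound) simp
  have "(\<lambda>n. digamma_defect (real n) - 1 / (2 * real n)) \<longlonglongrightarrow> 0 - 0"
    by (intro tendsto_diff digamma_defect_tendsto_0 inv)
  moreover have "\<forall>\<^sub>F n in sequentially. digamma_defect (real n) - 1 / (2 * real n) \<ge> digamma_defect u - 1 / (2 * u)"
    using ev by eventually_elim (intro digamma_defect_mono(2) assms)
  ultimately have 2: "0 - 0 \<ge> digamma_defect u - 1 / (2 * u)"
    by (rule tendsto_lowerbound) simp
  show ?thesis using 1 2 by (simp add: abs_le_iff)
qed


section \<open>The second derivative of the log-partition function\<close>

definition lower_shift :: "real \<Rightarrow> real \<Rightarrow> nat \<Rightarrow> nat \<Rightarrow> real" where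
  "lower_shift b \<theta> n j = b * (real n * (\<theta> - 1) + real j)"

definition scale_exponent :: "real \<Rightarrow> real \<Rightarrow> nat \<Rightarrow> real" where
  "scale_exponent b \<theta> n = b * (\<theta> * (real n)\<^sup>2 - real n)"

text \<open>
  For \<open>b = \<beta> / 2\<close> this is the logarithm of the Selberg product for the inverse temperature \<open>\<beta> x\<close>.
\<close>

definition log_partition :: "real \<Rightarrow> real \<Rightarrow> nat \<Rightarrow> complex \<Rightarrow> complex" where
  "log_partition b \<theta> n x =
     - (of_nat n + of_real (scale_exponent b \<theta> n) * x) * (Ln x + of_real (ln (b * real n * \<theta>)))
     + (\<Sum>j<n. ln_Gamma (1 + of_real (lower_shift b \<theta> n j) * x) + ln_Gamma (1 + of_real (b * real (Suc j)) * x))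
     - of_nat n * ln_Gamma (1 + of_real b * x)"

definition log_partition' :: "real \<Rightarrow> real \<Rightarrow> nat \<Rightarrow> complex \<Rightarrow> complex" where
  "log_partition' b \<theta> n x =
     - of_real (scale_exponent b \<theta> n) * (Ln x + of_real (ln (b * real n * \<theta>))) 
     - of_nat n / x - of_real (scale_exponent b \<theta> n)
     + (\<Sum>j<n. of_real (lower_shift b \<theta> n j) * Digamma (1 + of_real (lower_shift b \<theta> n j) * x) 
           + of_real (b * real (Suc j)) * Digamma (1 + of_real (b * real (Suc j)) * x))
     - of_nat n * (of_real b * Digamma (1 + of_real b * x))"

definition log_partition'' :: "real \<Rightarrow> real \<Rightarrow> nat \<Rightarrow> complex \<Rightarrow> complex" where
  "log_partition'' b \<theta> n x =
     - of_real (scale_exponent b \<theta> n) / x + of_nat n / x\<^sup>2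
     + (\<Sum>j<n. (of_real (lower_shift b \<theta> n j))\<^sup>2 * Polygamma 1 (1 + of_real (lower_shift b \<theta> n j) * x) 
           + (of_real (b * real (Suc j)))\<^sup>2 * Polygamma 1 (1 + of_real (b * real (Suc j)) * x))
     - of_nat n * ((of_real b)\<^sup>2 * Polygamma 1 (1 + of_real b * x))"

lemma one_plus_mult_not_nonpos:
  fixes x :: complex
  assumes "u \<ge> 0" "Re x > 0"
  shows "1 + of_real u * x \<notin> \<real>\<^sub>\<le>\<^sub>0" "1 + of_real u * x \<notin> \<int>\<^sub>\<le>\<^sub>0"
proof -
  have "Re (1 + of_real u * x) > 0" using assms by (simp add: add_pos_nonneg)
  then show "1 + of_real u * x \<notin> \<real>\<^sub>\<le>\<^sub>0" by (auto simp: complex_nonpos_Reals_iff)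
  then show "1 + of_real u * x \<notin> \<int>\<^sub>\<le>\<^sub>0" using nonpos_Ints_subset_nonpos_Reals by blast
qed

lemma deriv_ln_Gamma_affine:
  fixes x :: complex
  assumes "u \<ge> 0" "Re x > 0"
  shows "((\<lambda>x. ln_Gamma (1 + of_real u * x)) has_field_derivative of_real u * Digamma (1 + of_real u * x)) (at x)"
    and "((\<lambda>x. of_real u * Polygamma n (1 + of_real u * x)) has_field_derivative (of_real u)\<^sup>2 * Polygamma (Suc n) (1 + of_real u * x)) (at x)"
  using one_plus_mult_not_nonpos[OF assms] 
  by (auto intro!: derivative_eq_intros simp: power2_eq_square)

lemma lower_shift_nonneg: "b > 0 \<Longrightarrow> \<theta> \<ge> 1 \<Longrightarrow> lower_shift b \<theta> n j \<ge> 0"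
  by (simp add: lower_shift_def)

lemma deriv_log_partition:
  assumes "b > 0" "\<theta> \<ge> 1" "Re x > 0"
  shows "(log_partition b \<theta> n has_field_derivative log_partition' b \<theta> n x) (at x)"
    and "(log_partition' b \<theta> n has_field_derivative log_partition'' b \<theta> n x) (at x)"
proof -
  have x: "x \<noteq> 0" "x \<notin> \<real>\<^sub>\<le>\<^sub>0" using assms by (auto simp: complex_nonpos_Reals_iff)
  note d = deriv_ln_Gamma_affine[OF _ assms(3)]
  have Ln: "(Ln has_field_derivative 1 / x) (at x)" 
    using x by (auto intro!: derivative_eq_intros simp: field_simps)
  define c l where "c = complex_of_real (scale_exponent b \<theta> n)" and "l = complex_of_real (ln (b * real n * \<theta>))"
  have "((\<lambda>x. - (of_nat n + c * x) * (Ln x + l)) has_field_derivative - c * (Ln x + l) - of_nat n / x - c) (at x)"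
    using x by (auto intro!: derivative_eq_intros Ln simp: field_simps)
  moreover have "((\<lambda>x. \<Sum>j<n. ln_Gamma (1 + of_real (lower_shift b \<theta> n j) * x) + ln_Gamma (1 + of_real (b * real (Suc j)) * x))
      has_field_derivative (\<Sum>j<n. of_real (lower_shift b \<theta> n j) * Digamma (1 + of_real (lower_shift b \<theta> n j) * x) 
           + of_real (b * real (Suc j)) * Digamma (1 + of_real (b * real (Suc j)) * x))) (at x)"
    using assms by (intro DERIV_sum DERIV_add d(1)) (auto simp: lower_shift_nonneg)
  moreover have "((\<lambda>x. of_nat n * ln_Gamma (1 + of_real b * x)) has_field_derivative of_nat n * (of_real b * Digamma (1 + of_real b * x))) (at x)"
    using assms by (intro DERIV_cmult d(1)) auto
  ultimately show "(log_partition b \<theta> n has_field_derivative log_partition' b \<theta> n x) (at x)"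
    unfolding log_partition_def[abs_def] log_partition'_def c_def l_def by (intro DERIV_diff DERIV_add)
  have "((\<lambda>x. - c * (Ln x + l) - of_nat n / x - c) has_field_derivative - c / x + of_nat n / x\<^sup>2) (at x)"
    using x by (auto intro!: derivative_eq_intros Ln simp: field_simps power2_eq_square)
  moreover have "((\<lambda>x. \<Sum>j<n. of_real (lower_shift b \<theta> n j) * Digamma (1 + of_real (lower_shift b \<theta> n j) * x) + of_real (b * real (Suc j)) * Digamma (1 + of_real (b * real (Suc j)) * x))
      has_field_derivative (\<Sum>j<n. (of_real (lower_shift b \<theta> n j))\<^sup>2 * Polygamma (Suc 0) (1 + of_real (lower_shift b \<theta> n j) * x) 
           + (of_real (b * real (Suc j)))\<^sup>2 * Polygamma (Suc 0) (1 + of_real (b * real (Suc j)) * x))) (at x)"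
    using assms by (intro DERIV_sum DERIV_add d(2)) (auto simp: lower_shift_nonneg)
  moreover have "((\<lambda>x. of_nat n * (of_real b * Digamma (1 + of_real b * x))) has_field_derivative of_nat n * ((of_real b)\<^sup>2 * Polygamma (Suc 0) (1 + of_real b * x))) (at x)"
    using assms by (intro DERIV_cmult d(2)) auto
  ultimately show "(log_partition' b \<theta> n has_field_derivative log_partition'' b \<theta> n x) (at x)"
    unfolding log_partition'_def[abs_def] log_partition''_def c_def l_def One_nat_def by (intro DERIV_diff DERIV_add)
qed

text \<open>
  The uniform bound covers small \<open>u\<close>, in particular \<open>u = 0\<close>, which occurs when \<open>\<theta> = 1\<close>; the bound \<open>4 / u\<close>
  makes the sum over the particles logarithmic.
\<close>

lemma trigamma_term_bound:
  fixes x :: complex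
  assumes "u \<ge> 0" "Re x \<ge> 1/2"
  defines "E \<equiv> (of_real u)\<^sup>2 * Polygamma 1 (1 + of_real u * x) - (of_real u / x - 1 / (2 * x\<^sup>2))"
  shows "norm E \<le> 2" and "u > 0 \<Longrightarrow> norm E \<le> 4 / u"
proof -
  have nx: "norm x \<ge> 1/2" using complex_Re_le_cmod[of x] assms(2) by linarith
  have "x \<noteq> 0" using nx by auto
  have pos: "norm E \<le> 2 / (u * Re x + 1)" if u: "u > 0"
  proof -
    have R: "Re (of_real u * x) = u * Re x" by simp
    have "E = (of_real u)\<^sup>2 * (Polygamma 1 (1 + of_real u * x) - (1 / (of_real u * x) - 1 / (2 * (of_real u * x)\<^sup>2)))"
      unfolding E_def using u \<open>x \<noteq> 0\<close> by (simp add: right_diff_distrib power_mult_distrib) (simp add: power2_eq_square)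
    then have "norm E = u\<^sup>2 * norm (Polygamma 1 (1 + of_real u * x) - (1 / (of_real u * x) - 1 / (2 * (of_real u * x)\<^sup>2)))"
      by (simp add: norm_mult norm_power)
    also have "\<dots> \<le> u\<^sup>2 * (1 / (2 * (u * Re x)\<^sup>2 * (u * Re x + 1)))"
      using trigamma_asymp_bound[of "of_real u * x"] u assms by (intro mult_left_mono) (auto simp: R)
    also have "\<dots> = (1 / (2 * (Re x)\<^sup>2)) * (1 / (u * Re x + 1))"
      using u by (simp add: power_mult_distrib)
    also have "\<dots> \<le> 2 * (1 / (u * Re x + 1))"
    proof (intro mult_right_mono)
      have "(1/2)\<^sup>2 \<le> (Re x)\<^sup>2" using assms by (intro power_mono) auto
      then show "1 / (2 * (Re x)\<^sup>2) \<le> 2" by (simp add: divide_simps power2_eq_square split: if_splits)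
    qed (use u assms in auto)
    finally show ?thesis by simp
  qed
  show "norm E \<le> 2"
  proof (cases "u > 0")
    case True
    have "2 / (u * Re x + 1) \<le> 2 / 1" using True assms by (intro divide_left_mono) (auto intro!: add_nonneg_pos)
    with pos[OF True] show ?thesis by simp
  next
    case False
    then have "E = 1 / (2 * x\<^sup>2)" using assms by (simp add: E_def)
    then have "norm E = 1 / (2 * (norm x)\<^sup>2)" by (simp add: norm_divide norm_mult norm_power)
    also have "(1/2)\<^sup>2 \<le> (norm x)\<^sup>2" using nx by (intro power_mono) auto
    then have "1 / (2 * (norm x)\<^sup>2) \<le> 1 / (2 * (1/2)\<^sup>2)" using \<open>x \<noteq> 0\<close> by (intro divide_left_mono) auto
    finally show ?thesis by (simp add: power2_eq_square)
  qed
  assume u: "u > 0"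
  have "u * (1 / 2) \<le> u * Re x" using u assms by (intro mult_left_mono) auto
  then have "u / 2 \<le> u * Re x + 1" by linarith
  then have "2 / (u * Re x + 1) \<le> 2 / (u / 2)" using u by (intro divide_left_mono) (auto intro!: mult_pos_pos)
  with pos[OF u] show "norm E \<le> 4 / u" by simp
qed

text \<open>
  The coefficient of \<open>n\<close> in the second derivative of the log-partition function.
\<close>

definition limit_curvature :: "real \<Rightarrow> complex \<Rightarrow> complex" where
  "limit_curvature b x = of_real b / x - (of_real b)\<^sup>2 * Polygamma 1 (1 + of_real b * x)"

lemma sum_lower_shift: "(\<Sum>j<n. lower_shift b \<theta> n j + b * real (Suc j)) = b * \<theta> * (real n)\<^sup>2"
proof -
  have odd: "(\<Sum>j<n. 2 * real j + 1) = (real n)\<^sup>2"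
    by (induction n) (auto simp: power2_eq_square algebra_simps)
  have "(\<Sum>j<n. lower_shift b \<theta> n j + b * real (Suc j)) = (\<Sum>j<n. b * (real n * (\<theta> - 1)) + b * (2 * real j + 1))"
    by (intro sum.cong refl) (simp add: lower_shift_def algebra_simps)
  also have "\<dots> = real n * (b * (real n * (\<theta> - 1))) + b * (\<Sum>j<n. 2 * real j + 1)"
    unfolding sum.distrib[of "\<lambda>j. b * (real n * (\<theta> - 1))"] by (simp add: sum_distrib_left[symmetric] mult_ac)
  finally show ?thesis unfolding odd by (simp add: power2_eq_square algebra_simps)
qed

lemma sum_inverse_le_harm: "(\<Sum>j<n. 1 / real (Suc j)) = harm n" "(\<Sum>j<n. if j = 0 then 0 else 1 / real j) \<le> harm n"
proof -
  have 1: "(\<Sum>j<n. 1 / real (Suc j)) = harm n" for n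
    by (induction n) (auto simp: harm_Suc harm_expand inverse_eq_divide)
  then show "(\<Sum>j<n. 1 / real (Suc j)) = harm n" .
  show "(\<Sum>j<n. if j = 0 then 0 else 1 / real j) \<le> harm n"
  proof (cases n)
    case (Suc m)
    have "(\<Sum>j<Suc m. if j = 0 then 0 else 1 / real j) = (\<Sum>j<m. 1 / real (Suc j))"
      by (subst sum.lessThan_Suc_shift) simp
    also have "\<dots> \<le> (\<Sum>j<Suc m. 1 / real (Suc j))" by simp
    also have "\<dots> = harm n" unfolding Suc by (rule 1)
    finally show ?thesis using Suc by simp
  qed (simp add: harm_expand)
qed

text \<open>
  After inserting the trigamma expansion, the terms \<open>u / x\<close> add up to \<open>b \<theta> n\<^sup>2 / x\<close>, of which the
  prefactor leaves \<open>b n / x\<close>; the terms \<open>1 / (2x\<^sup>2)\<close> cancel, and a harmonic sum of errors remains.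
\<close>

lemma log_partition_curvature:
  assumes "b > 0" "\<theta> \<ge> 1" "Re x \<ge> 1/2"
  shows "norm (log_partition'' b \<theta> n x - of_nat n * limit_curvature b x) \<le> 2 + 8 / b * harm n"
proof -
  have "x \<noteq> 0" using assms by auto
  define E where "E u = (of_real u)\<^sup>2 * Polygamma 1 (1 + of_real u * x) - (of_real u / x - 1 / (2 * x\<^sup>2))" for u
  have E: "(of_real u)\<^sup>2 * Polygamma 1 (1 + of_real u * x) = E u + (of_real u / x - 1 / (2 * x\<^sup>2))" for u
    by (simp add: E_def)
  have "(\<Sum>j<n. (of_real (lower_shift b \<theta> n j))\<^sup>2 * Polygamma 1 (1 + of_real (lower_shift b \<theta> n j) * x) 
           + (of_real (b * real (Suc j)))\<^sup>2 * Polygamma 1 (1 + of_real (b * real (Suc j)) * x)) =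
     (\<Sum>j<n. E (lower_shift b \<theta> n j) + E (b * real (Suc j))) + (\<Sum>j<n. of_real (lower_shift b \<theta> n j + b * real (Suc j)) / x - 1 / x\<^sup>2)"
    unfolding E sum.distrib[symmetric] by (intro sum.cong refl) (simp add: add_divide_distrib)
  also have "(\<Sum>j<n. of_real (lower_shift b \<theta> n j + b * real (Suc j)) / x - 1 / x\<^sup>2) = of_real (b * \<theta> * (real n)\<^sup>2) / x - of_nat n / x\<^sup>2"
    unfolding sum_subtractf sum_divide_distrib[symmetric] of_real_sum[symmetric] sum_lower_shift by simp
  finally have key: "(\<Sum>j<n. (of_real (lower_shift b \<theta> n j))\<^sup>2 * Polygamma 1 (1 + of_real (lower_shift b \<theta> n j) * x) 
           + (of_real (b * real (Suc j)))\<^sup>2 * Polygamma 1 (1 + of_real (b * real (Suc j)) * x)) =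
     (\<Sum>j<n. E (lower_shift b \<theta> n j) + E (b * real (Suc j))) + (of_real (b * \<theta> * (real n)\<^sup>2) / x - of_nat n / x\<^sup>2)" .
  have "log_partition'' b \<theta> n x - of_nat n * limit_curvature b x = (\<Sum>j<n. E (lower_shift b \<theta> n j) + E (b * real (Suc j)))"
    unfolding log_partition''_def limit_curvature_def scale_exponent_def key
    by (simp add: diff_divide_distrib right_diff_distrib mult_ac)
  also have "norm \<dots> \<le> (\<Sum>j<n. (if j = 0 then 2 else 0) + 4 / b * (if j = 0 then 0 else 1 / real j) + 4 / b * (1 / real (Suc j)))"
  proof (intro sum_norm_le)
    fix j
    have "norm (E (lower_shift b \<theta> n j)) \<le> (if j = 0 then 2 else 0) + 4 / b * (if j = 0 then 0 else 1 / real j)"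
    proof (cases "j = 0")
      case True
      then show ?thesis using trigamma_term_bound(1)[OF lower_shift_nonneg[OF assms(1,2)] assms(3)] by (simp add: E_def)
    next
      case False
      have le: "b * real j \<le> lower_shift b \<theta> n j" using assms by (simp add: lower_shift_def)
      moreover have "b * real j > 0" using False assms by simp
      ultimately have "lower_shift b \<theta> n j > 0" by linarith
      then have "norm (E (lower_shift b \<theta> n j)) \<le> 4 / lower_shift b \<theta> n j"
        unfolding E_def using assms by (intro trigamma_term_bound) auto
      also have "\<dots> \<le> 4 / (b * real j)" using le \<open>b * real j > 0\<close> by (intro divide_left_mono) auto
      finally show ?thesis using False by simp
    qed
    moreover have "norm (E (b * real (Suc j))) \<le> 4 / (b * real (Suc j))"
      unfolding E_def using assms by (intro trigamma_term_bound) auto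
    ultimately show "norm (E (lower_shift b \<theta> n j) + E (b * real (Suc j))) \<le> (if j = 0 then 2 else 0) + 4 / b * (if j = 0 then 0 else 1 / real j) + 4 / b * (1 / real (Suc j))"
      by (intro order.trans[OF norm_triangle_ineq] add_mono) auto
  qed
  also have "\<dots> = (\<Sum>j<n. if j = 0 then 2 else 0) + 4 / b * (\<Sum>j<n. if j = 0 then 0 else 1 / real j) + 4 / b * (\<Sum>j<n. 1 / real (Suc j))"
    by (simp only: sum.distrib sum_distrib_left)
  also have "\<dots> \<le> 2 + 4 / b * harm n + 4 / b * harm n"
    unfolding sum_inverse_le_harm(1) using assms sum_inverse_le_harm(2)[of n] by (intro add_mono mult_left_mono) (auto simp: sum.delta)
  finally show ?thesis by simp
qed


section \<open>The first derivative of the log-partition function\<close>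

text \<open>
  The operator \<open>u d/du - 1\<close> applied to \<open>ln \<Gamma> (1 + u)\<close>.  It appears because the exponent contains the
  log-partition function in the combination \<open>G'(1) - G(1)\<close>.
\<close>

definition legendre_ln_Gamma :: "real \<Rightarrow> real" where
  "legendre_ln_Gamma u = u * Digamma (1 + u) - ln_Gamma (1 + u)"

definition shift_defect :: "real \<Rightarrow> real \<Rightarrow> real" where
  "shift_defect b c = legendre_ln_Gamma (b * c) - (b * c + 1 / 2 - ln (2 * pi * b) / 2 - ln c / 2)"

lemma shift_defect_bound:
  assumes "b > 0" "c > 0"
  shows "\<bar>shift_defect b c\<bar> \<le> 1 / (2 * b * c)"
proof -
  have "shift_defect b c = digamma_defect (b * c)"
    using assms by (simp add: shift_defect_def legendre_ln_Gamma_def digamma_defect_def ln_mult)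
  then show ?thesis using digamma_defect_bound[of "b * c"] assms by (simp add: mult_ac)
qed

lemma harm_ge_1: "n \<ge> 1 \<Longrightarrow> harm n \<ge> (1::real)"
proof -
  assume "n \<ge> 1"
  then have "harm 1 \<le> (harm n :: real)" unfolding harm_def by (intro sum_mono2) auto
  then show ?thesis by (simp add: harm_def)
qed

lemma sum_shift_defect_Suc:
  assumes "b > 0"
  shows "\<bar>\<Sum>j<n. shift_defect b (real (Suc j))\<bar> \<le> 1 / (2 * b) * harm n"
proof -
  have "\<bar>\<Sum>j<n. shift_defect b (real (Suc j))\<bar> \<le> (\<Sum>j<n. 1 / (2 * b) * (1 / real (Suc j)))"
    using shift_defect_bound[OF assms, of "real (Suc j)" for j] by (intro order.trans[OF sum_abs] sum_mono) auto
  then show ?thesis by (simp only: sum_distrib_left[symmetric] sum_inverse_le_harm(1))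
qed

text \<open>
  Only the term \<open>j = 0\<close> needs care: its shift is 0 if \<open>\<theta> = 1\<close>, and at least \<open>\<theta> - 1\<close> otherwise.
\<close>

lemma sum_shift_defect_lower:
  assumes "b > 0" "\<theta> \<ge> 1"
  shows "\<exists>K. \<forall>n\<ge>1. \<bar>\<Sum>j<n. shift_defect b (real n * (\<theta> - 1) + real j)\<bar> \<le> K * harm n"
proof -
  define K0 where "K0 = (if \<theta> = 1 then \<bar>shift_defect b 0\<bar> else 1 / (2 * b * (\<theta> - 1)))"
  have K0: "\<bar>shift_defect b (real n * (\<theta> - 1))\<bar> \<le> K0" if "n \<ge> 1" for n
  proof (cases "\<theta> = 1")
    case False
    then have "\<theta> > 1" using assms by simp
    then have pos: "real n * (\<theta> - 1) > 0" using that by simp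
    have "\<bar>shift_defect b (real n * (\<theta> - 1))\<bar> \<le> 1 / (2 * b * (real n * (\<theta> - 1)))"
      by (rule shift_defect_bound[OF assms(1) pos])
    also have "\<dots> \<le> 1 / (2 * b * (1 * (\<theta> - 1)))"
      using assms that \<open>\<theta> > 1\<close> by (intro divide_left_mono mult_left_mono mult_right_mono) auto
    finally show ?thesis using False by (simp add: K0_def)
  qed (simp add: K0_def)
  have "\<bar>\<Sum>j<n. shift_defect b (real n * (\<theta> - 1) + real j)\<bar> \<le> (K0 + 1 / (2 * b)) * harm n" if n: "n \<ge> 1" for n
  proof -
    have "\<bar>\<Sum>j<n. shift_defect b (real n * (\<theta> - 1) + real j)\<bar> \<le> 
       (\<Sum>j<n. (if j = 0 then K0 else 0) + 1 / (2 * b) * (if j = 0 then 0 else 1 / real j))"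
    proof (intro order.trans[OF sum_abs] sum_mono)
      fix j
      show "\<bar>shift_defect b (real n * (\<theta> - 1) + real j)\<bar> \<le> (if j = 0 then K0 else 0) + 1 / (2 * b) * (if j = 0 then 0 else 1 / real j)"
      proof (cases "j = 0")
        case False
        have le: "real j \<le> real n * (\<theta> - 1) + real j" using assms by simp
        then have "\<bar>shift_defect b (real n * (\<theta> - 1) + real j)\<bar> \<le> 1 / (2 * b * (real n * (\<theta> - 1) + real j))"
          using False assms by (intro shift_defect_bound) (auto intro!: add_nonneg_pos)
        also have "\<dots> \<le> 1 / (2 * b * real j)"
          using False assms le by (intro divide_left_mono mult_left_mono mult_pos_pos) (auto intro!: add_nonneg_pos)
        finally show ?thesis using False by simp
      qed (use K0[OF n] in simp)
    qed
    also have "\<dots> = (\<Sum>j<n. if j = 0 then K0 else 0) + 1 / (2 * b) * (\<Sum>j<n. if j = 0 then 0 else 1 / real j)"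
      by (simp only: sum.distrib sum_distrib_left)
    also have "\<dots> \<le> K0 * harm n + 1 / (2 * b) * harm n"
    proof (intro add_mono mult_left_mono sum_inverse_le_harm)
      have "K0 \<ge> 0" using assms by (simp add: K0_def)
      then have "K0 * 1 \<le> K0 * harm n" using harm_ge_1[OF n] by (intro mult_left_mono)
      then show "(\<Sum>j<n. if j = 0 then K0 else 0) \<le> K0 * harm n" using n by (simp add: sum.delta)
    qed (use assms in auto)
    finally show ?thesis by (simp add: distrib_right)
  qed
  then show ?thesis by blast
qed

text \<open>
  By the mean value theorem the increment of \<open>y ln y - y\<close> over \<open>[y, y + 1]\<close> lies between \<open>ln y\<close> and \<open>ln (y + 1)\<close>.
\<close>

lemma sum_ln_bound:
  assumes "c > (0::real)"
  shows "\<bar>(\<Sum>j<n. ln (c + real j)) - (((c + real n) * ln (c + real n) - (c + real n)) - (c * ln c - c))\<bar> \<le> ln (c + real n) - ln c"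
proof -
  define T where "T y = y * ln y - y" for y :: real
  have step: "ln y \<le> T (y + 1) - T y \<and> T (y + 1) - T y \<le> ln (y + 1)" if "y > 0" for y
  proof -
    have "(T has_real_derivative ln x) (at x)" if "x > 0" for x
      unfolding T_def[abs_def] using that by (auto intro!: derivative_eq_intros)
    then obtain z where z: "y < z" "z < y + 1" "T (y + 1) - T y = (y + 1 - y) * ln z"
      using MVT2[of y "y + 1" T ln] \<open>y > 0\<close> by auto
    then show ?thesis using that by auto
  qed
  have "(\<Sum>j<n. ln (c + real j)) \<le> (\<Sum>j<n. T (c + real (Suc j)) - T (c + real j))"
    using step[of "c + real j" for j] assms by (intro sum_mono) (auto simp: add_ac add_pos_nonneg)
  moreover have "(\<Sum>j<n. T (c + real (Suc j)) - T (c + real j)) = T (c + real n) - T c"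
    using sum_lessThan_telescope[of "\<lambda>j. T (c + real j)" n] by simp
  moreover have "(\<Sum>j<n. T (c + real (Suc j)) - T (c + real j)) \<le> (\<Sum>j<n. ln (c + real (Suc j)))"
    using step[of "c + real j" for j] assms by (intro sum_mono) (auto simp: add_ac add_pos_nonneg)
  moreover have "(\<Sum>j<n. ln (c + real (Suc j))) - (\<Sum>j<n. ln (c + real j)) = ln (c + real n) - ln c"
    using sum_lessThan_telescope[of "\<lambda>j. ln (c + real j)" n] by (simp add: sum_subtractf)
  ultimately show ?thesis unfolding T_def[symmetric] by linarith
qed

lemma ln_real_le_harm: "n \<ge> 1 \<Longrightarrow> ln (real n) \<le> harm n"
proof -
  assume "n \<ge> 1"
  then have "ln (real n) \<le> ln (real n + 1)" by simp
  also have "\<dots> \<le> harm n" using ln_le_harm[of n] by (simp add: add_ac)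
  finally show ?thesis .
qed

text \<open>
  For \<open>\<theta> = 1\<close> the first summand is \<open>ln 0 = 0\<close>, so the sum starts at \<open>j = 1\<close>; also \<open>0 * ln 0 = 0\<close> on the other side.
\<close>

lemma sum_ln_lower:
  assumes "\<theta> \<ge> 1"
  shows "\<exists>K. \<forall>n\<ge>1.
    \<bar>(\<Sum>j<n. ln (real n * (\<theta> - 1) + real j)) - real n * (ln (real n) + \<theta> * ln \<theta> - (\<theta> - 1) * ln (\<theta> - 1) - 1)\<bar> \<le> K * harm n"
proof (cases "\<theta> = 1")
  case True
  have "\<bar>(\<Sum>j<n. ln (real n * (\<theta> - 1) + real j)) - real n * (ln (real n) + \<theta> * ln \<theta> - (\<theta> - 1) * ln (\<theta> - 1) - 1)\<bar> \<le> 2 * harm n" 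
    if n: "n \<ge> 1" for n
  proof -
    obtain m where m: "n = Suc m" using n by (cases n) auto
    have "(\<Sum>j<n. ln (real n * (\<theta> - 1) + real j)) = (\<Sum>j<m. ln (1 + real j))"
      unfolding m sum.lessThan_Suc_shift True by (simp add: add_ac)
    moreover have "\<bar>(\<Sum>j<m. ln (1 + real j)) - ((real n * ln (real n) - real n) - (- 1))\<bar> \<le> ln (real n)"
      using sum_ln_bound[of 1 m] by (simp add: m add_ac)
    ultimately show ?thesis using ln_real_le_harm[OF n] harm_ge_1[OF n] True 
      by (simp add: algebra_simps)
  qed
  then show ?thesis by blast
next
  case False
  then have th: "\<theta> > 1" using assms by simp
  have "\<bar>(\<Sum>j<n. ln (real n * (\<theta> - 1) + real j)) - real n * (ln (real n) + \<theta> * ln \<theta> - (\<theta> - 1) * ln (\<theta> - 1) - 1)\<bar> 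
     \<le> (ln \<theta> - ln (\<theta> - 1)) * harm n" if "n \<ge> 1" for n
  proof -
    define c where "c = real n * (\<theta> - 1)"
    have c: "c > 0" "c + real n = real n * \<theta>" using th that by (auto simp: c_def algebra_simps)
    have l: "ln c = ln (real n) + ln (\<theta> - 1)" "ln (real n * \<theta>) = ln (real n) + ln \<theta>"
      unfolding c_def using th that by (auto simp: ln_mult)
    have "\<bar>(\<Sum>j<n. ln (c + real j)) - ((real n * \<theta> * ln (real n * \<theta>) - real n * \<theta>) - (c * ln c - c))\<bar> \<le> ln (real n * \<theta>) - ln c"
      using sum_ln_bound[OF c(1), of n] by (simp add: c(2))
    also have "(real n * \<theta> * ln (real n * \<theta>) - real n * \<theta>) - (c * ln c - c) = real n * (ln (real n) + \<theta> * ln \<theta> - (\<theta> - 1) * ln (\<theta> - 1) - 1)"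
      unfolding l by (simp add: c_def algebra_simps)
    also have "ln (real n * \<theta>) - ln c = (ln \<theta> - ln (\<theta> - 1)) * 1" unfolding l by simp
    also have "\<dots> \<le> (ln \<theta> - ln (\<theta> - 1)) * harm n"
      using th harm_ge_1[OF that] by (intro mult_left_mono) auto
    finally show ?thesis by (simp add: c_def)
  qed
  then show ?thesis by blast
qed

definition mean_constant :: "real \<Rightarrow> real \<Rightarrow> real" where
  "mean_constant b \<theta> = legendre_ln_Gamma b + ln (2 * pi) - 1 - b - ln \<theta> + \<theta> * ln \<theta> / 2 - (\<theta> - 1) * ln (\<theta> - 1) / 2"

lemma log_partition_1:
  assumes "b > 0" "\<theta> \<ge> 1"
  shows "log_partition b \<theta> n 1 = of_real (
      - (real n + scale_exponent b \<theta> n) * ln (b * real n * \<theta>)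
     + (\<Sum>j<n. ln_Gamma (1 + lower_shift b \<theta> n j) + ln_Gamma (1 + b * real (Suc j))) - real n * ln_Gamma (1 + b))"
    and "log_partition' b \<theta> n 1 = of_real (
     - scale_exponent b \<theta> n * ln (b * real n * \<theta>) - real n - scale_exponent b \<theta> n
     + (\<Sum>j<n. lower_shift b \<theta> n j * Digamma (1 + lower_shift b \<theta> n j) + b * real (Suc j) * Digamma (1 + b * real (Suc j)))
     - real n * (b * Digamma (1 + b)))"
proof -
  have g: "ln_Gamma (1 + complex_of_real u) = of_real (ln_Gamma (1 + u))" 
     "Digamma (1 + complex_of_real u) = of_real (Digamma (1 + u))" if "u \<ge> 0" for u
    using ln_Gamma_complex_of_real[of "1 + u"] Polygamma_of_real[of "1 + u" 0, where 'a = complex] that by auto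
  show "log_partition b \<theta> n 1 = of_real (
      - (real n + scale_exponent b \<theta> n) * ln (b * real n * \<theta>)
     + (\<Sum>j<n. ln_Gamma (1 + lower_shift b \<theta> n j) + ln_Gamma (1 + b * real (Suc j))) - real n * ln_Gamma (1 + b))"
    unfolding log_partition_def using assms g(1)[OF lower_shift_nonneg[OF assms]] g(1)[of "b * real (Suc j)" for j] g(1)[of b]
    by simp
  show "log_partition' b \<theta> n 1 = of_real (
     - scale_exponent b \<theta> n * ln (b * real n * \<theta>) - real n - scale_exponent b \<theta> n
     + (\<Sum>j<n. lower_shift b \<theta> n j * Digamma (1 + lower_shift b \<theta> n j) + b * real (Suc j) * Digamma (1 + b * real (Suc j)))
     - real n * (b * Digamma (1 + b)))"
    unfolding log_partition'_def using assms g(2)[OF lower_shift_nonneg[OF assms]] g(2)[of "b * real (Suc j)" for j] g(2)[of b]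
    by simp
qed

text \<open>
  Stirling's formula turns the left-hand side into \<open>\<Sum> ln\<close> over the two families of shifts; the
  terms of order \<open>n\<^sup>2\<close> and \<open>n ln n\<close> cancel, and those of order \<open>n\<close> make up \<open>mean_constant\<close>.
\<close>

lemma log_partition_mean:
  assumes "b > 0" "\<theta> \<ge> 1"
  shows "\<exists>K. \<forall>n\<ge>1.
    norm (log_partition' b \<theta> n 1 - log_partition b \<theta> n 1 + of_nat n * of_real (mean_constant b \<theta>)) \<le> K * harm n"
proof -
  obtain K1 where K1: "\<And>n. n \<ge> 1 \<Longrightarrow> \<bar>\<Sum>j<n. shift_defect b (real n * (\<theta> - 1) + real j)\<bar> \<le> K1 * harm n"
    using sum_shift_defect_lower[OF assms] by blast
  obtain K2 where K2: "\<And>n. n \<ge> 1 \<Longrightarrow> 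
    \<bar>(\<Sum>j<n. ln (real n * (\<theta> - 1) + real j)) - real n * (ln (real n) + \<theta> * ln \<theta> - (\<theta> - 1) * ln (\<theta> - 1) - 1)\<bar> \<le> K2 * harm n"
    using sum_ln_lower[OF assms(2)] by blast
  have K3: "\<bar>(\<Sum>j<n. ln (real (Suc j))) - real n * (ln (real n) - 1)\<bar> \<le> 3 * harm n" if n: "n \<ge> 1" for n
  proof -
    obtain m where m: "n = Suc m" using n by (cases n) auto
    have "(\<Sum>j<n. ln (real (Suc j))) = (\<Sum>j<m. ln (1 + real j)) + ln (real n)" by (simp add: m add_ac)
    moreover have "\<bar>(\<Sum>j<m. ln (1 + real j)) - ((real n * ln (real n) - real n) - (- 1))\<bar> \<le> ln (real n)"
      using sum_ln_bound[of 1 m] by (simp add: m add_ac)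
    moreover have "real n * (ln (real n) - 1) = real n * ln (real n) - real n" by (simp add: algebra_simps)
    ultimately show ?thesis using ln_real_le_harm[OF n] harm_ge_1[OF n] ln_ge_zero[of "real n"] n
      unfolding abs_le_iff by linarith
  qed
  have "norm (log_partition' b \<theta> n 1 - log_partition b \<theta> n 1 + of_nat n * of_real (mean_constant b \<theta>)) \<le> (K1 + 1 / (2 * b) + K2 / 2 + 3 / 2) * harm n"
    if n: "n \<ge> 1" for n
  proof -
    define c where "c j = real n * (\<theta> - 1) + real j" for j
    define D1 D2 L1 L2 where "D1 = (\<Sum>j<n. shift_defect b (c j))" and "D2 = (\<Sum>j<n. shift_defect b (real (Suc j)))"
      and "L1 = (\<Sum>j<n. ln (c j))" and "L2 = (\<Sum>j<n. ln (real (Suc j)))"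
    have ll: "legendre_ln_Gamma (b * y) = shift_defect b y + (b * y + 1 / 2 - ln (2 * pi * b) / 2 - ln y / 2)" for y
      by (simp add: shift_defect_def)
    have "(\<Sum>j<n. legendre_ln_Gamma (b * c j) + legendre_ln_Gamma (b * real (Suc j))) = 
        D1 + D2 + (\<Sum>j<n. b * c j + b * real (Suc j)) + real n - real n * ln (2 * pi * b) - L1 / 2 - L2 / 2"
      unfolding ll D1_def D2_def L1_def L2_def sum.distrib sum_subtractf sum_divide_distrib by simp
    also have "(\<Sum>j<n. b * c j + b * real (Suc j)) = b * \<theta> * (real n)\<^sup>2"
      using sum_lower_shift[of b \<theta> n] by (simp add: lower_shift_def c_def)
    finally have S: "(\<Sum>j<n. legendre_ln_Gamma (b * c j) + legendre_ln_Gamma (b * real (Suc j))) = 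
        D1 + D2 + b * \<theta> * (real n)\<^sup>2 + real n - real n * ln (2 * pi * b) - L1 / 2 - L2 / 2" .
    have "log_partition' b \<theta> n 1 - log_partition b \<theta> n 1 = of_real (
       real n * ln (b * real n * \<theta>) - real n - scale_exponent b \<theta> n + (\<Sum>j<n. legendre_ln_Gamma (b * c j) + legendre_ln_Gamma (b * real (Suc j)))
        - real n * legendre_ln_Gamma b)"
      unfolding log_partition_1[OF assms] of_real_diff[symmetric]
      by (rule arg_cong[where f = of_real]) 
         (simp add: legendre_ln_Gamma_def lower_shift_def c_def sum.distrib sum_subtractf algebra_simps)
    also have "real n * ln (b * real n * \<theta>) - real n - scale_exponent b \<theta> n + (\<Sum>j<n. legendre_ln_Gamma (b * c j) + legendre_ln_Gamma (b * real (Suc j)))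
        - real n * legendre_ln_Gamma b = 
       D1 + D2 - (L1 - real n * (ln (real n) + \<theta> * ln \<theta> - (\<theta> - 1) * ln (\<theta> - 1) - 1)) / 2 - (L2 - real n * (ln (real n) - 1)) / 2
         - real n * mean_constant b \<theta>"
    proof -
      have ln1: "ln (b * real n * \<theta>) = ln b + ln (real n) + ln \<theta>" "ln (2 * pi * b) = ln (2 * pi) + ln b"
        using assms n by (auto simp: ln_mult)
      show ?thesis unfolding S ln1 mean_constant_def scale_exponent_def by (simp add: field_simps power2_eq_square)
    qed
    finally have "log_partition' b \<theta> n 1 - log_partition b \<theta> n 1 + of_nat n * of_real (mean_constant b \<theta>) = of_real (
       D1 + D2 - (L1 - real n * (ln (real n) + \<theta> * ln \<theta> - (\<theta> - 1) * ln (\<theta> - 1) - 1)) / 2 - (L2 - real n * (ln (real n) - 1)) / 2)"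
      by simp
    then have "norm (log_partition' b \<theta> n 1 - log_partition b \<theta> n 1 + of_nat n * of_real (mean_constant b \<theta>)) = 
      \<bar>D1 + D2 - (L1 - real n * (ln (real n) + \<theta> * ln \<theta> - (\<theta> - 1) * ln (\<theta> - 1) - 1)) / 2 - (L2 - real n * (ln (real n) - 1)) / 2\<bar>"
      by (simp only: norm_of_real)
    also have "\<dots> \<le> K1 * harm n + 1 / (2 * b) * harm n + (K2 * harm n) / 2 + (3 * harm n) / 2"
    proof -
      have bounds: "\<bar>D1\<bar> \<le> K1 * harm n" "\<bar>D2\<bar> \<le> 1 / (2 * b) * harm n"
        "\<bar>L1 - real n * (ln (real n) + \<theta> * ln \<theta> - (\<theta> - 1) * ln (\<theta> - 1) - 1)\<bar> \<le> K2 * harm n"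
        "\<bar>L2 - real n * (ln (real n) - 1)\<bar> \<le> 3 * harm n"
        using K1[OF n] K2[OF n] K3[OF n] sum_shift_defect_Suc[OF assms(1), of n] by (simp_all add: D1_def D2_def L1_def L2_def c_def)
      have tri: "\<bar>p + q - r / 2 - s / 2\<bar> \<le> P + Q + R / 2 + S / 2"
        if "\<bar>p\<bar> \<le> P" "\<bar>q\<bar> \<le> Q" "\<bar>r\<bar> \<le> R" "\<bar>s\<bar> \<le> S" for p q r s P Q R S :: real
        using that by linarith
      show ?thesis by (rule tri[OF bounds])
    qed
    finally show ?thesis by (simp add: algebra_simps)
  qed
  then show ?thesis by blast
qed


section \<open>Cubic expansion of the exponent\<close>

lemma limit_curvature_Taylor:
  assumes "b > 0"
  shows "\<exists>H\<ge>0. \<forall>s. norm s \<le> 1/2 \<longrightarrow> norm (limit_curvature b (1 + s) - (of_real (b - b\<^sup>2 * Polygamma 1 (1 + b)) 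
            - of_real (b + b ^ 3 * Polygamma 2 (1 + b)) * s)) \<le> H * (norm s)\<^sup>2"
proof -
  define f where "f i x = (case i of 0 \<Rightarrow> of_real b / x - of_real b * (of_real b * Polygamma 1 (1 + of_real b * x))
      | Suc 0 \<Rightarrow> - of_real b / x\<^sup>2 - of_real b * ((of_real b)\<^sup>2 * Polygamma 2 (1 + of_real b * x))
      | _ \<Rightarrow> 2 * of_real b / x ^ 3 - (of_real b)\<^sup>2 * ((of_real b)\<^sup>2 * Polygamma 3 (1 + of_real b * x)))" for i :: nat and x :: complex
  define S where "S = cball (1::complex) (1/2)"
  have Re: "Re x > 0" if "x \<in> S" for x
    using abs_Re_le_cmod[of "1 - x"] that by (auto simp: S_def dist_norm)
  then have ne: "x \<noteq> 0" if "x \<in> S" for x using that by fastforce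
  have d: "(f i has_field_derivative f (Suc i) x) (at x within S)" if "x \<in> S" "i \<le> 1" for i x
  proof -
    note g = deriv_ln_Gamma_affine(2)[OF less_imp_le[OF assms] Re[OF that(1)]]
    have "Suc 1 = 2" "Suc 2 = 3" by auto
    note g1 = g[of 1, unfolded this] and g2 = g[of 2, unfolded this]
    from \<open>i \<le> 1\<close> have "i = 0 \<or> i = 1" by auto
    then have "(f i has_field_derivative f (Suc i) x) (at x)"
    proof
      assume i: "i = 0"
      have "((\<lambda>x. of_real b / x - of_real b * (of_real b * Polygamma 1 (1 + of_real b * x))) has_field_derivative
          - of_real b / x\<^sup>2 - of_real b * ((of_real b)\<^sup>2 * Polygamma 2 (1 + of_real b * x))) (at x)"
        using ne[OF that(1)]
        by (intro DERIV_diff DERIV_cmult g1) (auto intro!: derivative_eq_intros simp: power2_eq_square)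
      then show ?thesis by (simp add: f_def[abs_def] i)
    next
      assume i: "i = 1"
      have "((\<lambda>x. - of_real b / x\<^sup>2 - of_real b * (of_real b * (of_real b * Polygamma 2 (1 + of_real b * x)))) has_field_derivative
          2 * of_real b / x ^ 3 - of_real b * (of_real b * ((of_real b)\<^sup>2 * Polygamma 3 (1 + of_real b * x)))) (at x)"
        using ne[OF that(1)]
        by (intro DERIV_diff DERIV_cmult g2) (auto intro!: derivative_eq_intros simp: power2_eq_square power3_eq_cube mult_ac)
      then show ?thesis by (simp add: f_def[abs_def] i power2_eq_square mult_ac)
    qed
    then show ?thesis by (rule has_field_derivative_at_within)
  qed
  have "continuous_on S (f (Suc (Suc 0)))"
  proof -
    have "1 + complex_of_real b * x \<notin> \<int>\<^sub>\<le>\<^sub>0" if "x \<in> S" for x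
      using one_plus_mult_not_nonpos[OF less_imp_le[OF assms] Re[OF that]] by simp
    then have "continuous_on S (\<lambda>x. Polygamma 3 (1 + complex_of_real b * x))"
      by (intro holomorphic_on_imp_continuous_on holomorphic_on_compose_gen[where g = "Polygamma 3" and t = "- \<int>\<^sub>\<le>\<^sub>0" and f = "\<lambda>x. 1 + complex_of_real b * x", unfolded o_def] holomorphic_intros) auto
    then show ?thesis unfolding f_def by (simp, intro continuous_intros) (auto simp: ne)
  qed
  then have "compact (f (Suc (Suc 0)) ` S)" by (intro compact_continuous_image) (auto simp: S_def)
  then obtain B where B: "B > 0" "\<And>x. x \<in> S \<Longrightarrow> norm (f (Suc (Suc 0)) x) \<le> B"
    using compact_imp_bounded bounded_pos by (metis imageI)
  have P: "Polygamma n (1 + complex_of_real b) = of_real (Polygamma n (1 + b))" for n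
    using Polygamma_of_real[of "1 + b" n, where 'a = complex] assms by simp
  have "norm (limit_curvature b (1 + s) - (of_real (b - b\<^sup>2 * Polygamma 1 (1 + b)) 
            - of_real (b + b ^ 3 * Polygamma 2 (1 + b)) * s)) \<le> B * (norm s)\<^sup>2" if s: "norm s \<le> 1/2" for s
  proof -
    have "cmod (f 0 (1 + s) - (\<Sum>i\<le>1. f i 1 * (1 + s - 1) ^ i / fact i)) \<le> B * cmod (1 + s - 1) ^ Suc 1 / fact 1"
      by (rule complex_Taylor[where S = S]) (use B d s in \<open>auto simp: S_def dist_norm\<close>)
    moreover have "f 0 (1 + s) = limit_curvature b (1 + s)" by (simp add: f_def limit_curvature_def power2_eq_square)
    moreover have "(\<Sum>i\<le>1. f i 1 * (1 + s - 1) ^ i / fact i) = of_real (b - b\<^sup>2 * Polygamma 1 (1 + b)) 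
            - of_real (b + b ^ 3 * Polygamma 2 (1 + b)) * s"
      by (simp add: f_def P power2_eq_square power3_eq_cube algebra_simps)
    ultimately show ?thesis by (simp add: power2_eq_square)
  qed
  then show ?thesis using B(1) by (intro exI[of _ B]) auto
qed

definition centred_exponent :: "real \<Rightarrow> real \<Rightarrow> nat \<Rightarrow> complex \<Rightarrow> complex" where
  "centred_exponent b \<theta> n s = log_partition b \<theta> n (1 + s) - (1 + s) * log_partition b \<theta> n 1 + s * of_nat n * of_real (mean_constant b \<theta>)"

text \<open>
  The difference of the exponent and its claimed expansion, minus the linear part, vanishes to second order
  at 0, so it is bounded through its second derivative, which is controlled by \<open>log_partition_curvature\<close> and \<open>limit_curvature_Taylor\<close>.
\<close>

lemma centred_exponent_expansion:
  assumes "b > 0" "\<theta> \<ge> 1"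
  defines "\<sigma> \<equiv> b - b\<^sup>2 * Polygamma 1 (1 + b)" and "A \<equiv> b + b ^ 3 * Polygamma 2 (1 + b)"
  shows "\<exists>H K. H \<ge> 0 \<and> (\<forall>n\<ge>1. \<forall>s. norm s \<le> 1/2 \<longrightarrow> 
     norm (centred_exponent b \<theta> n s - (of_nat n * of_real \<sigma> * s\<^sup>2 / 2 - of_nat n * of_real A * s ^ 3 / 6)) \<le>
       K * harm n * norm s + (2 + 8 / b * harm n + real n * (H * (norm s)\<^sup>2)) * (norm s)\<^sup>2)"
proof -
  obtain H where H: "H \<ge> 0" "\<And>s. norm s \<le> 1/2 \<Longrightarrow> norm (limit_curvature b (1 + s) - (of_real \<sigma> - of_real A * s)) \<le> H * (norm s)\<^sup>2"
    using limit_curvature_Taylor[OF assms(1)] unfolding \<sigma>_def A_def by blast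
  obtain K where K: "\<And>n. n \<ge> 1 \<Longrightarrow> norm (log_partition' b \<theta> n 1 - log_partition b \<theta> n 1 + of_nat n * of_real (mean_constant b \<theta>)) \<le> K * harm n"
    using log_partition_mean[OF assms(1,2)] by blast
  have "norm (centred_exponent b \<theta> n s - (of_nat n * of_real \<sigma> * s\<^sup>2 / 2 - of_nat n * of_real A * s ^ 3 / 6)) \<le>
       K * harm n * norm s + (2 + 8 / b * harm n + real n * (H * (norm s)\<^sup>2)) * (norm s)\<^sup>2" if n: "n \<ge> 1" and s: "norm s \<le> 1/2" for n s
  proof -
    define m where "m = log_partition' b \<theta> n 1 - log_partition b \<theta> n 1 + of_nat n * of_real (mean_constant b \<theta>)"
    define R where "R i t = (case i of 
       0 \<Rightarrow> centred_exponent b \<theta> n t - t * m - (of_nat n * of_real \<sigma> * t\<^sup>2 / 2 - of_nat n * of_real A * t ^ 3 / 6)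
     | Suc 0 \<Rightarrow> log_partition' b \<theta> n (1 + t) - log_partition' b \<theta> n 1 - (of_nat n * of_real \<sigma> * t - of_nat n * of_real A * t\<^sup>2 / 2)
     | _ \<Rightarrow> log_partition'' b \<theta> n (1 + t) - (of_nat n * of_real \<sigma> - of_nat n * of_real A * t))" for i :: nat and t :: complex
    define S where "S = cball (0::complex) (norm s)"
    have S: "norm t \<le> norm s" "Re (1 + t) \<ge> 1/2" if "t \<in> S" for t
      using abs_Re_le_cmod[of t] that s by (auto simp: S_def)
    have "cmod (R 0 s - (\<Sum>i\<le>1. R i 0 * (s - 0) ^ i / fact i)) \<le> (2 + 8 / b * harm n + real n * (H * (norm s)\<^sup>2)) * cmod (s - 0) ^ Suc 1 / fact 1"
    proof (rule complex_Taylor[where S = S])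
      fix i t assume t: "t \<in> S" and "i \<le> (1::nat)"
      have Re: "Re (1 + t) > 0" using S(2)[OF t] by linarith
      have g: "((\<lambda>t. 1 + t) has_field_derivative 1) (at t)" by (auto intro!: derivative_eq_intros)
      have D: "((\<lambda>t. log_partition b \<theta> n (1 + t)) has_field_derivative log_partition' b \<theta> n (1 + t)) (at t)"
        "((\<lambda>t. log_partition' b \<theta> n (1 + t)) has_field_derivative log_partition'' b \<theta> n (1 + t)) (at t)"
        using DERIV_chain2[where f = "log_partition b \<theta> n", OF deriv_log_partition(1)[OF assms(1,2) Re] g]
          DERIV_chain2[where f = "log_partition' b \<theta> n", OF deriv_log_partition(2)[OF assms(1,2) Re] g] by simp_all
      from \<open>i \<le> 1\<close> have "i = 0 \<or> i = 1" by auto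
      then have "(R i has_field_derivative R (Suc i) t) (at t)"
      proof
        assume i: "i = 0"
        have "((\<lambda>t. centred_exponent b \<theta> n t - t * m - (of_nat n * of_real \<sigma> * t\<^sup>2 / 2 - of_nat n * of_real A * t ^ 3 / 6)) has_field_derivative
          (log_partition' b \<theta> n (1 + t) - log_partition' b \<theta> n 1 - (of_nat n * of_real \<sigma> * t - of_nat n * of_real A * t\<^sup>2 / 2))) (at t)"
          unfolding centred_exponent_def m_def by (auto intro!: derivative_eq_intros D(1))
        then show ?thesis by (simp add: R_def[abs_def] i)
      next
        assume i: "i = 1"
        have "((\<lambda>t. log_partition' b \<theta> n (1 + t) - log_partition' b \<theta> n 1 - (of_nat n * of_real \<sigma> * t - of_nat n * of_real A * t\<^sup>2 / 2)) has_field_derivative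
           (log_partition'' b \<theta> n (1 + t) - (of_nat n * of_real \<sigma> - of_nat n * of_real A * t))) (at t)"
          by (auto intro!: derivative_eq_intros D(2))
        then show ?thesis by (simp add: R_def[abs_def] i)
      qed
      then show "(R i has_field_derivative R (Suc i) t) (at t within S)" by (rule has_field_derivative_at_within)
    next
      fix t assume t: "t \<in> S"
      have "R (Suc 1) t = (log_partition'' b \<theta> n (1 + t) - of_nat n * limit_curvature b (1 + t)) + 
          of_nat n * (limit_curvature b (1 + t) - (of_real \<sigma> - of_real A * t))"
        by (simp add: R_def algebra_simps)
      also have "norm \<dots> \<le> (2 + 8 / b * harm n) + real n * (H * (norm s)\<^sup>2)"
      proof (intro order.trans[OF norm_triangle_ineq] add_mono)
        show "norm (log_partition'' b \<theta> n (1 + t) - of_nat n * limit_curvature b (1 + t)) \<le> 2 + 8 / b * harm n"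
          using assms S[OF t] by (intro log_partition_curvature) auto
        have "norm (limit_curvature b (1 + t) - (of_real \<sigma> - of_real A * t)) \<le> H * (norm t)\<^sup>2"
          using S[OF t] s by (intro H(2)) auto
        also have "\<dots> \<le> H * (norm s)\<^sup>2" using S[OF t] H(1) by (intro mult_left_mono power_mono) auto
        finally show "norm (of_nat n * (limit_curvature b (1 + t) - (of_real \<sigma> - of_real A * t))) \<le> real n * (H * (norm s)\<^sup>2)"
          by (simp add: norm_mult mult_left_mono)
      qed
      finally show "cmod (R (Suc 1) t) \<le> 2 + 8 / b * harm n + real n * (H * (norm s)\<^sup>2)" .
    qed (auto simp: S_def)
    moreover have "(\<Sum>i\<le>1. R i 0 * (s - 0) ^ i / fact i) = 0"
      by (simp add: R_def centred_exponent_def)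
    ultimately have "norm (R 0 s) \<le> (2 + 8 / b * harm n + real n * (H * (norm s)\<^sup>2)) * (norm s)\<^sup>2" by (simp add: power2_eq_square)
    moreover have "norm (s * m) \<le> K * harm n * norm s"
      using K[OF n] by (simp add: norm_mult m_def mult.commute mult_left_mono)
    moreover have "centred_exponent b \<theta> n s - (of_nat n * of_real \<sigma> * s\<^sup>2 / 2 - of_nat n * of_real A * s ^ 3 / 6) = s * m + R 0 s"
      by (simp add: R_def)
    ultimately show ?thesis using norm_triangle_ineq[of "s * m" "R 0 s"] by simp
  qed
  then show ?thesis using H(1) by blast
qed

lemma harm_powr_tendsto_0: 
  assumes "e < 0"
  shows "(\<lambda>n. harm n * real n powr e) \<longlonglongrightarrow> 0"
proof -
  have "(\<lambda>n. (harm n - ln (real n)) * real n powr e) \<longlonglongrightarrow> euler_mascheroni * 0"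
    by (intro tendsto_mult euler_mascheroni_LIMSEQ) (use assms in real_asymp)
  moreover have "(\<lambda>n. ln (real n) * real n powr e) \<longlonglongrightarrow> 0" using assms by real_asymp
  ultimately have "(\<lambda>n. (harm n - ln (real n)) * real n powr e + ln (real n) * real n powr e) \<longlonglongrightarrow> euler_mascheroni * 0 + 0"
    by (rule tendsto_add)
  then show ?thesis by (simp add: algebra_simps)
qed

lemma centred_exponent_uniform_limit:
  assumes "b > 0" "\<theta> \<ge> 1"
  defines "\<sigma> \<equiv> b - b\<^sup>2 * Polygamma 1 (1 + b)" and "A \<equiv> b + b ^ 3 * Polygamma 2 (1 + b)"
  assumes S: "bounded S"
  shows "uniform_limit S (\<lambda>n z. centred_exponent b \<theta> n (z * of_real (real n powr (- 1 / 3))) - of_real (real n powr (1 / 3) * \<sigma>) * z\<^sup>2 / 2)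
     (\<lambda>z. - (of_real A * z ^ 3 / 6)) sequentially"
proof -
  obtain \<rho> where \<rho>: "\<rho> > 0" "\<And>z. z \<in> S \<Longrightarrow> norm z \<le> \<rho>" using S bounded_pos by blast
  obtain H K where H: "H \<ge> 0" and HK: "\<And>n s. n \<ge> 1 \<Longrightarrow> norm s \<le> 1/2 \<Longrightarrow>
     norm (centred_exponent b \<theta> n s - (of_nat n * of_real \<sigma> * s\<^sup>2 / 2 - of_nat n * of_real A * s ^ 3 / 6)) \<le>
       K * harm n * norm s + (2 + 8 / b * harm n + real n * (H * (norm s)\<^sup>2)) * (norm s)\<^sup>2"
    using centred_exponent_expansion[OF assms(1,2)] unfolding \<sigma>_def A_def by blast
  define N where "N n = real n powr (- 1 / 3)" for n
  \<comment> \<open>The error bound of the expansion at the largest admissible \<open>|s|\<close>.\<close>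
  define \<delta> where "\<delta> n = \<bar>K\<bar> * (harm n * N n) * \<rho> + (2 * N n powr 2 + 8 / b * (harm n * real n powr (- 2 / 3)) + (H * \<rho>\<^sup>2) * real n powr (- 1 / 3)) * \<rho>\<^sup>2" for n
  have "\<delta> \<longlonglongrightarrow> \<bar>K\<bar> * 0 * \<rho> + (2 * 0 + 8 / b * 0 + (H * \<rho>\<^sup>2) * 0) * \<rho>\<^sup>2"
    unfolding \<delta>_def N_def by (intro tendsto_intros harm_powr_tendsto_0) (simp_all, real_asymp+)
  then have \<delta>: "\<delta> \<longlonglongrightarrow> 0" by simp
  have small: "\<forall>\<^sub>F n in sequentially. \<rho> * N n \<le> 1/2"
  proof -
    have "(\<lambda>n. \<rho> * N n) \<longlonglongrightarrow> 0" unfolding N_def by real_asymp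
    then show ?thesis by (rule eventually_mono[OF order_tendstoD(2), of _ _ _ "1/2"]) auto
  qed
  show ?thesis
  proof (rule uniform_limitI)
    fix e :: real assume "e > 0"
    then have "\<forall>\<^sub>F n in sequentially. \<delta> n < e" using \<delta> order_tendstoD(2) by blast
    with small eventually_ge_at_top[of 1] show "\<forall>\<^sub>F n in sequentially. \<forall>z\<in>S. 
       dist (centred_exponent b \<theta> n (z * of_real (real n powr (- 1 / 3))) - of_real (real n powr (1 / 3) * \<sigma>) * z\<^sup>2 / 2) (- (of_real A * z ^ 3 / 6)) < e"
    proof eventually_elim
      case (elim n)
      have N: "N n > 0" using elim by (simp add: N_def)
      have npos: "real n powr 1 = real n" using elim by simp
      \<comment> \<open>The scale is chosen such that \<open>n s\<^sup>3\<close> is bounded.\<close>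
      have N2: "real n * (N n)\<^sup>2 = real n powr (1 / 3)" 
        unfolding N_def power2_eq_square by (subst (1) npos[symmetric]) (simp only: powr_add[symmetric], simp)
      have N3: "real n * (N n) ^ 3 = 1"
        unfolding N_def power3_eq_cube by (subst (1) npos[symmetric]) (simp only: powr_add[symmetric], use elim in simp)
      show ?case
      proof
        fix z assume z: "z \<in> S"
        define s where "s = z * of_real (N n)"
        have ns: "norm s = norm z * N n" using N by (simp add: s_def norm_mult)
        also have "\<dots> \<le> \<rho> * N n" using N \<rho>(2)[OF z] by (intro mult_right_mono) auto
        finally have s: "norm s \<le> \<rho> * N n" "norm s \<le> 1/2" using elim by auto
        have "of_nat n * of_real \<sigma> * s\<^sup>2 / 2 = of_real (real n * (N n)\<^sup>2 * \<sigma>) * z\<^sup>2 / 2"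
          by (simp add: s_def power_mult_distrib)
        then have eq1: "of_nat n * of_real \<sigma> * s\<^sup>2 / 2 = of_real (real n powr (1 / 3) * \<sigma>) * z\<^sup>2 / 2" unfolding N2 .
        have "of_nat n * of_real A * s ^ 3 / 6 = of_real (real n * (N n) ^ 3) * of_real A * z ^ 3 / 6"
          by (simp add: s_def power_mult_distrib)
        then have eq2: "of_nat n * of_real A * s ^ 3 / 6 = of_real A * z ^ 3 / 6" unfolding N3 by simp
        have "dist (centred_exponent b \<theta> n s - of_real (real n powr (1 / 3) * \<sigma>) * z\<^sup>2 / 2) (- (of_real A * z ^ 3 / 6)) = 
          norm (centred_exponent b \<theta> n s - (of_nat n * of_real \<sigma> * s\<^sup>2 / 2 - of_nat n * of_real A * s ^ 3 / 6))"
          unfolding eq1 eq2 dist_norm by (simp add: algebra_simps)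
        also have "\<dots> \<le> K * harm n * norm s + (2 + 8 / b * harm n + real n * (H * (norm s)\<^sup>2)) * (norm s)\<^sup>2"
          using elim s by (intro HK) auto
        also have "\<dots> \<le> \<bar>K\<bar> * harm n * (\<rho> * N n) + (2 + 8 / b * harm n + real n * (H * (\<rho> * N n)\<^sup>2)) * (\<rho> * N n)\<^sup>2"
          using s H assms(1) harm_nonneg[of n, where 'a = real] N \<rho>
          by (intro add_mono mult_mono power_mono order.refl) (auto intro!: add_nonneg_nonneg mult_nonneg_nonneg)
        also have "\<dots> = \<delta> n"
        proof -
          have e1: "N n powr 2 = (N n)\<^sup>2" using N by simp
          have e2: "real n powr (- 2 / 3) = (N n)\<^sup>2" unfolding N_def power2_eq_square by (simp flip: powr_add)
          have e3: "real n powr (- 1 / 3) = real n * (N n)\<^sup>2 * (N n)\<^sup>2"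
          proof -
            have "real n * (N n)\<^sup>2 * (N n)\<^sup>2 = real n powr 1 * real n powr (- 2 / 3) * real n powr (- 2 / 3)"
              by (simp only: e2 npos)
            also have "\<dots> = real n powr (- 1 / 3)" by (simp only: powr_add[symmetric]) simp
            finally show ?thesis ..
          qed
          show ?thesis unfolding \<delta>_def e1 e2 e3 by (simp add: power_mult_distrib algebra_simps)
        qed
        finally show "dist (centred_exponent b \<theta> n (z * of_real (real n powr (- 1 / 3))) - of_real (real n powr (1 / 3) * \<sigma>) * z\<^sup>2 / 2) (- (of_real A * z ^ 3 / 6)) < e"
          using elim by (simp add: s_def N_def)
      qed
    qed
  qed
qed


section \<open>Analytic continuation in the inverse temperature\<close>

text \<open>
  Around \<open>z\<^sub>0\<close> expand \<open>exp ((z - z\<^sub>0) ln f)\<close>; the absolute series sums to \<open>exp (|z - z\<^sub>0| |ln f|)\<close>, which is at most the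
  sum of the powers of \<open>f\<close> with real exponents \<open>Re z\<^sub>0 \<plusminus> |z - z\<^sub>0|\<close>.  Hence the integral is a power series.
\<close>

lemma
  fixes f :: "'a \<Rightarrow> real"
  assumes [measurable]: "f \<in> borel_measurable M" and f: "\<And>x. f x \<ge> 0"
    and int: "\<And>r. r > 0 \<Longrightarrow> integrable M (\<lambda>x. f x powr r)"
  shows integrable_complex_power: "Re z > 0 \<Longrightarrow> integrable M (\<lambda>x. if f x = 0 then 0 else exp (z * of_real (ln (f x))))"
    and holomorphic_power_integral: 
      "(\<lambda>z. LINT x|M. (if f x = 0 then 0 else exp (z * of_real (ln (f x))))) holomorphic_on {z. Re z > 0}"
proof -
  define p where "p z x = (if f x = 0 then 0 else exp (z * of_real (ln (f x))))" for z :: complex and x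
  have [measurable]: "p z \<in> borel_measurable M" for z unfolding p_def by measurable
  have norm_p: "norm (p z x) = f x powr Re z" for z x
    using f[of x] by (auto simp: p_def powr_def)
  show int_p: "integrable M (\<lambda>x. if f x = 0 then 0 else exp (z * of_real (ln (f x))))" if "Re z > 0" for z
    unfolding p_def[symmetric]
    by (rule Bochner_Integration.integrable_bound[OF int[OF that]]) (auto simp: norm_p)
  have "(\<lambda>z. LINT x|M. p z x) holomorphic_on ball z0 (Re z0)" if z0: "Re z0 > 0" for z0
  proof (rule power_series_holomorphic)
    fix z assume "z \<in> ball z0 (Re z0)"
    then have d: "norm (z - z0) < Re z0" by (simp add: dist_norm norm_minus_commute)
    define t where "t = norm (z - z0)"
    have t: "0 \<le> t" "t < Re z0" using d by (auto simp: t_def)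
    define g where "g k x = p z0 x * of_real (ln (f x) ^ k / fact k) * (z - z0) ^ k" for k x
    have norm_g: "norm (g k x) = f x powr Re z0 * ((t * \<bar>ln (f x)\<bar>) ^ k /\<^sub>R fact k)" for k x
      by (simp add: g_def norm_mult norm_power norm_p t_def power_mult_distrib norm_divide norm_inverse power_abs divide_inverse mult_ac)
    have sums_norm: "(\<lambda>k. norm (g k x)) sums (f x powr Re z0 * exp (t * \<bar>ln (f x)\<bar>))" for x
      unfolding norm_g by (intro sums_mult exp_converges)
    have maj: "f x powr Re z0 * exp (t * \<bar>ln (f x)\<bar>) \<le> f x powr (Re z0 + t) + f x powr (Re z0 - t)" for x
    proof (cases "f x = 0")
      case False
      then have "f x > 0" using f[of x] by simp
      then show ?thesis
        by (cases "ln (f x) \<ge> 0") (auto simp: powr_def exp_add[symmetric] algebra_simps)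
    qed simp
    have int_maj: "integrable M (\<lambda>x. f x powr (Re z0 + t) + f x powr (Re z0 - t))"
      using t z0 by (intro Bochner_Integration.integrable_add int) auto
    have [measurable]: "g k \<in> borel_measurable M" for k unfolding g_def by measurable
    have le_maj: "(\<Sum>k<N. norm (g k x)) \<le> f x powr (Re z0 + t) + f x powr (Re z0 - t)" for N x
      using sum_le_suminf[OF sums_summable[OF sums_norm[of x]], of "{..<N}"] sums_unique[OF sums_norm[of x]] maj[of x] by simp
    have int_g: "integrable M (g k)" for k
    proof (rule Bochner_Integration.integrable_bound[OF int_maj])
      show "AE x in M. norm (g k x) \<le> norm (f x powr (Re z0 + t) + f x powr (Re z0 - t))"
      proof (rule AE_I2)
        fix x
        have "norm (g k x) \<le> (\<Sum>j<Suc k. norm (g j x))" by (simp add: sum_nonneg)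
        also have "\<dots> \<le> f x powr (Re z0 + t) + f x powr (Re z0 - t)" by (rule le_maj)
        also have "\<dots> \<le> norm (f x powr (Re z0 + t) + f x powr (Re z0 - t))" by simp
        finally show "norm (g k x) \<le> norm (f x powr (Re z0 + t) + f x powr (Re z0 - t))" .
      qed
    qed measurable
    have "(\<lambda>k. LINT x|M. g k x) sums (LINT x|M. (\<Sum>k. g k x))"
    proof (rule sums_integral)
      show "AE x in M. summable (\<lambda>k. norm (g k x))" using sums_summable[OF sums_norm] by auto
      show "summable (\<lambda>k. LINT x|M. norm (g k x))"
      proof (rule bounded_imp_summable)
        fix N
        have "(\<Sum>k\<le>N. LINT x|M. norm (g k x)) = (LINT x|M. (\<Sum>k<Suc N. norm (g k x)))"
          using int_g by (subst Bochner_Integration.integral_sum) (auto simp: lessThan_Suc_atMost)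
        also have "\<dots> \<le> (LINT x|M. f x powr (Re z0 + t) + f x powr (Re z0 - t))"
          using int_g by (intro integral_mono int_maj le_maj Bochner_Integration.integrable_sum) auto
        finally show "(\<Sum>k\<le>N. LINT x|M. norm (g k x)) \<le> (LINT x|M. f x powr (Re z0 + t) + f x powr (Re z0 - t))" .
      qed (auto intro!: integral_nonneg_AE)
    qed (rule int_g)
    moreover have "(\<Sum>k. g k x) = p z x" for x
    proof -
      have "(\<lambda>k. p z0 x * (((z - z0) * of_real (ln (f x))) ^ k /\<^sub>R fact k)) sums (p z0 x * exp ((z - z0) * of_real (ln (f x))))"
        by (intro sums_mult exp_converges)
      moreover have "p z0 x * (((z - z0) * of_real (ln (f x))) ^ k /\<^sub>R fact k) = g k x" for k
        by (simp add: g_def power_mult_distrib scaleR_conv_of_real divide_inverse mult_ac)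
      moreover have "p z0 x * exp ((z - z0) * of_real (ln (f x))) = p z x"
        by (simp add: p_def exp_add[symmetric] algebra_simps)
      ultimately show ?thesis by (simp add: sums_iff)
    qed
    moreover have "(LINT x|M. g k x) = (LINT x|M. p z0 x * of_real (ln (f x) ^ k / fact k)) * (z - z0) ^ k" for k
      unfolding g_def by (rule integral_mult_left_zero)
    ultimately show "(\<lambda>k. (LINT x|M. p z0 x * of_real (ln (f x) ^ k / fact k)) * (z - z0) ^ k) sums (LINT x|M. p z x)"
      by simp
  qed
  then have "(\<lambda>z. LINT x|M. p z x) field_differentiable at z0" if "Re z0 > 0" for z0
    using that by (intro holomorphic_on_imp_differentiable_at[OF _ open_ball]) auto
  then show "(\<lambda>z. LINT x|M. (if f x = 0 then 0 else exp (z * of_real (ln (f x))))) holomorphic_on {z. Re z > 0}"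
    unfolding p_def[symmetric] by (auto simp: holomorphic_on_def intro: field_differentiable_at_within)
qed

lemma prod_pairs_eq_vandermonde_powr:
  fixes l :: "nat \<Rightarrow> real"
  shows "(\<Prod>(j, k)\<in>{(j, k). 1 \<le> j \<and> j < k \<and> k \<le> n}. \<bar>l k - l j\<bar> powr \<beta>) = vandermonde_powr (\<beta> / 2) {1..n} l"
proof (induction n)
  case 0
  have "{(j, k). 1 \<le> j \<and> j < k \<and> k \<le> (0::nat)} = {}" by auto
  then show ?case by (simp only:) (simp add: vandermonde_powr_def)
next
  case (Suc n)
  have "{(j, k). 1 \<le> j \<and> j < k \<and> k \<le> Suc n} = {(j, k). 1 \<le> j \<and> j < k \<and> k \<le> n} \<union> (\<lambda>j. (j, Suc n)) ` {1..n}"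
    by (auto simp: le_Suc_eq)
  moreover have "finite {(j, k). 1 \<le> j \<and> j < k \<and> k \<le> n}"
    by (rule finite_subset[of _ "{1..n} \<times> {1..n}"]) auto
  moreover have "{(j, k). 1 \<le> j \<and> j < k \<and> k \<le> n} \<inter> (\<lambda>j. (j, Suc n)) ` {1..n} = {}" by auto
  ultimately have "(\<Prod>(j, k)\<in>{(j, k). 1 \<le> j \<and> j < k \<and> k \<le> Suc n}. \<bar>l k - l j\<bar> powr \<beta>) = 
      (\<Prod>(j, k)\<in>{(j, k). 1 \<le> j \<and> j < k \<and> k \<le> n}. \<bar>l k - l j\<bar> powr \<beta>) * (\<Prod>j\<in>{1..n}. \<bar>l (Suc n) - l j\<bar> powr \<beta>)"
    by (simp add: prod.union_disjoint prod.reindex inj_on_def)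
  moreover have "{1..Suc n} = insert (Suc n) {1..n}" by auto
  ultimately show ?case using Suc by (simp add: vandermonde_powr_insert mult_ac)
qed

lemma laguerre_weight_eq_wt:
  assumes "\<And>i. i \<in> {1..n} \<Longrightarrow> l i > 0"
  shows "laguerre_weight \<theta> n \<beta> l = laguerre_wt (1 + \<beta> / 2 * (real n * (\<theta> - 1))) (\<beta> / 2 * real n * \<theta>) (\<beta> / 2) {1..n} l"
proof -
  have "(\<Prod>k=1..n. exp (- (\<beta> / 2) * real n * L_pot \<theta> (l k))) = 
     (\<Prod>i\<in>{1..n}. gamma_wt (1 + \<beta> / 2 * (real n * (\<theta> - 1))) (\<beta> / 2 * real n * \<theta>) (l i))"
  proof (intro prod.cong refl)
    fix i assume "i \<in> {1..n}"
    then have "l i > 0" by (rule assms)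
    then show "exp (- (\<beta> / 2) * real n * L_pot \<theta> (l i)) = 
        gamma_wt (1 + \<beta> / 2 * (real n * (\<theta> - 1))) (\<beta> / 2 * real n * \<theta>) (l i)"
      by (simp add: powr_def L_pot_def mult_exp_exp algebra_simps)
  qed
  then show ?thesis unfolding laguerre_weight_def laguerre_wt_def prod_pairs_eq_vandermonde_powr by simp
qed

lemma laguerre_weight_nonneg: "laguerre_weight \<theta> n \<beta> l \<ge> 0"
  unfolding laguerre_weight_def by (auto intro!: mult_nonneg_nonneg prod_nonneg)

lemma laguerre_weight_powr: "laguerre_weight \<theta> n \<beta> l powr r = laguerre_weight \<theta> n (\<beta> * r) l"
proof -
  have 1: "(\<Prod>(j, k)\<in>A. \<bar>l k - l j\<bar> powr \<beta>) powr r = (\<Prod>(j, k)\<in>A. \<bar>l k - l j\<bar> powr (\<beta> * r))" for A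
    unfolding prod_powr_distrib by (intro prod.cong refl) (auto simp: powr_powr)
  have 2: "(\<Prod>k=1..n. exp (- (\<beta> / 2) * real n * L_pot \<theta> (l k))) powr r = (\<Prod>k=1..n. exp (- (\<beta> * r / 2) * real n * L_pot \<theta> (l k)))"
    unfolding prod_powr_distrib by (intro prod.cong refl) (simp add: exp_powr_real mult_ac)
  show ?thesis unfolding laguerre_weight_def 1[symmetric] 2[symmetric] by (rule powr_mult)
qed

lemma measurable_laguerre_weight [measurable]: "laguerre_weight \<theta> n \<beta> \<in> borel_measurable (pos_lebesgue n)"
proof -
  have "laguerre_weight \<theta> n \<beta> \<in> borel_measurable (Leb {1..n})"
    unfolding laguerre_weight_def prod_pairs_eq_vandermonde_powr L_pot_def by measurable
  then show ?thesis unfolding pos_lebesgue_def by (rule measurable_restrict_space1)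
qed

lemma
  fixes f :: "(nat \<Rightarrow> real) \<Rightarrow> real"
  assumes "\<And>l. (\<And>i. i \<in> {1..n} \<Longrightarrow> l i > 0) \<Longrightarrow> f l = g l" "\<And>l i. i \<in> {1..n} \<Longrightarrow> l i \<le> 0 \<Longrightarrow> g l = 0"
  shows integrable_pos_lebesgue: "integrable (pos_lebesgue n) f \<longleftrightarrow> integrable (Leb {1..n}) g"
    and integral_pos_lebesgue: "(LINT l|pos_lebesgue n. f l) = (LINT l|Leb {1..n}. g l)"
proof -
  have S: "(\<Pi>\<^sub>E i\<in>{1..n}. {0<..}) \<inter> space (Leb {1..n}) \<in> sets (Leb {1..n})"
    by (intro sets.Int sets_PiM_I_finite) auto
  have eq: "indicator (\<Pi>\<^sub>E i\<in>{1..n}. {0<..}) l *\<^sub>R f l = g l" if "l \<in> space (Leb {1..n})" for l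
  proof (cases "\<forall>i\<in>{1..n}. l i > 0")
    case True
    then have "l \<in> (\<Pi>\<^sub>E i\<in>{1..n}. {0<..})" using that by (auto simp: space_PiM PiE_iff)
    then show ?thesis using True assms(1)[of l] by simp
  next
    case False
    then obtain i where i: "i \<in> {1..n}" "l i \<le> 0" by force
    then have "l \<notin> (\<Pi>\<^sub>E i\<in>{1..n}. {0<..})" by (force simp: PiE_iff)
    then show ?thesis using assms(2)[of i l] i by simp
  qed
  show "integrable (pos_lebesgue n) f \<longleftrightarrow> integrable (Leb {1..n}) g"
    unfolding pos_lebesgue_def integrable_restrict_space[OF S]
    by (intro Bochner_Integration.integrable_cong refl) (rule eq)
  show "(LINT l|pos_lebesgue n. f l) = (LINT l|Leb {1..n}. g l)"
    unfolding pos_lebesgue_def integral_restrict_space[OF S]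
    by (intro Bochner_Integration.integral_cong refl) (rule eq)
qed

lemma
  assumes "\<beta> > 0" "\<theta> \<ge> 1" "n \<ge> 1"
  shows integrable_laguerre_weight: "integrable (pos_lebesgue n) (laguerre_weight \<theta> n \<beta>)"
    and laguerre_Z_eq_selberg: "laguerre_Z \<theta> n \<beta> = selberg (1 + \<beta> / 2 * (real n * (\<theta> - 1))) (\<beta> / 2 * real n * \<theta>) (\<beta> / 2) {1..n}"
proof -
  have p: "1 + \<beta> / 2 * (real n * (\<theta> - 1)) \<ge> 1" "\<beta> / 2 * real n * \<theta> > 0" "\<beta> / 2 \<ge> 0"
    using assms by (auto intro!: mult_pos_pos)
  show "integrable (pos_lebesgue n) (laguerre_weight \<theta> n \<beta>)"
    using p by (subst integrable_pos_lebesgue[OF laguerre_weight_eq_wt laguerre_wt_eq_0]) (auto intro!: integrable_laguerre_wt)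
  show "laguerre_Z \<theta> n \<beta> = selberg (1 + \<beta> / 2 * (real n * (\<theta> - 1))) (\<beta> / 2 * real n * \<theta>) (\<beta> / 2) {1..n}"
    unfolding laguerre_Z_def selberg_def by (rule integral_pos_lebesgue[OF laguerre_weight_eq_wt laguerre_wt_eq_0]) auto
qed

lemma laguerre_Z_pos:
  assumes "\<beta> > 0" "\<theta> \<ge> 1" "n \<ge> 1"
  shows "laguerre_Z \<theta> n \<beta> > 0"
  unfolding laguerre_Z_eq_selberg[OF assms] using assms by (intro selberg_pos) (auto intro!: mult_pos_pos)

lemma laguerre_Z_real:
  assumes "b > 0" "\<theta> \<ge> 1" "n \<ge> 1" "b * r > 1/2"
  shows "complex_of_real (laguerre_Z \<theta> n (2 * b * r)) = exp (log_partition b \<theta> n (of_real r))"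
proof -
  have "r > 0" using assms by (metis half_gt_zero_iff less_trans zero_less_mult_pos zero_less_one)
  have g: "ln_Gamma (1 + complex_of_real u * of_real r) = of_real (ln_Gamma (1 + u * r))" if "u \<ge> 0" for u
    using ln_Gamma_complex_of_real[of "1 + u * r"] that \<open>r > 0\<close> by (simp add: add_pos_nonneg)
  define P where "P = - (real n + scale_exponent b \<theta> n * r) * (ln r + ln (b * real n * \<theta>))
     + (\<Sum>j<n. ln_Gamma (1 + lower_shift b \<theta> n j * r) + ln_Gamma (1 + b * real (Suc j) * r)) - real n * ln_Gamma (1 + b * r)"
  have "log_partition b \<theta> n (of_real r) = of_real P"
    unfolding log_partition_def P_def using assms \<open>r > 0\<close> g[OF lower_shift_nonneg[OF assms(1,2)]] g[of "b * real (Suc j)" for j] g[of b]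
    by (simp add: Ln_of_real)
  moreover have "laguerre_Z \<theta> n (2 * b * r) = exp P"
  proof -
    define B where "B = b * r * real n * \<theta>"
    have B: "B > 0" "ln B = ln r + ln (b * real n * \<theta>)" using assms \<open>r > 0\<close> 
      by (auto simp: B_def ln_mult intro!: mult_pos_pos)
    have G: "exp (ln_Gamma (1 + u)) = Gamma (1 + u)" if "u \<ge> 0" for u :: real
      using that by (simp add: Gamma_real_pos_exp)
    have "laguerre_Z \<theta> n (2 * b * r) = selberg (1 + b * r * (real n * (\<theta> - 1))) B (b * r) {1..n}"
      using laguerre_Z_eq_selberg[of "2 * b * r" \<theta> n] assms \<open>r > 0\<close> by (simp add: B_def)
    also have "\<dots> = B powr (- (real n * (1 + b * r * (real n * (\<theta> - 1))) + real n * (real n - 1) * (b * r))) *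
       (\<Prod>k<n. Gamma (1 + b * r * (real n * (\<theta> - 1)) + b * r * real k) * Gamma (1 + b * r * real (Suc k)) / Gamma (1 + b * r))"
      using assms B \<open>r > 0\<close> by (subst selberg_laguerre) auto
    also have "B powr (- (real n * (1 + b * r * (real n * (\<theta> - 1))) + real n * (real n - 1) * (b * r))) = 
       exp (- (real n + scale_exponent b \<theta> n * r) * (ln r + ln (b * real n * \<theta>)))"
    proof -
      have "- (real n * (1 + b * r * (real n * (\<theta> - 1))) + real n * (real n - 1) * (b * r)) = - (real n + scale_exponent b \<theta> n * r)"
        by (simp add: scale_exponent_def power2_eq_square algebra_simps)
      then show ?thesis using B by (simp add: powr_def)
    qed
    also have "(\<Prod>k<n. Gamma (1 + b * r * (real n * (\<theta> - 1)) + b * r * real k) * Gamma (1 + b * r * real (Suc k)) / Gamma (1 + b * r)) = 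
       (\<Prod>k<n. exp (ln_Gamma (1 + lower_shift b \<theta> n k * r) + ln_Gamma (1 + b * real (Suc k) * r) - ln_Gamma (1 + b * r)))"
    proof (intro prod.cong refl)
      fix k
      have "1 + b * r * (real n * (\<theta> - 1)) + b * r * real k = 1 + lower_shift b \<theta> n k * r"
         "1 + b * r * real (Suc k) = 1 + b * real (Suc k) * r"
        by (simp_all add: lower_shift_def algebra_simps)
      then show "Gamma (1 + b * r * (real n * (\<theta> - 1)) + b * r * real k) * Gamma (1 + b * r * real (Suc k)) / Gamma (1 + b * r) = 
          exp (ln_Gamma (1 + lower_shift b \<theta> n k * r) + ln_Gamma (1 + b * real (Suc k) * r) - ln_Gamma (1 + b * r))"
        unfolding exp_diff exp_add using assms \<open>r > 0\<close> by (simp only: G mult_nonneg_nonneg lower_shift_nonneg less_imp_le of_nat_0_le_iff)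
    qed
    also have "\<dots> = exp (\<Sum>k<n. ln_Gamma (1 + lower_shift b \<theta> n k * r) + ln_Gamma (1 + b * real (Suc k) * r) - ln_Gamma (1 + b * r))"
      by (simp add: exp_sum)
    also have "(\<Sum>k<n. ln_Gamma (1 + lower_shift b \<theta> n k * r) + ln_Gamma (1 + b * real (Suc k) * r) - ln_Gamma (1 + b * r)) = 
       (\<Sum>k<n. ln_Gamma (1 + lower_shift b \<theta> n k * r) + ln_Gamma (1 + b * real (Suc k) * r)) - real n * ln_Gamma (1 + b * r)"
      by (simp add: sum_subtractf)
    finally show ?thesis unfolding P_def by (simp only: exp_add[symmetric]) (simp add: algebra_simps)
  qed
  ultimately show ?thesis by (simp add: exp_of_real)
qed

definition complex_partition :: "real \<Rightarrow> nat \<Rightarrow> real \<Rightarrow> complex \<Rightarrow> complex" where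
  "complex_partition \<theta> n \<beta> x = (LINT l|pos_lebesgue n. (if laguerre_weight \<theta> n \<beta> l = 0 then 0 
      else exp (x * of_real (ln (laguerre_weight \<theta> n \<beta> l)))))"

lemma integrable_laguerre_weight_powr:
  assumes "\<beta> > 0" "\<theta> \<ge> 1" "n \<ge> 1" "r > 0"
  shows "integrable (pos_lebesgue n) (\<lambda>l. laguerre_weight \<theta> n \<beta> l powr r)"
  unfolding laguerre_weight_powr using assms by (intro integrable_laguerre_weight) auto

lemma complex_partition_of_real:
  assumes "r > 0"
  shows "complex_partition \<theta> n \<beta> (of_real r) = of_real (laguerre_Z \<theta> n (\<beta> * r))"
proof -
  have "(if laguerre_weight \<theta> n \<beta> l = 0 then 0 else exp (of_real r * of_real (ln (laguerre_weight \<theta> n \<beta> l)))) = complex_of_real (laguerre_weight \<theta> n (\<beta> * r) l)" for l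
    unfolding laguerre_weight_powr[symmetric] using laguerre_weight_nonneg[of \<theta> n \<beta> l]
    by (simp add: powr_def exp_of_real flip: of_real_mult)
  then show ?thesis by (simp add: complex_partition_def laguerre_Z_def)
qed

text \<open>
  For real \<open>x > 1 / (2 b)\<close> the Selberg formula applies with exponent \<open>g = b x > 1/2\<close>.  Both sides are holomorphic
  in the right half-plane.
\<close>

theorem complex_partition_eq:
  assumes "b > 0" "\<theta> \<ge> 1" "n \<ge> 1" "Re x > 0"
  shows "complex_partition \<theta> n (2 * b) x = exp (log_partition b \<theta> n x)"
proof -
  define S where "S = {z. Re z > 0}"
  define U where "U = complex_of_real ` {1 / (2 * b)<..}"
  define \<xi> where "\<xi> = complex_of_real (1 / (2 * b) + 1)"
  have "complex_partition \<theta> n (2 * b) x - exp (log_partition b \<theta> n x) = 0"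
  proof (rule analytic_continuation[where S = S and U = U and \<xi> = \<xi> and f = "\<lambda>x. complex_partition \<theta> n (2 * b) x - exp (log_partition b \<theta> n x)"])
    have "complex_partition \<theta> n (2 * b) holomorphic_on S"
      unfolding complex_partition_def[abs_def] S_def using assms
      by (intro holomorphic_power_integral integrable_laguerre_weight_powr laguerre_weight_nonneg) auto
    moreover have "log_partition b \<theta> n holomorphic_on S"
      using deriv_log_partition(1)[OF assms(1,2)] unfolding S_def
      by (auto simp: holomorphic_on_def field_differentiable_def intro: has_field_derivative_at_within)
    ultimately show "(\<lambda>x. complex_partition \<theta> n (2 * b) x - exp (log_partition b \<theta> n x)) holomorphic_on S"
      by (intro holomorphic_intros)
    show "open S" unfolding S_def by (rule open_halfspace_Re_gt)
    show "connected S" unfolding S_def by (intro convex_connected convex_halfspace_Re_gt)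
    have "1 / (2 * b) > 0" using assms by simp
    then show "U \<subseteq> S" "\<xi> \<in> S" unfolding U_def S_def \<xi>_def by (auto intro: less_trans[OF \<open>1 / (2 * b) > 0\<close>] add_pos_pos)
    show "\<xi> islimpt U" unfolding islimpt_approachable
    proof (intro allI impI)
      fix e :: real assume "e > 0"
      then have "of_real (1 / (2 * b) + 1 + e / 2) \<in> U" unfolding U_def by (intro imageI) simp
      moreover have "dist (complex_of_real (1 / (2 * b) + 1 + e / 2)) \<xi> = e / 2"
        unfolding \<xi>_def dist_of_real using \<open>e > 0\<close> by (simp add: dist_real_def)
      ultimately show "\<exists>x'\<in>U. x' \<noteq> \<xi> \<and> dist x' \<xi> < e" using \<open>e > 0\<close>
        by (intro bexI[of _ "of_real (1 / (2 * b) + 1 + e / 2)"]) auto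
    qed
    fix z assume "z \<in> U"
    then obtain r where r: "z = of_real r" "r > 1 / (2 * b)" by (auto simp: U_def)
    then have "b * r > 1 / 2" using assms by (simp add: field_simps)
    moreover have "1 / (2 * b) > 0" using assms by simp
    with r have "r > 0" by linarith
    ultimately show "complex_partition \<theta> n (2 * b) z - exp (log_partition b \<theta> n z) = 0"
      using assms by (simp add: r complex_partition_of_real laguerre_Z_real)
  qed (use assms in \<open>auto simp: S_def\<close>)
  then show ?thesis by simp
qed


section \<open>Fourier analysis on the half-circle\<close>

definition arc_integral :: "(real \<Rightarrow> real) \<Rightarrow> real" where
  "arc_integral f = (LINT \<phi>|lborel. indicator {0..pi} \<phi> * f \<phi>)"

abbreviation arc_integrable :: "(real \<Rightarrow> real) \<Rightarrow> bool" where
  "arc_integrable f \<equiv> integrable lborel (\<lambda>\<phi>. indicator {0..pi} \<phi> * f \<phi>)"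

lemma integrable_arc:
  assumes "continuous_on {0..pi} f"
  shows "arc_integrable f"
  using borel_integrable_atLeastAtMost'[OF assms] by (simp add: set_integrable_def)

lemma arc_integral_cos_int: "arc_integral (\<lambda>\<phi>. cos (of_int j * \<phi>)) = (if j = 0 then pi else 0)"
proof (cases "j = 0")
  case True
  then show ?thesis by (simp add: arc_integral_def)
next
  case False
  have "(LINT \<phi>|lborel. indicator {0..pi} \<phi> *\<^sub>R cos (of_int j * \<phi>)) = sin (of_int j * pi) / of_int j - sin (of_int j * 0) / of_int j"
    using False by (intro integral_FTC_atLeastAtMost) 
      (auto intro!: derivative_eq_intros continuous_intros simp flip: has_real_derivative_iff_has_vector_derivative)
  moreover have "sin (of_int j * pi) = 0" by (auto simp: sin_zero_iff_int2)
  ultimately show ?thesis using False by (simp add: arc_integral_def)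
qed

lemma arc_integral_add:
  assumes "continuous_on {0..pi} f" "continuous_on {0..pi} g"
  shows "arc_integral (\<lambda>\<phi>. f \<phi> + g \<phi>) = arc_integral f + arc_integral g"
  unfolding arc_integral_def distrib_left using assms by (intro Bochner_Integration.integral_add integrable_arc)

lemma arc_integral_cmult: "arc_integral (\<lambda>\<phi>. c * f \<phi>) = c * arc_integral f"
proof -
  have "arc_integral (\<lambda>\<phi>. c * f \<phi>) = (LINT \<phi>|lborel. c * (indicator {0..pi} \<phi> * f \<phi>))"
    by (simp add: arc_integral_def mult_ac)
  then show ?thesis by (simp only: integral_mult_right_zero arc_integral_def)
qed

lemma arc_integral_cong: "(\<And>\<phi>. 0 \<le> \<phi> \<Longrightarrow> \<phi> \<le> pi \<Longrightarrow> f \<phi> = g \<phi>) \<Longrightarrow> arc_integral f = arc_integral g"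
  unfolding arc_integral_def by (intro Bochner_Integration.integral_cong) (auto simp: indicator_def)

lemma arc_integral_cos_cos:
  "arc_integral (\<lambda>\<phi>. cos (real k * \<phi>) * cos (real m * \<phi>)) = (if k = m then if k = 0 then pi else pi / 2 else 0)"
proof -
  have "arc_integral (\<lambda>\<phi>. cos (real k * \<phi>) * cos (real m * \<phi>)) = 
     arc_integral (\<lambda>\<phi>. 1 / 2 * cos (of_int (int k - int m) * \<phi>) + 1 / 2 * cos (of_int (int k + int m) * \<phi>))"
    by (intro arc_integral_cong) (simp add: cos_times_cos algebra_simps add_divide_distrib)
  also have "\<dots> = 1 / 2 * (if int k - int m = 0 then pi else 0) + 1 / 2 * (if int k + int m = 0 then pi else 0)"
    by (subst arc_integral_add) (auto intro!: continuous_intros simp only: arc_integral_cmult arc_integral_cos_int)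
  finally show ?thesis by auto
qed

lemma cosine_series_arc_integral:
  assumes c: "summable (\<lambda>k. \<bar>c k\<bar>)" and g: "continuous_on {0..pi} g"
    and f: "\<And>\<phi>. 0 \<le> \<phi> \<Longrightarrow> \<phi> \<le> pi \<Longrightarrow> (\<lambda>k. c k * cos (real k * \<phi>)) sums f \<phi>"
  shows "(\<lambda>k. c k * arc_integral (\<lambda>\<phi>. cos (real k * \<phi>) * g \<phi>)) sums arc_integral (\<lambda>\<phi>. f \<phi> * g \<phi>)"
proof -
  obtain B where B: "B > 0" "\<And>\<phi>. \<phi> \<in> {0..pi} \<Longrightarrow> norm (g \<phi>) \<le> B"
    using compact_imp_bounded[OF compact_continuous_image[OF g]] bounded_pos by (metis compact_Icc imageI)
  define h where "h k \<phi> = indicator {0..pi} \<phi> * (c k * (cos (real k * \<phi>) * g \<phi>))" for k \<phi>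
  have int_h: "integrable lborel (h k)" for k
    unfolding h_def using g by (intro integrable_arc continuous_intros)
  have h_le: "norm (h k \<phi>) \<le> indicator {0..pi} \<phi> * (\<bar>c k\<bar> * B)" for k \<phi>
  proof (cases "\<phi> \<in> {0..pi}")
    case True
    have "\<bar>cos (real k * \<phi>)\<bar> * \<bar>g \<phi>\<bar> \<le> 1 * B" using B(2)[OF True] by (intro mult_mono) auto
    then show ?thesis using True by (simp add: h_def abs_mult mult_left_mono)
  qed (simp add: h_def)
  have "(\<lambda>k. LINT \<phi>|lborel. h k \<phi>) sums (LINT \<phi>|lborel. (\<Sum>k. h k \<phi>))"
  proof (rule sums_integral)
    show "AE \<phi> in lborel. summable (\<lambda>k. norm (h k \<phi>))"
      by (intro AE_I2 summable_comparison_test'[OF summable_mult[OF summable_mult2[OF c, of B]]])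
         (use h_le in auto)
    show "summable (\<lambda>k. LINT \<phi>|lborel. norm (h k \<phi>))"
    proof (rule summable_comparison_test')
      show "summable (\<lambda>k. \<bar>c k\<bar> * (B * pi))" using c by (rule summable_mult2)
      fix k
      have "(LINT \<phi>|lborel. norm (h k \<phi>)) \<le> (LINT \<phi>|lborel. indicator {0..pi} \<phi> * (\<bar>c k\<bar> * B))"
        using int_h by (intro integral_mono h_le integrable_arc) auto
      then show "norm (LINT \<phi>|lborel. norm (h k \<phi>)) \<le> \<bar>c k\<bar> * (B * pi)"
        by (simp add: integral_nonneg_AE mult_ac)
    qed
  qed (rule int_h)
  moreover have "(\<Sum>k. h k \<phi>) = indicator {0..pi} \<phi> * (f \<phi> * g \<phi>)" for \<phi>
  proof (cases "\<phi> \<in> {0..pi}")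
    case True
    have "(\<lambda>k. c k * cos (real k * \<phi>) * g \<phi>) sums (f \<phi> * g \<phi>)" using f True by (intro sums_mult2) auto
    then show ?thesis using True by (simp add: h_def sums_iff mult_ac)
  qed (simp add: h_def)
  moreover have "(LINT \<phi>|lborel. h k \<phi>) = c k * arc_integral (\<lambda>\<phi>. cos (real k * \<phi>) * g \<phi>)" for k
    using arc_integral_cmult[of "c k" "\<lambda>\<phi>. cos (real k * \<phi>) * g \<phi>"] by (simp add: arc_integral_def h_def)
  ultimately show ?thesis by (simp add: arc_integral_def)
qed

text \<open>
  The squared modulus of \<open>1 + q e\<^sup>i\<^sup>\<phi>\<close>.
\<close>

definition circle_dist :: "real \<Rightarrow> real \<Rightarrow> real" where
  "circle_dist q \<phi> = 1 + 2 * q * cos \<phi> + q\<^sup>2"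

lemma circle_dist_eq: "circle_dist q \<phi> = (q + cos \<phi>)\<^sup>2 + (sin \<phi>)\<^sup>2"
  using sin_cos_squared_add[of \<phi>] unfolding circle_dist_def by algebra

lemma circle_dist_nonneg: "circle_dist q \<phi> \<ge> 0"
  by (simp add: circle_dist_eq)

lemma circle_dist_pos: "\<bar>q\<bar> < 1 \<Longrightarrow> circle_dist q \<phi> > 0"
proof -
  assume q: "\<bar>q\<bar> < 1"
  have "circle_dist q \<phi> \<noteq> 0"
  proof
    assume "circle_dist q \<phi> = 0"
    then have "sin \<phi> = 0" "q = - cos \<phi>" unfolding circle_dist_eq by (auto simp: sum_power2_eq_zero_iff)
    then have "\<bar>q\<bar> = 1" using sin_cos_squared_add[of \<phi>] by (simp add: power2_eq_1_iff) auto
    then show False using q by simp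
  qed
  then show ?thesis using circle_dist_nonneg[of q \<phi>] by simp
qed

lemma circle_dist_conv_norm: "circle_dist q \<phi> = (norm (1 + of_real q * cis \<phi>))\<^sup>2"
proof -
  have "(norm (1 + of_real q * cis \<phi>))\<^sup>2 = (1 + q * cos \<phi>)\<^sup>2 + (q * sin \<phi>)\<^sup>2" by (simp add: cmod_power2)
  then show ?thesis using sin_cos_squared_add[of \<phi>] unfolding circle_dist_def by algebra
qed

text \<open>
  Up to a constant, the density of both limit laws in the angular variable: it equals
  \<open>sin\<^sup>2\<phi> / circle_dist r \<phi>\<close>.  The present form displays the Fourier coefficients and is continuous also for
  \<open>|r| = 1\<close>, where the quotient has a zero of the denominator.
\<close>

definition arc_weight :: "real \<Rightarrow> real \<Rightarrow> real" where
  "arc_weight r \<phi> = 1 / 2 - r / 2 * cos \<phi> - (1 - r\<^sup>2) / 2 * ((cos (2 * \<phi>) + r * cos \<phi>) / circle_dist r \<phi>)"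

lemma arc_weight_eq:
  assumes "circle_dist r \<phi> \<noteq> 0"
  shows "arc_weight r \<phi> = (sin \<phi>)\<^sup>2 / circle_dist r \<phi>"
proof -
  have "(1 / 2 - r / 2 * cos \<phi>) * circle_dist r \<phi> - (1 - r\<^sup>2) / 2 * (cos (2 * \<phi>) + r * cos \<phi>) = 1 - (cos \<phi>)\<^sup>2"
    unfolding circle_dist_def cos_double_cos by (simp add: power2_eq_square field_simps)
  also have "\<dots> = (sin \<phi>)\<^sup>2" by (simp add: sin_squared_eq)
  finally show ?thesis using assms by (simp add: arc_weight_def field_simps)
qed

lemma arc_weight_nonneg:
  assumes "\<bar>r\<bar> \<le> 1"
  shows "arc_weight r \<phi> \<ge> 0"
proof (cases "circle_dist r \<phi> = 0")
  case True
  have "\<bar>r * cos \<phi>\<bar> \<le> 1 * 1" unfolding abs_mult using assms by (intro mult_mono) auto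
  then show ?thesis using True by (simp add: arc_weight_def abs_le_iff)
next
  case False
  then show ?thesis using circle_dist_nonneg[of r \<phi>] by (simp add: arc_weight_eq)
qed

lemma continuous_on_arc_weight:
  assumes "\<bar>r\<bar> \<le> 1"
  shows "continuous_on A (arc_weight r)"
proof (cases "\<bar>r\<bar> = 1")
  case True
  then have "1 - r\<^sup>2 = 0" by (simp add: power2_eq_1_iff abs_if split: if_splits)
  then show ?thesis unfolding arc_weight_def[abs_def] by (auto intro!: continuous_intros)
next
  case False
  then have "circle_dist r \<phi> \<noteq> 0" for \<phi> using circle_dist_pos[of r \<phi>] assms by auto
  then show ?thesis unfolding arc_weight_def[abs_def] circle_dist_def[abs_def] 
    by (intro continuous_intros) (auto simp: circle_dist_def)
qed

text \<open>
  Real part of \<open>e\<^sup>2\<^sup>i\<^sup>\<phi> / (1 + r e\<^sup>i\<^sup>\<phi>)\<close>, expanded as a geometric series.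
\<close>

lemma geometric_cosine_series:
  assumes "\<bar>r\<bar> < 1"
  shows "(\<lambda>k. (if k < 2 then 0 else (- r) ^ (k - 2)) * cos (real k * \<phi>)) sums ((cos (2 * \<phi>) + r * cos \<phi>) / circle_dist r \<phi>)"
proof -
  define z where "z = complex_of_real (- r) * cis \<phi>"
  have "norm z < 1" using assms by (simp add: z_def norm_mult)
  then have "(\<lambda>k. cis (2 * \<phi>) * z ^ k) sums (cis (2 * \<phi>) * (1 / (1 - z)))"
    by (intro sums_mult geometric_sums)
  then have "(\<lambda>k. Re (cis (2 * \<phi>) * z ^ k)) sums Re (cis (2 * \<phi>) * (1 / (1 - z)))" by (rule sums_Re)
  moreover have "Re (cis (2 * \<phi>) * z ^ k) = (- r) ^ k * cos (real (k + 2) * \<phi>)" for k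
  proof -
    have "cis (2 * \<phi>) * z ^ k = of_real ((- r) ^ k) * cis (real (k + 2) * \<phi>)"
    proof -
      have "z ^ k = of_real ((- r) ^ k) * cis (real k * \<phi>)"
        by (simp only: z_def power_mult_distrib Complex.DeMoivre of_real_power)
      then have "cis (2 * \<phi>) * z ^ k = of_real ((- r) ^ k) * (cis (2 * \<phi>) * cis (real k * \<phi>))"
        by (simp only: mult_ac)
      also have "cis (2 * \<phi>) * cis (real k * \<phi>) = cis (real (k + 2) * \<phi>)"
        unfolding cis_mult by (simp add: algebra_simps)
      finally show ?thesis .
    qed
    then show ?thesis by simp
  qed
  moreover have "Re (cis (2 * \<phi>) * (1 / (1 - z))) = (cos (2 * \<phi>) + r * cos \<phi>) / circle_dist r \<phi>"
  proof -
    have "cis (2 * \<phi>) * (1 / (1 - z)) = cis (2 * \<phi>) / (1 + of_real r * cis \<phi>)" by (simp add: z_def)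
    also have "Re \<dots> = Re (cis (2 * \<phi>) * cnj (1 + of_real r * cis \<phi>)) / (norm (1 + of_real r * cis \<phi>))\<^sup>2"
      by (subst complex_div_cnj) (simp only: of_real_power[symmetric] Re_divide_of_real)
    also have "cis (2 * \<phi>) * cnj (1 + of_real r * cis \<phi>) = cis (2 * \<phi>) + of_real r * cis \<phi>"
      by (simp add: algebra_simps cis_cnj cis_mult)
    finally show ?thesis by (simp add: circle_dist_conv_norm)
  qed
  ultimately have "(\<lambda>k. (- r) ^ k * cos (real (k + 2) * \<phi>)) sums ((cos (2 * \<phi>) + r * cos \<phi>) / circle_dist r \<phi>)" by simp
  then have "(\<lambda>k. (if k + 2 < 2 then 0 else (- r) ^ (k + 2 - 2)) * cos (real (k + 2) * \<phi>)) sums ((cos (2 * \<phi>) + r * cos \<phi>) / circle_dist r \<phi>)" by simp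
  then show ?thesis by (subst (asm) sums_iff_shift) (simp add: numeral_2_eq_2)
qed

lemma log_cosine_series:
  assumes "\<bar>q\<bar> < 1"
  shows "(\<lambda>k. (- 2 * (- q) ^ k / real k) * cos (real k * \<phi>)) sums ln (circle_dist q \<phi>)"
proof -
  define z where "z = complex_of_real q * cis \<phi>"
  have "norm z < 1" using assms by (simp add: z_def norm_mult)
  from sums_Re[OF Ln_series[OF this]]
  have "(\<lambda>k. Re ((-1) ^ Suc k / of_nat k * z ^ k)) sums Re (ln (1 + z))" .
  moreover have "Re ((-1) ^ Suc k / of_nat k * z ^ k) = - ((- q) ^ k / real k) * cos (real k * \<phi>)" for k
  proof -
    have "z ^ k = of_real (q ^ k) * cis (real k * \<phi>)"
      by (simp only: z_def power_mult_distrib Complex.DeMoivre of_real_power)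
    then have "(-1) ^ Suc k / of_nat k * z ^ k = (- ((- q) ^ k / real k)) *\<^sub>R cis (real k * \<phi>)"
      by (simp add: scaleR_conv_of_real power_minus[of "complex_of_real q"])
    then show ?thesis by (simp only: scaleR_complex.sel cis.sel)
  qed
  moreover have "1 + z \<noteq> 0" using \<open>norm z < 1\<close> by (metis add_eq_0_iff norm_minus_cancel norm_one order_less_irrefl)
  then have "Re (ln (1 + z)) = ln (circle_dist q \<phi>) / 2"
    by (simp add: circle_dist_conv_norm z_def[symmetric] ln_realpow)
  ultimately have "(\<lambda>k. - ((- q) ^ k / real k) * cos (real k * \<phi>)) sums (ln (circle_dist q \<phi>) / 2)"
    by (simp only:)
  from sums_mult[OF this, of 2] show ?thesis by (simp add: mult_ac)
qed

text \<open>
  Orthogonality of cosines picks one coefficient of the geometric series.  For \<open>|r| = 1\<close> that series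
  diverges, but its factor \<open>1 - r\<^sup>2\<close> is 0.
\<close>

lemma arc_weight_moment:
  assumes "\<bar>r\<bar> \<le> 1"
  shows "arc_integral (\<lambda>\<phi>. cos (real k * \<phi>) * arc_weight r \<phi>) = 
     (if k = 0 then pi / 2 else if k = 1 then - pi * r / 4 else - (pi / 4) * (1 - r\<^sup>2) * (- r) ^ (k - 2))"
proof -
  define G where "G \<phi> = (cos (2 * \<phi>) + r * cos \<phi>) / circle_dist r \<phi>" for \<phi>
  have main: "(1 - r\<^sup>2) * arc_integral (\<lambda>\<phi>. G \<phi> * cos (real k * \<phi>)) = (1 - r\<^sup>2) * ((if k < 2 then 0 else (- r) ^ (k - 2)) * (pi / 2))
     \<and> continuous_on {0..pi} (\<lambda>\<phi>. (1 - r\<^sup>2) * G \<phi>)"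
  proof (cases "\<bar>r\<bar> = 1")
    case True
    then have "1 - r\<^sup>2 = 0" by (simp add: power2_eq_1_iff abs_if split: if_splits)
    then show ?thesis by simp
  next
    case False
    then have r: "\<bar>r\<bar> < 1" using assms by simp
    define c where "c j = (if j < 2 then 0 else (- r) ^ (j - 2))" for j :: nat
    have "summable (\<lambda>j. \<bar>c (j + 2)\<bar>)" using r by (simp add: c_def power_abs summable_geometric)
    then have "summable (\<lambda>j. \<bar>c j\<bar>)" by (subst (asm) summable_iff_shift)
    then have "(\<lambda>j. c j * arc_integral (\<lambda>\<phi>. cos (real j * \<phi>) * cos (real k * \<phi>))) sums arc_integral (\<lambda>\<phi>. G \<phi> * cos (real k * \<phi>))"
      using geometric_cosine_series[OF r] unfolding G_def c_def[abs_def]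
      by (intro cosine_series_arc_integral) (auto intro!: continuous_intros)
    moreover have "c j * arc_integral (\<lambda>\<phi>. cos (real j * \<phi>) * cos (real k * \<phi>)) = (if j = k then c k * (pi / 2) else 0)" for j
      by (simp add: arc_integral_cos_cos c_def)
    ultimately have "(\<lambda>j. if j = k then c k * (pi / 2) else 0) sums arc_integral (\<lambda>\<phi>. G \<phi> * cos (real k * \<phi>))" by simp
    from sums_unique2[OF this sums_single[of k "\<lambda>_. c k * (pi / 2)"]]
    have "arc_integral (\<lambda>\<phi>. G \<phi> * cos (real k * \<phi>)) = c k * (pi / 2)" .
    moreover have "circle_dist r \<phi> \<noteq> 0" for \<phi> using circle_dist_pos[OF r, of \<phi>] by auto
    then have "continuous_on {0..pi} (\<lambda>\<phi>. (1 - r\<^sup>2) * G \<phi>)" unfolding G_def circle_dist_def[abs_def]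
      by (intro continuous_intros) (auto simp: circle_dist_def)
    ultimately show ?thesis by (simp add: c_def)
  qed
  have "arc_integral (\<lambda>\<phi>. cos (real k * \<phi>) * arc_weight r \<phi>) = 
     arc_integral (\<lambda>\<phi>. (1 / 2 * (cos (real k * \<phi>) * cos (real 0 * \<phi>)) + (- r / 2) * (cos (real k * \<phi>) * cos (real 1 * \<phi>))) + (- 1 / 2) * ((1 - r\<^sup>2) * G \<phi> * cos (real k * \<phi>)))"
  proof (intro arc_integral_cong)
    fix \<phi>
    have "arc_weight r \<phi> = 1 / 2 - r / 2 * cos \<phi> - (1 - r\<^sup>2) / 2 * G \<phi>" by (simp add: arc_weight_def G_def)
    then show "cos (real k * \<phi>) * arc_weight r \<phi> = (1 / 2 * (cos (real k * \<phi>) * cos (real 0 * \<phi>)) + (- r / 2) * (cos (real k * \<phi>) * cos (real 1 * \<phi>))) + (- 1 / 2) * ((1 - r\<^sup>2) * G \<phi> * cos (real k * \<phi>))"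
      by (simp only:) (simp add: field_simps)
  qed
  also have "\<dots> = arc_integral (\<lambda>\<phi>. 1 / 2 * (cos (real k * \<phi>) * cos (real 0 * \<phi>)) + (- r / 2) * (cos (real k * \<phi>) * cos (real 1 * \<phi>)))
       + arc_integral (\<lambda>\<phi>. (- 1 / 2) * ((1 - r\<^sup>2) * G \<phi> * cos (real k * \<phi>)))"
  proof (rule arc_integral_add)
    show "continuous_on {0..pi} (\<lambda>\<phi>. 1 / 2 * (cos (real k * \<phi>) * cos (real 0 * \<phi>)) + (- r / 2) * (cos (real k * \<phi>) * cos (real 1 * \<phi>)))"
      by (intro continuous_intros)
    show "continuous_on {0..pi} (\<lambda>\<phi>. (- 1 / 2) * ((1 - r\<^sup>2) * G \<phi> * cos (real k * \<phi>)))"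
      by (rule continuous_on_mult[OF continuous_on_const], rule continuous_on_mult[OF conjunct2[OF main]]) (intro continuous_intros)
  qed
  also have "arc_integral (\<lambda>\<phi>. 1 / 2 * (cos (real k * \<phi>) * cos (real 0 * \<phi>)) + (- r / 2) * (cos (real k * \<phi>) * cos (real 1 * \<phi>))) =
      1 / 2 * arc_integral (\<lambda>\<phi>. cos (real k * \<phi>) * cos (real 0 * \<phi>)) + (- r / 2) * arc_integral (\<lambda>\<phi>. cos (real k * \<phi>) * cos (real 1 * \<phi>))"
    unfolding arc_integral_cmult[symmetric] by (rule arc_integral_add) (intro continuous_intros)+
  also have "arc_integral (\<lambda>\<phi>. (- 1 / 2) * ((1 - r\<^sup>2) * G \<phi> * cos (real k * \<phi>))) = (- 1 / 2) * ((1 - r\<^sup>2) * arc_integral (\<lambda>\<phi>. G \<phi> * cos (real k * \<phi>)))"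
    by (simp only: arc_integral_cmult mult.assoc)
  finally show ?thesis unfolding arc_integral_cos_cos main[THEN conjunct1] by auto
qed


section \<open>Logarithmic potentials\<close>

text \<open>
  The closed form of \<open>\<Sum> q\<^sup>k\<^sup>+\<^sup>2 r\<^sup>k / (k + 2)\<close>; the value at \<open>r = 0\<close> is its continuous extension.
\<close>

definition log_tail :: "real \<Rightarrow> real \<Rightarrow> real" where
  "log_tail q r = (if r = 0 then q\<^sup>2 / 2 else (- ln (1 - q * r) - q * r) / r\<^sup>2)"

lemma log_tail_sums:
  assumes "\<bar>q\<bar> < 1" "\<bar>r\<bar> \<le> 1"
  shows "(\<lambda>k. q ^ (k + 2) * r ^ k / real (k + 2)) sums log_tail q r"
proof (cases "r = 0")
  case True
  have "(\<lambda>k. q ^ (k + 2) * r ^ k / real (k + 2)) sums (\<Sum>k\<in>{0}. q ^ (k + 2) * r ^ k / real (k + 2))"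
    using True by (intro sums_finite) auto
  then show ?thesis using True by (simp add: log_tail_def power2_eq_square)
next
  case False
  define y where "y = q * r"
  have "\<bar>q\<bar> * \<bar>r\<bar> \<le> \<bar>q\<bar> * 1" using assms by (intro mult_left_mono) auto
  then have y: "\<bar>y\<bar> < 1" using assms by (simp add: y_def abs_mult)
  have "(\<lambda>k. - ((- (- y)) ^ k) / real k) sums ln (1 + (- y))"
    using y by (intro ln_series') auto
  from sums_minus[OF this] have "(\<lambda>k. y ^ k / real k) sums (- ln (1 - y))" by simp
  then have "(\<lambda>k. y ^ (k + 2) / real (k + 2)) sums (- ln (1 - y) - (\<Sum>k<2. y ^ k / real k))"
    by (rule sums_split_initial_segment)
  then have "(\<lambda>k. y ^ (k + 2) / real (k + 2)) sums (- ln (1 - y) - y)" by (simp add: numeral_2_eq_2)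
  then have "(\<lambda>k. y ^ (k + 2) / real (k + 2) / r\<^sup>2) sums ((- ln (1 - y) - y) / r\<^sup>2)" by (rule sums_divide)
  moreover have "y ^ (k + 2) / real (k + 2) / r\<^sup>2 = q ^ (k + 2) * r ^ k / real (k + 2)" for k
    using False by (simp add: y_def power_mult_distrib power_add power2_eq_square)
  ultimately show ?thesis using False by (simp add: log_tail_def y_def)
qed

definition arc_log_potential :: "real \<Rightarrow> real \<Rightarrow> real" where
  "arc_log_potential q r = - pi * q * r / 2 + pi / 2 * (1 - r\<^sup>2) * log_tail q r"

lemma arc_integral_log_circle_dist:
  assumes q: "\<bar>q\<bar> < 1" and r: "\<bar>r\<bar> \<le> 1"
  shows "arc_integral (\<lambda>\<phi>. ln (circle_dist q \<phi>) * arc_weight r \<phi>) = arc_log_potential q r"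
proof -
  define c where "c k = - 2 * (- q) ^ k / real k" for k
  have "summable (\<lambda>k. \<bar>c k\<bar>)"
  proof (rule summable_comparison_test')
    show "summable (\<lambda>k. 2 * \<bar>q\<bar> ^ k)" using q by (intro summable_mult summable_geometric) auto
    fix k :: nat assume "k \<ge> 1"
    then have "2 * \<bar>q\<bar> ^ k / real k \<le> 2 * \<bar>q\<bar> ^ k / 1" by (intro divide_left_mono) auto
    then show "norm \<bar>c k\<bar> \<le> 2 * \<bar>q\<bar> ^ k" by (simp add: c_def abs_mult power_abs)
  qed
  then have "(\<lambda>k. c k * arc_integral (\<lambda>\<phi>. cos (real k * \<phi>) * arc_weight r \<phi>)) sums arc_integral (\<lambda>\<phi>. ln (circle_dist q \<phi>) * arc_weight r \<phi>)"
    using log_cosine_series[OF q] unfolding c_def[abs_def]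
    by (intro cosine_series_arc_integral continuous_on_arc_weight r) auto
  then have "(\<lambda>k. c (k + 2) * arc_integral (\<lambda>\<phi>. cos (real (k + 2) * \<phi>) * arc_weight r \<phi>)) sums 
     (arc_integral (\<lambda>\<phi>. ln (circle_dist q \<phi>) * arc_weight r \<phi>) - (\<Sum>k<2. c k * arc_integral (\<lambda>\<phi>. cos (real k * \<phi>) * arc_weight r \<phi>)))"
    by (rule sums_split_initial_segment)
  moreover have "(\<Sum>k<2. c k * arc_integral (\<lambda>\<phi>. cos (real k * \<phi>) * arc_weight r \<phi>)) = - pi * q * r / 2"
  proof -
    have "(\<Sum>k<2. c k * arc_integral (\<lambda>\<phi>. cos (real k * \<phi>) * arc_weight r \<phi>)) = 
       c 0 * arc_integral (\<lambda>\<phi>. cos (real 0 * \<phi>) * arc_weight r \<phi>) + c 1 * arc_integral (\<lambda>\<phi>. cos (real 1 * \<phi>) * arc_weight r \<phi>)"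
      by (simp add: numeral_2_eq_2)
    then show ?thesis unfolding arc_weight_moment[OF r] by (simp add: c_def)
  qed
  moreover have "c (k + 2) * arc_integral (\<lambda>\<phi>. cos (real (k + 2) * \<phi>) * arc_weight r \<phi>) = pi / 2 * (1 - r\<^sup>2) * (q ^ (k + 2) * r ^ k / real (k + 2))" for k
  proof -
    have "(- q) ^ (k + 2) * (- r) ^ k = q ^ (k + 2) * r ^ k"
      by (simp add: power_minus[of q] power_minus[of r] flip: power_add mult_2)
    moreover have "c (k + 2) * arc_integral (\<lambda>\<phi>. cos (real (k + 2) * \<phi>) * arc_weight r \<phi>) = pi / 2 * (1 - r\<^sup>2) * ((- q) ^ (k + 2) * (- r) ^ k / real (k + 2))"
    proof -
      have "(- 2 * X / m) * (- (pi / 4) * Y * Z) = pi / 2 * Y * (X * Z / m)" for X Y Z m :: real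
        by (cases "m = 0") (simp_all add: field_simps)
      from this[of "(- q) ^ (k + 2)" "real (k + 2)" "1 - r\<^sup>2" "(- r) ^ k"] show ?thesis
        unfolding arc_weight_moment[OF r] c_def by (simp del: of_nat_add power_add_numeral2 power_Suc)
    qed
    ultimately show ?thesis by simp
  qed
  ultimately have "(\<lambda>k. pi / 2 * (1 - r\<^sup>2) * (q ^ (k + 2) * r ^ k / real (k + 2))) sums 
      (arc_integral (\<lambda>\<phi>. ln (circle_dist q \<phi>) * arc_weight r \<phi>) - (- pi * q * r / 2))" by simp
  from sums_unique2[OF this sums_mult[OF log_tail_sums[OF q r]]]
  show ?thesis by (simp add: arc_log_potential_def)
qed

text \<open>
  For \<open>|q| = 1\<close> the logarithm is unbounded and its Fourier series does not converge absolutely.  Approach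
  \<open>s\<close> by \<open>s t\<close> with \<open>t\<close> increasing to 1: after division by \<open>t\<close>, the functions \<open>circle_dist (s t) \<phi> / t\<close> equal
  \<open>t + 1/t + 2 s cos \<phi>\<close> and decrease, so monotone convergence gives integrability and the value together.
\<close>

lemma arc_log_potential_boundary:
  assumes s: "s = 1 \<or> s = - 1" and r: "\<bar>r\<bar> \<le> 1"
  shows "arc_integrable (\<lambda>\<phi>. ln (circle_dist s \<phi>) * arc_weight r \<phi>)" (is ?int)
    and "arc_integral (\<lambda>\<phi>. ln (circle_dist s \<phi>) * arc_weight r \<phi>) = arc_log_potential s r" (is ?val)
proof -
  define p where "p n = 1 - 1 / real (n + 2)" for n
  have p: "p n > 0" "p n < 1" for n by (auto simp: p_def field_simps)
  have p_mono: "p m \<le> p n" if "m \<le> n" for m n using that by (auto simp: p_def intro!: divide_left_mono)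
  have p_lim: "p \<longlonglongrightarrow> 1" unfolding p_def by real_asymp
  define e where "e t = t + 1 / t" for t :: real
  have s2: "s\<^sup>2 = 1" using s by auto
  have dist_p: "circle_dist (s * t) \<phi> / t = e t + 2 * s * cos \<phi>" if "t > 0" for t \<phi>
    using that s2 by (simp add: circle_dist_def e_def power_mult_distrib field_simps) (simp add: power2_eq_square)
  have e_anti: "e v \<le> e u" if "0 < u" "u \<le> v" "v \<le> 1" for u v
  proof -
    have "u * v \<le> 1 * 1" using that by (intro mult_mono) auto
    have "e u - e v = (v - u) * (1 - u * v) / (u * v)" using that by (simp add: e_def field_simps)
    also have "\<dots> \<ge> 0" using that \<open>u * v \<le> 1 * 1\<close> by (intro divide_nonneg_nonneg mult_nonneg_nonneg) auto
    finally show ?thesis by simp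
  qed
  have e_lim: "(\<lambda>n. e (p n)) \<longlonglongrightarrow> e 1" unfolding e_def by (intro tendsto_intros p_lim) auto
  have pos: "circle_dist s \<phi> > 0" if "0 < \<phi>" "\<phi> < pi" for \<phi>
    using sin_gt_zero[OF that] unfolding circle_dist_eq by (intro add_nonneg_pos) auto
  define f where "f n \<phi> = - (indicator {0..pi} \<phi> * (ln (circle_dist (s * p n) \<phi> / p n) * arc_weight r \<phi>))" for n \<phi>
  define u where "u \<phi> = - (indicator {0..pi} \<phi> * (ln (circle_dist s \<phi>) * arc_weight r \<phi>))" for \<phi>
  have sp: "\<bar>s * p n\<bar> < 1" for n using p[of n] s by auto
  have dpos: "circle_dist (s * p n) \<phi> / p n > 0" for n \<phi> using circle_dist_pos[OF sp] p by simp
  have cont: "continuous_on {0..pi} (\<lambda>\<phi>. ln (circle_dist (s * p n) \<phi>) * arc_weight r \<phi>)" for n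
    using circle_dist_pos[OF sp[of n]] unfolding circle_dist_def[abs_def]
    by (intro continuous_intros continuous_on_arc_weight r) (auto simp: circle_dist_def less_imp_neq[THEN not_sym])
  have f_alt: "f n = (\<lambda>\<phi>. - (indicator {0..pi} \<phi> * (ln (circle_dist (s * p n) \<phi>) * arc_weight r \<phi>)) + ln (p n) * (indicator {0..pi} \<phi> * (cos (real 0 * \<phi>) * arc_weight r \<phi>)))" for n
    unfolding f_def using circle_dist_pos[OF sp] p 
    by (intro ext) (simp add: ln_div less_imp_neq[THEN not_sym] algebra_simps)
  have int1: "arc_integrable (\<lambda>\<phi>. cos (real 0 * \<phi>) * arc_weight r \<phi>)"
    by (intro integrable_arc continuous_intros continuous_on_arc_weight r)
  have int_f: "integrable lborel (f n)" for n
    unfolding f_alt by (intro Bochner_Integration.integrable_add Bochner_Integration.integrable_minus integrable_mult_right int1 integrable_arc cont)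
  have val_f: "(LINT \<phi>|lborel. f n \<phi>) = - arc_log_potential (s * p n) r + ln (p n) * (pi / 2)" for n
  proof -
    have "(LINT \<phi>|lborel. f n \<phi>) = - arc_integral (\<lambda>\<phi>. ln (circle_dist (s * p n) \<phi>) * arc_weight r \<phi>) + ln (p n) * arc_integral (\<lambda>\<phi>. cos (real 0 * \<phi>) * arc_weight r \<phi>)"
      unfolding f_alt arc_integral_def using integrable_arc[OF cont] int1 by simp
    then show ?thesis unfolding arc_integral_log_circle_dist[OF sp r] arc_weight_moment[OF r] by simp
  qed
  have AE_int: "AE \<phi> in lborel. \<phi> \<noteq> 0 \<and> \<phi> \<noteq> pi" using AE_lborel_singleton[of 0] AE_lborel_singleton[of pi] by auto
  define T where "T q = (1 - r\<^sup>2) * log_tail q r" for q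
  have lim_val: "(\<lambda>n. LINT \<phi>|lborel. f n \<phi>) \<longlonglongrightarrow> - arc_log_potential s r"
  proof -
    have "(\<lambda>n. (1 - r\<^sup>2) * log_tail (s * p n) r) \<longlonglongrightarrow> (1 - r\<^sup>2) * log_tail s r"
    proof (cases "\<bar>r\<bar> = 1")
      case True
      then have "1 - r\<^sup>2 = 0" by (simp add: power2_eq_1_iff abs_if split: if_splits)
      then show ?thesis by simp
    next
      case False
      then have "1 - s * r \<noteq> 0" using s r by auto
      have L: "(\<lambda>n. s * p n) \<longlonglongrightarrow> s" using tendsto_mult[OF tendsto_const[of s] p_lim] by simp
      have "(\<lambda>n. log_tail (s * p n) r) \<longlonglongrightarrow> log_tail s r"
      proof (cases "r = 0")
        case True
        then show ?thesis unfolding log_tail_def using tendsto_divide[OF tendsto_power[OF L, of 2] tendsto_const[of 2]] by simp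
      next
        case rne: False
        have "(\<lambda>n. (- ln (1 - s * p n * r) - s * p n * r) / r\<^sup>2) \<longlonglongrightarrow> (- ln (1 - s * r) - s * r) / r\<^sup>2"
          using rne \<open>1 - s * r \<noteq> 0\<close> by (intro tendsto_intros L) auto
        then show ?thesis using rne by (simp add: log_tail_def)
      qed
      then show ?thesis by (intro tendsto_intros)
    qed
    then have T: "(\<lambda>n. T (s * p n)) \<longlonglongrightarrow> T s" by (simp only: T_def)
    have "(\<lambda>n. ln (p n)) \<longlonglongrightarrow> ln 1" by (intro tendsto_ln p_lim) auto
    then have "(\<lambda>n. - (- pi * (s * p n) * r / 2 + pi / 2 * T (s * p n)) + ln (p n) * (pi / 2)) \<longlonglongrightarrow> 
       - (- pi * (s * 1) * r / 2 + pi / 2 * T s) + ln 1 * (pi / 2)"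
      by (intro tendsto_intros p_lim T) auto
    then show ?thesis unfolding val_f arc_log_potential_def by (simp add: T_def mult.assoc)
  qed
  have "has_bochner_integral lborel u (- arc_log_potential s r)"
  proof (rule has_bochner_integral_monotone_convergence[OF int_f _ _ lim_val])
    show "AE \<phi> in lborel. mono (\<lambda>n. f n \<phi>)"
    proof (intro AE_I2 monoI)
      fix \<phi> :: real and m n :: nat assume "m \<le> n"
      then have "circle_dist (s * p n) \<phi> / p n \<le> circle_dist (s * p m) \<phi> / p m"
        unfolding dist_p[OF p(1)] using e_anti[of "p m" "p n"] p p_mono by (simp add: less_imp_le)
      then have "ln (circle_dist (s * p n) \<phi> / p n) \<le> ln (circle_dist (s * p m) \<phi> / p m)"
        using dpos by (simp only: ln_le_cancel_iff)
      then show "f m \<phi> \<le> f n \<phi>" unfolding f_def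
        using arc_weight_nonneg[OF r] by (intro le_imp_neg_le mult_left_mono mult_right_mono) auto
    qed
    show "AE \<phi> in lborel. (\<lambda>n. f n \<phi>) \<longlonglongrightarrow> u \<phi>"
      using AE_int
    proof eventually_elim
      case (elim \<phi>)
      show ?case
      proof (cases "\<phi> \<in> {0..pi}")
        case True
        then have "circle_dist s \<phi> > 0" using elim by (intro pos) auto
        moreover have "(\<lambda>n. circle_dist (s * p n) \<phi> / p n) \<longlonglongrightarrow> circle_dist (s * 1) \<phi> / 1"
          unfolding dist_p[OF p(1)] dist_p[OF zero_less_one] by (intro tendsto_intros e_lim)
        ultimately have "(\<lambda>n. ln (circle_dist (s * p n) \<phi> / p n)) \<longlonglongrightarrow> ln (circle_dist s \<phi>)"
          by (intro tendsto_ln) auto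
        then show ?thesis unfolding f_def u_def by (intro tendsto_minus tendsto_mult[OF tendsto_const] tendsto_mult[OF _ tendsto_const])
      qed (simp add: f_def u_def)
    qed
    show "u \<in> borel_measurable lborel" 
      unfolding u_def circle_dist_def[abs_def] arc_weight_def[abs_def] by measurable
  qed
  then have "has_bochner_integral lborel (\<lambda>\<phi>. - u \<phi>) (- (- arc_log_potential s r))" by (rule has_bochner_integral_minus)
  then have "has_bochner_integral lborel (\<lambda>\<phi>. indicator {0..pi} \<phi> * (ln (circle_dist s \<phi>) * arc_weight r \<phi>)) (arc_log_potential s r)"
    by (simp add: u_def)
  then show ?int ?val by (auto simp: has_bochner_integral_iff arc_integral_def)
qed


section \<open>The entropies of the limiting densities\<close>

text \<open>
  Substitute \<open>x = A + B cos \<phi>\<close>.  Integrability is known on the angular side and transferred, since the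
  densities may be unbounded at an end point.
\<close>

lemma integral_arc_substitution:
  fixes F h :: "real \<Rightarrow> real"
  assumes B: "B > 0" and F: "F \<in> borel_measurable borel"
    and h: "\<And>\<phi>. 0 < \<phi> \<Longrightarrow> \<phi> < pi \<Longrightarrow> B * sin \<phi> * F (A + B * cos \<phi>) = h \<phi>"
    and int: "arc_integrable h"
  shows "(LINT x:{A - B..A + B}|lborel. F x) = arc_integral h"
proof -
  define S where "S = {0<..<pi}"
  define g where "g \<phi> = A + B * cos \<phi>" for \<phi>
  define k where "k \<phi> = \<bar>- B * sin \<phi>\<bar> * F (g \<phi>)" for \<phi>
  have k: "k \<phi> = h \<phi>" if "\<phi> \<in> S" for \<phi>
  proof -
    have "sin \<phi> > 0" using that by (intro sin_gt_zero) (auto simp: S_def)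
    then show ?thesis using that h[of \<phi>] B by (simp add: k_def g_def S_def abs_mult)
  qed
  have ind: "indicator S \<phi> * k \<phi> = indicator S \<phi> * (indicator {0..pi} \<phi> * h \<phi>)" for \<phi>
    using k by (auto simp: indicator_def S_def)
  have intS: "integrable lborel (\<lambda>\<phi>. indicator S \<phi> * (indicator {0..pi} \<phi> * h \<phi>))"
    using integrable_mult_indicator[OF _ int, of S] by (simp add: S_def)
  have int_k: "set_integrable lborel S k"
    unfolding set_integrable_def real_scaleR_def ind by (rule intS)
  then have abs_k: "k absolutely_integrable_on S"
    unfolding set_integrable_def by (subst integrable_completion) auto
  have "(LINT \<phi>:S|lborel. k \<phi>) = arc_integral h"
    unfolding set_lebesgue_integral_def arc_integral_def real_scaleR_def ind
  proof (intro integral_cong_AE)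
    show "AE \<phi> in lborel. indicator S \<phi> * (indicator {0..pi} \<phi> * h \<phi>) = indicator {0..pi} \<phi> * h \<phi>"
      using AE_lborel_singleton[of 0] AE_lborel_singleton[of pi]
      by eventually_elim (auto simp: indicator_def S_def)
  qed (use int intS in auto)
  then have val_k: "integral S k = arc_integral h"
    using set_borel_integral_eq_integral(2)[OF int_k] by simp
  have der: "(g has_field_derivative (- B * sin \<phi>)) (at \<phi> within S)" for \<phi>
    unfolding g_def by (auto intro!: derivative_eq_intros)
  have inj: "inj_on g S"
    unfolding g_def S_def using B by (intro inj_onI) (auto intro: cos_inj_pi)
  have img: "g ` S = {A - B<..<A + B}"
  proof (intro equalityI subsetI)
    fix x assume "x \<in> g ` S"
    then obtain \<phi> where "\<phi> \<in> S" "x = g \<phi>" by blast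
    then have \<phi>: "x = A + B * cos \<phi>" "0 < \<phi>" "\<phi> < pi" by (auto simp: g_def S_def)
    from \<phi> have "cos \<phi> < 1" "- 1 < cos \<phi>"
      using cos_monotone_0_pi[of 0 \<phi>] cos_monotone_0_pi[of \<phi> pi] by auto
    then have "B * cos \<phi> < B * 1" "B * (- 1) < B * cos \<phi>" using B by (intro mult_strict_left_mono; simp)+
    then show "x \<in> {A - B<..<A + B}" using \<phi> by auto
  next
    fix x assume "x \<in> {A - B<..<A + B}"
    then have y: "- 1 < (x - A) / B" "(x - A) / B < 1" using B by (auto simp: field_simps)
    then have "g (arccos ((x - A) / B)) = x" using B by (simp add: g_def)
    moreover have "arccos ((x - A) / B) \<in> S" using arccos_lt_bounded[OF y] by (simp add: S_def)
    ultimately show "x \<in> g ` S" by (metis imageI)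
  qed
  have "F absolutely_integrable_on (g ` S) \<and> integral (g ` S) F = arc_integral h"
    using has_absolute_integral_change_of_variables_1'[OF _ der inj, of F "arc_integral h"] abs_k val_k
    by (simp add: k_def[abs_def] S_def)
  then have F_abs: "F absolutely_integrable_on {A - B<..<A + B}" and F_val: "integral {A - B<..<A + B} F = arc_integral h"
    unfolding img by auto
  have F_int: "set_integrable lborel {A - B<..<A + B} F"
    using F_abs F unfolding set_integrable_def by (subst (asm) integrable_completion) auto
  have "(LINT x:{A - B..A + B}|lborel. F x) = (LINT x:{A - B<..<A + B}|lborel. F x)"
    unfolding set_lebesgue_integral_def
  proof (intro integral_cong_AE)
    show "AE x in lborel. indicator {A - B..A + B} x *\<^sub>R F x = indicator {A - B<..<A + B} x *\<^sub>R F x"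
      using AE_lborel_singleton[of "A - B"] AE_lborel_singleton[of "A + B"]
      by eventually_elim (auto simp: indicator_def)
  qed (use F in measurable)
  also have "\<dots> = arc_integral h" using set_borel_integral_eq_integral(2)[OF F_int] F_val by simp
  finally show ?thesis .
qed

text \<open>
  From \<open>4 sin\<^sup>2\<phi> = |1 + e\<^sup>i\<^sup>\<phi>|\<^sup>2 |1 - e\<^sup>i\<^sup>\<phi>|\<^sup>2\<close> the logarithm of the sine is an average of two boundary potentials.
\<close>

lemma
  assumes r: "\<bar>r\<bar> \<le> 1"
  shows integrable_log_sin_arc: "arc_integrable (\<lambda>\<phi>. ln (sin \<phi>) * arc_weight r \<phi>)"
    and arc_integral_log_sin: "arc_integral (\<lambda>\<phi>. ln (sin \<phi>) * arc_weight r \<phi>) = 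
        (arc_log_potential 1 r + arc_log_potential (- 1) r) / 2 - ln 2 * (pi / 2)"
proof -
  define w where "w \<phi> = indicator {0..pi} \<phi> * arc_weight r \<phi>" for \<phi>
  define F where "F \<phi> = 1 / 2 * (indicator {0..pi} \<phi> * (ln (circle_dist 1 \<phi>) * arc_weight r \<phi>)) 
     + 1 / 2 * (indicator {0..pi} \<phi> * (ln (circle_dist (- 1) \<phi>) * arc_weight r \<phi>)) - ln 2 * (indicator {0..pi} \<phi> * arc_weight r \<phi>)" for \<phi>
  note i = arc_log_potential_boundary(1)[of 1 r, OF _ r] arc_log_potential_boundary(1)[of "- 1" r, OF _ r]
  have w: "arc_integrable (arc_weight r)"
    by (intro integrable_arc continuous_on_arc_weight r)
  have F: "integrable lborel F" unfolding F_def using i w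
    by (intro Bochner_Integration.integrable_diff Bochner_Integration.integrable_add integrable_mult_right) auto
  have *: "(LINT \<phi>|lborel. F \<phi>) = 1 / 2 * arc_integral (\<lambda>\<phi>. ln (circle_dist 1 \<phi>) * arc_weight r \<phi>) 
      + 1 / 2 * arc_integral (\<lambda>\<phi>. ln (circle_dist (- 1) \<phi>) * arc_weight r \<phi>) - ln 2 * arc_integral (\<lambda>\<phi>. cos (real 0 * \<phi>) * arc_weight r \<phi>)"
    unfolding F_def arc_integral_def using i w by simp
  have val: "(LINT \<phi>|lborel. F \<phi>) = (arc_log_potential 1 r + arc_log_potential (- 1) r) / 2 - ln 2 * (pi / 2)"
  proof -
    have "arc_integral (\<lambda>\<phi>. cos (real 0 * \<phi>) * arc_weight r \<phi>) = pi / 2" using arc_weight_moment[OF r, of 0] by simp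
    moreover have "arc_integral (\<lambda>\<phi>. ln (circle_dist 1 \<phi>) * arc_weight r \<phi>) = arc_log_potential 1 r"
      "arc_integral (\<lambda>\<phi>. ln (circle_dist (- 1) \<phi>) * arc_weight r \<phi>) = arc_log_potential (- 1) r"
      using r by (intro arc_log_potential_boundary(2); simp)+
    ultimately show ?thesis using * by (simp only:) (simp add: field_simps)
  qed
  have AE: "AE \<phi> in lborel. F \<phi> = indicator {0..pi} \<phi> * (ln (sin \<phi>) * arc_weight r \<phi>)"
    using AE_lborel_singleton[of 0] AE_lborel_singleton[of pi]
  proof eventually_elim
    case (elim \<phi>)
    show ?case
    proof (cases "\<phi> \<in> {0..pi}")
      case True
      then have s: "sin \<phi> > 0" using elim by (intro sin_gt_zero) auto
      have c: "circle_dist 1 \<phi> > 0" "circle_dist (- 1) \<phi> > 0" 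
        unfolding circle_dist_eq using s by (auto intro!: add_nonneg_pos)
      have "circle_dist 1 \<phi> * circle_dist (- 1) \<phi> = (2 + 2 * cos \<phi>) * (2 - 2 * cos \<phi>)" by (simp add: circle_dist_def)
      also have "\<dots> = (2 * sin \<phi>)\<^sup>2" using sin_cos_squared_add[of \<phi>] by algebra
      finally have prod: "circle_dist 1 \<phi> * circle_dist (- 1) \<phi> = (2 * sin \<phi>)\<^sup>2" .
      have "ln (circle_dist 1 \<phi>) + ln (circle_dist (- 1) \<phi>) = ln ((2 * sin \<phi>)\<^sup>2)"
        unfolding prod[symmetric] by (rule ln_mult_pos[OF c, symmetric])
      also have "\<dots> = 2 * (ln 2 + ln (sin \<phi>))" using s by (subst ln_realpow) (simp_all add: ln_mult)
      finally have ln_sin: "ln (sin \<phi>) = 1 / 2 * ln (circle_dist 1 \<phi>) + 1 / 2 * ln (circle_dist (- 1) \<phi>) - ln 2" by simp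
      show ?thesis unfolding F_def ln_sin by (simp add: algebra_simps)
    qed (simp add: F_def)
  qed
  have meas: "(\<lambda>\<phi>. indicator {0..pi} \<phi> * (ln (sin \<phi>) * arc_weight r \<phi>)) \<in> borel_measurable lborel"
    unfolding arc_weight_def[abs_def] circle_dist_def[abs_def] by measurable
  show "arc_integrable (\<lambda>\<phi>. ln (sin \<phi>) * arc_weight r \<phi>)"
    using integrable_cong_AE_imp[OF F meas] AE by simp
  show "arc_integral (\<lambda>\<phi>. ln (sin \<phi>) * arc_weight r \<phi>) = (arc_log_potential 1 r + arc_log_potential (- 1) r) / 2 - ln 2 * (pi / 2)"
    using integral_cong_AE[OF borel_measurable_integrable[OF F] meas AE] val by (simp add: arc_integral_def)
qed

text \<open>
  With \<open>x = 2 cos \<phi>\<close> the semicircle density is \<open>sin \<phi> / \<pi>\<close>, and its law has weight \<open>2 sin\<^sup>2\<phi> / \<pi>\<close>, the case \<open>r = 0\<close>.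
\<close>

lemma S_H_eq: "S_H = 1 / 2 - ln (2 * pi)"
proof -
  define h where "h \<phi> = 2 / pi * (ln (sin \<phi>) * arc_weight 0 \<phi>) + (- 2 * ln pi / pi) * (cos (real 0 * \<phi>) * arc_weight 0 \<phi>)" for \<phi>
  have c0: "arc_integral (\<lambda>\<phi>. cos (real 0 * \<phi>) * arc_weight 0 \<phi>) = pi / 2" using arc_weight_moment[of 0 0] by simp
  have i: "arc_integrable (\<lambda>\<phi>. ln (sin \<phi>) * arc_weight 0 \<phi>)"
     "arc_integrable (\<lambda>\<phi>. cos (real 0 * \<phi>) * arc_weight 0 \<phi>)"
    by (intro integrable_log_sin_arc integrable_arc continuous_intros continuous_on_arc_weight; simp)+
  have h_alt: "indicator {0..pi} \<phi> * h \<phi> = 2 / pi * (indicator {0..pi} \<phi> * (ln (sin \<phi>) * arc_weight 0 \<phi>)) + (- 2 * ln pi / pi) * (indicator {0..pi} \<phi> * (cos (real 0 * \<phi>) * arc_weight 0 \<phi>))" for \<phi>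
    by (simp add: h_def algebra_simps)
  have int: "arc_integrable h"
    unfolding h_alt using i by (intro Bochner_Integration.integrable_add integrable_mult_right)
  have "arc_integral h = 2 / pi * arc_integral (\<lambda>\<phi>. ln (sin \<phi>) * arc_weight 0 \<phi>) + (- 2 * ln pi / pi) * arc_integral (\<lambda>\<phi>. cos (real 0 * \<phi>) * arc_weight 0 \<phi>)"
    unfolding arc_integral_def h_alt using i by simp
  also have "\<dots> = 1 / 2 - ln (2 * pi)"
    unfolding arc_integral_log_sin[of 0, simplified] c0 by (simp add: arc_log_potential_def log_tail_def ln_mult field_simps)
  finally have val: "arc_integral h = 1 / 2 - ln (2 * pi)" .
  have "(LINT x:{0 - 2..0 + 2}|lborel. \<rho>_H x * ln (\<rho>_H x)) = arc_integral h"
  proof (rule integral_arc_substitution[OF _ _ _ int])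
    show "(\<lambda>x. \<rho>_H x * ln (\<rho>_H x)) \<in> borel_measurable borel" unfolding \<rho>_H_def by measurable
    fix \<phi> :: real assume \<phi>: "0 < \<phi>" "\<phi> < pi"
    have s: "sin \<phi> > 0" using \<phi> by (rule sin_gt_zero)
    have "4 - (0 + 2 * cos \<phi>)\<^sup>2 = (2 * sin \<phi>)\<^sup>2" using sin_cos_squared_add[of \<phi>] by algebra
    then have rho: "\<rho>_H (0 + 2 * cos \<phi>) = sin \<phi> / pi" using s by (simp only: \<rho>_H_def real_sqrt_abs) simp
    have w: "arc_weight 0 \<phi> = (sin \<phi>)\<^sup>2" by (subst arc_weight_eq) (auto simp: circle_dist_def)
    show "2 * sin \<phi> * (\<rho>_H (0 + 2 * cos \<phi>) * ln (\<rho>_H (0 + 2 * cos \<phi>))) = h \<phi>"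
      unfolding rho h_def w using s by (simp add: ln_div power2_eq_square field_simps)
  qed simp
  then show ?thesis using val by (simp add: S_H_def)
qed

text \<open>
  With \<open>r = 1 / sqrt \<theta>\<close> and \<open>x = |1 + r e\<^sup>i\<^sup>\<phi>|\<^sup>2\<close> the density is \<open>\<theta> r sin \<phi> / (\<pi> x)\<close>, so its logarithm is a constant plus
  \<open>ln (sin \<phi>)\<close> minus the potential at \<open>q = r\<close>, which is on the boundary exactly for \<open>\<theta> = 1\<close>.
\<close>

lemma S_L_eq:
  assumes \<theta>: "\<theta> \<ge> 1"
  shows "S_L \<theta> = 1 - ln (2 * pi) + (\<theta> - 1) / 2 * ln (\<theta> - 1) - (\<theta> - 2) / 2 * ln \<theta>"
proof -
  define r where "r = 1 / sqrt \<theta>"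
  have r: "0 < r" "r \<le> 1" "r\<^sup>2 = 1 / \<theta>" "\<bar>r\<bar> \<le> 1" using \<theta> by (auto simp: r_def power_divide)
  have lnr: "ln r = - ln \<theta> / 2" using \<theta> by (simp add: r_def ln_div ln_sqrt)
  define k where "k = ln (\<theta> * r / pi)"
  define h where "h \<phi> = 2 / pi * (ln (sin \<phi>) * arc_weight r \<phi>) + 2 * k / pi * (cos (real 0 * \<phi>) * arc_weight r \<phi>) + (- 2 / pi) * (ln (circle_dist r \<phi>) * arc_weight r \<phi>)" for \<phi>
  have c0: "arc_integral (\<lambda>\<phi>. cos (real 0 * \<phi>) * arc_weight r \<phi>) = pi / 2" using arc_weight_moment[OF r(4), of 0] by simp
  have i: "arc_integrable (\<lambda>\<phi>. ln (sin \<phi>) * arc_weight r \<phi>)"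
     "arc_integrable (\<lambda>\<phi>. cos (real 0 * \<phi>) * arc_weight r \<phi>)"
    by (intro integrable_log_sin_arc integrable_arc continuous_intros continuous_on_arc_weight r(4))+
  have d: "arc_integrable (\<lambda>\<phi>. ln (circle_dist r \<phi>) * arc_weight r \<phi>)"
    "arc_integral (\<lambda>\<phi>. ln (circle_dist r \<phi>) * arc_weight r \<phi>) = arc_log_potential r r"
  proof -
    have "arc_integrable (\<lambda>\<phi>. ln (circle_dist r \<phi>) * arc_weight r \<phi>) \<and>
      arc_integral (\<lambda>\<phi>. ln (circle_dist r \<phi>) * arc_weight r \<phi>) = arc_log_potential r r"
    proof (cases "r = 1")
      case True
      then show ?thesis using arc_log_potential_boundary[of 1 1] by simp
    next
      case False
      then have "\<bar>r\<bar> < 1" using r by simp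
      moreover from circle_dist_pos[OF this] have "continuous_on {0..pi} (\<lambda>\<phi>. ln (circle_dist r \<phi>) * arc_weight r \<phi>)" 
        unfolding circle_dist_def[abs_def]
        by (intro continuous_intros continuous_on_arc_weight r(4)) (auto simp: circle_dist_def less_imp_neq[THEN not_sym])
      ultimately show ?thesis using arc_integral_log_circle_dist r(4) integrable_arc by blast
    qed
    then show "arc_integrable (\<lambda>\<phi>. ln (circle_dist r \<phi>) * arc_weight r \<phi>)"
      "arc_integral (\<lambda>\<phi>. ln (circle_dist r \<phi>) * arc_weight r \<phi>) = arc_log_potential r r" by auto
  qed
  have h_alt: "indicator {0..pi} \<phi> * h \<phi> = 2 / pi * (indicator {0..pi} \<phi> * (ln (sin \<phi>) * arc_weight r \<phi>)) + 2 * k / pi * (indicator {0..pi} \<phi> * (cos (real 0 * \<phi>) * arc_weight r \<phi>)) + (- 2 / pi) * (indicator {0..pi} \<phi> * (ln (circle_dist r \<phi>) * arc_weight r \<phi>))" for \<phi>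
    by (simp add: h_def algebra_simps)
  have int: "arc_integrable h"
    unfolding h_alt using i d(1) by (intro Bochner_Integration.integrable_add integrable_mult_right)
  have "arc_integral h = 2 / pi * arc_integral (\<lambda>\<phi>. ln (sin \<phi>) * arc_weight r \<phi>) + 2 * k / pi * arc_integral (\<lambda>\<phi>. cos (real 0 * \<phi>) * arc_weight r \<phi>) 
       + (- 2 / pi) * arc_integral (\<lambda>\<phi>. ln (circle_dist r \<phi>) * arc_weight r \<phi>)"
    unfolding arc_integral_def h_alt using i d(1) by simp
  also have "\<dots> = k - ln 2 + (arc_log_potential 1 r + arc_log_potential (- 1) r) / pi - 2 / pi * arc_log_potential r r"
    unfolding arc_integral_log_sin[OF r(4)] c0 d(2) by (simp add: field_simps)
  also have "(arc_log_potential 1 r + arc_log_potential (- 1) r) / pi = - ((1 - r\<^sup>2) / r\<^sup>2) * (ln (1 - r\<^sup>2) / 2)"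
  proof (cases "r = 1")
    case False
    then have "0 < 1 - r" "0 < 1 + r" using r by auto
    then have "ln (1 - r\<^sup>2) = ln (1 - r) + ln (1 + r)"
      by (subst ln_mult_pos[symmetric]) (auto simp: power2_eq_square algebra_simps)
    then show ?thesis using r(1) by (simp add: arc_log_potential_def log_tail_def field_simps)
  qed (simp add: arc_log_potential_def)
  also have "2 / pi * arc_log_potential r r = - 1 - ((1 - r\<^sup>2) / r\<^sup>2) * ln (1 - r\<^sup>2)"
    using r(1) by (simp add: arc_log_potential_def log_tail_def power2_eq_square[symmetric] field_simps)
  also have "(1 - r\<^sup>2) / r\<^sup>2 = \<theta> - 1" using \<theta> by (simp add: r(3) field_simps)
  also have "k - ln 2 + - (\<theta> - 1) * (ln (1 - r\<^sup>2) / 2) - (- 1 - (\<theta> - 1) * ln (1 - r\<^sup>2)) = 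
     1 - ln (2 * pi) + (\<theta> - 1) / 2 * ln (\<theta> - 1) - (\<theta> - 2) / 2 * ln \<theta>"
  proof -
    have "k = ln \<theta> / 2 - ln pi" using \<theta> r(1) by (simp add: k_def ln_div ln_mult lnr)
    moreover have "(\<theta> - 1) * ln (1 - r\<^sup>2) = (\<theta> - 1) * (ln (\<theta> - 1) - ln \<theta>)"
    proof (cases "\<theta> = 1")
      case False
      then have "1 - r\<^sup>2 = (\<theta> - 1) / \<theta>" using \<theta> by (simp add: r(3) field_simps)
      then show ?thesis using False \<theta> by (simp add: ln_div)
    qed simp
    ultimately show ?thesis by (simp add: ln_mult field_simps)
  qed
  finally have val: "arc_integral h = 1 - ln (2 * pi) + (\<theta> - 1) / 2 * ln (\<theta> - 1) - (\<theta> - 2) / 2 * ln \<theta>" .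
  have ends: "c_minus \<theta> = (1 + r\<^sup>2) - 2 * r" "c_plus \<theta> = (1 + r\<^sup>2) + 2 * r"
    using \<theta> by (simp_all add: c_minus_def c_plus_def r_def power2_eq_square field_simps)
  have "(LINT x:{(1 + r\<^sup>2) - 2 * r..(1 + r\<^sup>2) + 2 * r}|lborel. \<rho>_L \<theta> x * ln (\<rho>_L \<theta> x)) = arc_integral h"
  proof (rule integral_arc_substitution[OF _ _ _ int])
    show "(\<lambda>x. \<rho>_L \<theta> x * ln (\<rho>_L \<theta> x)) \<in> borel_measurable borel" unfolding \<rho>_L_def by measurable
    fix \<phi> :: real assume \<phi>: "0 < \<phi>" "\<phi> < pi"
    have s: "sin \<phi> > 0" using \<phi> by (rule sin_gt_zero)
    define D where "D = circle_dist r \<phi>"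
    have D: "D > 0" unfolding D_def circle_dist_eq using s by (intro add_nonneg_pos) auto
    have x: "1 + r\<^sup>2 + 2 * r * cos \<phi> = D" by (simp add: D_def circle_dist_def)
    have "(c_plus \<theta> - D) * (D - c_minus \<theta>) = (2 * r * sin \<phi>)\<^sup>2"
      unfolding ends D_def circle_dist_def using sin_cos_squared_add[of \<phi>] by algebra
    then have "sqrt ((c_plus \<theta> - D) * (D - c_minus \<theta>)) = 2 * r * sin \<phi>" using s r(1) by (simp only: real_sqrt_abs) simp
    then have rho: "\<rho>_L \<theta> D = \<theta> * r / pi * sin \<phi> / D" by (simp add: \<rho>_L_def)
    have ln_rho: "ln (\<rho>_L \<theta> D) = k + ln (sin \<phi>) - ln D"
      unfolding rho k_def using s r(1) \<theta> D by (simp add: ln_div ln_mult)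
    have w: "arc_weight r \<phi> = (sin \<phi>)\<^sup>2 / D" unfolding D_def using D by (intro arc_weight_eq) (simp add: D_def)
    have "2 * r * sin \<phi> * \<rho>_L \<theta> D = 2 / pi * arc_weight r \<phi>"
    proof -
      have "2 * r * sin \<phi> * \<rho>_L \<theta> D = 2 * (\<theta> * r\<^sup>2) / pi * ((sin \<phi>)\<^sup>2 / D)" unfolding rho by (simp add: power2_eq_square)
      also have "\<theta> * r\<^sup>2 = 1" using \<theta> by (simp add: r(3))
      finally show ?thesis by (simp add: w)
    qed
    then have "2 * r * sin \<phi> * (\<rho>_L \<theta> D * ln (\<rho>_L \<theta> D)) = 2 / pi * arc_weight r \<phi> * ln (\<rho>_L \<theta> D)"
      by (simp only: mult.assoc[symmetric])
    also have "\<dots> = h \<phi>" unfolding ln_rho h_def D_def[symmetric] by (simp add: field_simps)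
    finally show "2 * r * sin \<phi> * (\<rho>_L \<theta> (1 + r\<^sup>2 + 2 * r * cos \<phi>) * ln (\<rho>_L \<theta> (1 + r\<^sup>2 + 2 * r * cos \<phi>))) = h \<phi>"
      unfolding x .
  qed (use r in simp)
  then show ?thesis using val by (simp only: S_L_def ends)
qed


section \<open>Mod-Gaussian convergence\<close>

lemma E_L_eq_mean_constant:
  assumes "\<beta> > 0" "\<theta> \<ge> 1"
  shows "E_L \<theta> \<beta> = mean_constant (\<beta> / 2) \<theta>"
  using assms unfolding E_L_def E_H_def S_H_eq S_L_eq[OF assms(2)] mean_constant_def legendre_ln_Gamma_def ell_def
  by (simp add: ln_Gamma_real_pos) (simp add: field_simps)

lemma higher_deriv_ell:
  assumes "x > 0" "j > 0"
  shows "(deriv ^^ j) ell x = Polygamma (j - 1) x"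
proof -
  have "eventually (\<lambda>y. y \<in> {0<..}) (nhds x)" using assms by (intro eventually_nhds_in_open) auto
  then have "eventually (\<lambda>y. ell y = ln_Gamma y) (nhds x)"
    by eventually_elim (simp add: ell_def ln_Gamma_real_pos)
  from higher_deriv_cong_ev[OF this refl, of j] show ?thesis
    using higher_deriv_ln_Gamma_real[OF assms(1), of j] assms by simp
qed

lemma
  assumes "\<beta> > 0"
  shows sigma_sq_eq: "sigma_sq \<beta> = \<beta> / 2 - (\<beta> / 2)\<^sup>2 * Polygamma 1 (1 + \<beta> / 2)"
    and A_const_eq: "A_const \<beta> = \<beta> / 2 + (\<beta> / 2) ^ 3 * Polygamma 2 (1 + \<beta> / 2)"
  unfolding sigma_sq_def A_const_def using assms by (simp_all add: higher_deriv_ell numeral_2_eq_2[symmetric])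

lemma sigma_sq_pos:
  assumes "\<beta> > 0"
  shows "sigma_sq \<beta> > 0"
proof -
  define b where "b = \<beta> / 2"
  have b: "b > 0" using assms by (simp add: b_def)
  have "b\<^sup>2 * Polygamma 1 (1 + b) < b\<^sup>2 * (1 / b)"
    using trigamma_less_inverse[OF b] b by (intro mult_strict_left_mono) auto
  also have "\<dots> = b" using b by (simp add: power2_eq_square)
  finally show ?thesis using sigma_sq_eq[OF assms] by (simp add: b_def)
qed

lemma laguerre_Z_eq_exp:
  assumes "b > 0" "\<theta> \<ge> 1" "n \<ge> 1"
  shows "complex_of_real (ln (laguerre_Z \<theta> n (2 * b))) = log_partition b \<theta> n 1"
proof -
  obtain P where P: "log_partition b \<theta> n 1 = of_real P" using log_partition_1(1)[OF assms(1,2)] by blast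
  have "complex_of_real (laguerre_Z \<theta> n (2 * b)) = exp (of_real P)"
    using complex_partition_eq[OF assms, of 1] complex_partition_of_real[of 1 \<theta> n "2 * b"] P by simp
  then have "laguerre_Z \<theta> n (2 * b) = exp P" unfolding exp_of_real of_real_eq_iff .
  then show ?thesis using P by simp
qed

text \<open>
  Integrate against the density: \<open>P\<close> times \<open>exp (s ln P)\<close> is \<open>exp ((1 + s) ln P)\<close> wherever the weight is positive.
  Where it is 0, the logarithm has no meaning but the density removes the point.
\<close>

lemma
  fixes M :: "'a measure" and lam :: "'a \<Rightarrow> nat \<Rightarrow> real"
  assumes \<beta>: "\<beta> > 0" and \<theta>: "\<theta> \<ge> 1" and n: "n \<ge> 1"
    and distr: "distributed M (pos_lebesgue n) lam (\<lambda>l. ennreal (laguerre_density \<theta> n \<beta> l))"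
  shows measurable_Y_L: "(\<lambda>\<omega>. Y_L \<theta> n \<beta> (lam \<omega>)) \<in> borel_measurable M"
    and integrable_exp_Y_L: "Re s > - 1 \<Longrightarrow> integrable M (\<lambda>\<omega>. exp (s * of_real (Y_L \<theta> n \<beta> (lam \<omega>))))"
    and integral_exp_Y_L: "Re s > - 1 \<Longrightarrow> (LINT \<omega>|M. exp (s * of_real (Y_L \<theta> n \<beta> (lam \<omega>)))) = exp (centred_exponent (\<beta> / 2) \<theta> n s)"
proof -
  define P where "P = pos_lebesgue n"
  define b where "b = \<beta> / 2"
  have b: "b > 0" "\<beta> = 2 * b" using \<beta> by (auto simp: b_def)
  define Z where "Z = laguerre_Z \<theta> n \<beta>"
  have Z: "Z > 0" unfolding Z_def using \<beta> \<theta> n by (rule laguerre_Z_pos)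
  have lnZ: "complex_of_real (ln Z) = log_partition b \<theta> n 1"
    unfolding Z_def b(2) using b(1) \<theta> n by (rule laguerre_Z_eq_exp)
  have [measurable]: "laguerre_weight \<theta> n \<beta> \<in> borel_measurable P" unfolding P_def by measurable
  have [measurable]: "laguerre_density \<theta> n \<beta> \<in> borel_measurable P"
    unfolding laguerre_density_def[abs_def] by measurable
  have [measurable]: "Y_L \<theta> n \<beta> \<in> borel_measurable P"
    unfolding Y_L_def[abs_def] by measurable
  have lam [measurable]: "lam \<in> M \<rightarrow>\<^sub>M P" using distributed_measurable[OF distr] by (simp add: P_def)
  show "(\<lambda>\<omega>. Y_L \<theta> n \<beta> (lam \<omega>)) \<in> borel_measurable M" by measurable
  have dens: "distr M P lam = density P (\<lambda>l. ennreal (laguerre_density \<theta> n \<beta> l))"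
    using distributed_distr_eq_density[OF distr] by (simp add: P_def)
  have nn: "AE l in P. 0 \<le> laguerre_density \<theta> n \<beta> l"
    using Z laguerre_weight_nonneg[of \<theta> n \<beta>] by (auto simp: laguerre_density_def Z_def[symmetric])
  assume s: "Re s > - 1"
  define g where "g l = exp (s * of_real (Y_L \<theta> n \<beta> l))" for l
  have [measurable]: "g \<in> borel_measurable P" unfolding g_def by measurable
  define C where "C = exp (s * of_nat n * of_real (E_L \<theta> \<beta>) - (1 + s) * of_real (ln Z))"
  have fg: "laguerre_density \<theta> n \<beta> l *\<^sub>R g l = C * (if laguerre_weight \<theta> n \<beta> l = 0 then 0 
      else exp ((1 + s) * of_real (ln (laguerre_weight \<theta> n \<beta> l))))" for l
  proof (cases "laguerre_weight \<theta> n \<beta> l = 0")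
    case False
    then have W: "laguerre_weight \<theta> n \<beta> l > 0" using laguerre_weight_nonneg[of \<theta> n \<beta> l] by simp
    have "laguerre_density \<theta> n \<beta> l = exp (ln (laguerre_weight \<theta> n \<beta> l) - ln Z)"
      using W Z by (simp add: laguerre_density_def Z_def exp_diff)
    then have "complex_of_real (laguerre_density \<theta> n \<beta> l) = exp (of_real (ln (laguerre_weight \<theta> n \<beta> l)) - of_real (ln Z))"
      by (simp add: exp_of_real flip: of_real_diff)
    moreover have Y: "Y_L \<theta> n \<beta> l = ln (laguerre_weight \<theta> n \<beta> l) - ln Z + real n * E_L \<theta> \<beta>"
      using W Z by (simp add: Y_L_def laguerre_density_def Z_def ln_div)
    ultimately show ?thesis using False
      by (simp only: g_def C_def Y scaleR_conv_of_real mult_exp_exp if_False) (simp add: algebra_simps)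
  qed (simp add: laguerre_density_def)
  have int: "integrable P (\<lambda>l. laguerre_density \<theta> n \<beta> l *\<^sub>R g l)"
    unfolding fg P_def using assms s
    by (intro integrable_mult_right integrable_complex_power integrable_laguerre_weight_powr laguerre_weight_nonneg measurable_laguerre_weight) auto
  have "integrable (distr M P lam) g" unfolding dens using int nn by (subst integrable_density) auto
  from integrable_distr[OF lam this] show "integrable M (\<lambda>\<omega>. exp (s * of_real (Y_L \<theta> n \<beta> (lam \<omega>))))"
    by (simp add: g_def)
  have "(LINT \<omega>|M. g (lam \<omega>)) = (LINT l|P. laguerre_density \<theta> n \<beta> l *\<^sub>R g l)"
  proof -
    have "(LINT \<omega>|M. g (lam \<omega>)) = integral\<^sup>L (density P (\<lambda>l. ennreal (laguerre_density \<theta> n \<beta> l))) g"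
      using integral_distr[OF lam, of g] dens by simp
    also have "\<dots> = (LINT l|P. laguerre_density \<theta> n \<beta> l *\<^sub>R g l)"
      using nn by (intro integral_density) auto
    finally show ?thesis .
  qed
  also have "\<dots> = C * complex_partition \<theta> n \<beta> (1 + s)"
    unfolding fg complex_partition_def P_def by simp
  also have "complex_partition \<theta> n \<beta> (1 + s) = exp (log_partition b \<theta> n (1 + s))"
    unfolding b(2) using b \<theta> n s by (intro complex_partition_eq) auto
  also have "C * \<dots> = exp (centred_exponent b \<theta> n s)"
    unfolding C_def lnZ centred_exponent_def E_L_eq_mean_constant[OF \<beta> \<theta>] b_def[symmetric] mult_exp_exp
    by (simp add: algebra_simps)
  finally show "(LINT \<omega>|M. exp (s * of_real (Y_L \<theta> n \<beta> (lam \<omega>)))) = exp (centred_exponent (\<beta> / 2) \<theta> n s)"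
    by (simp add: g_def b_def)
qed

lemma uniform_limit_exp_bounded:
  fixes f :: "nat \<Rightarrow> 'b \<Rightarrow> complex"
  assumes lim: "uniform_limit S f g sequentially" and g: "\<And>z. z \<in> S \<Longrightarrow> norm (g z) \<le> B"
  shows "uniform_limit S (\<lambda>n z. exp (f n z)) (\<lambda>z. exp (g z)) sequentially"
proof -
  have "uniform_limit S (\<lambda>n z. exp (f n z)) (exp \<circ> g) sequentially"
  proof (rule uniform_limit_compose[OF lim])
    show "uniformly_continuous_on (cball 0 (B + 1)) (exp :: complex \<Rightarrow> complex)"
      by (intro compact_uniformly_continuous continuous_intros) auto
    show "g ` S \<subseteq> cball 0 (B + 1)" 
    proof safe
      fix z assume "z \<in> S"
      then show "g z \<in> cball 0 (B + 1)" using g[of z] by simp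
    qed
    have "\<forall>\<^sub>F n in sequentially. \<forall>z\<in>S. dist (f n z) (g z) < 1" using lim by (rule uniform_limitD) simp
    then show "\<forall>\<^sub>F n in sequentially. f n ` S \<subseteq> cball 0 (B + 1)"
    proof eventually_elim
      case (elim n)
      show ?case
      proof safe
        fix z assume z: "z \<in> S"
        have "norm (f n z) \<le> norm (f n z - g z) + norm (g z)" by (metis diff_add_cancel norm_triangle_ineq)
        then show "f n z \<in> cball 0 (B + 1)" using elim z g[OF z] by (force simp: dist_norm)
      qed
    qed
  qed
  then show ?thesis by (simp add: o_def)
qed

theorem theorem5p6:
  fixes \<beta> \<theta> :: real
    and M :: "nat \<Rightarrow> 'a measure"
    and lam :: "nat \<Rightarrow> 'a \<Rightarrow> (nat \<Rightarrow> real)"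
  assumes "\<beta> > 0" and "\<theta> \<ge> 1"
    and "\<And>n. n \<ge> 1 \<Longrightarrow> prob_space (M n)"
    and "\<And>n. n \<ge> 1 \<Longrightarrow>
      distributed (M n) (pos_lebesgue n) (lam n) (\<lambda>l. ennreal (laguerre_density \<theta> n \<beta> l))"
  shows "mod_Gaussian_convergent M
      (\<lambda>n \<omega>. real n powr (- 1 / 3) * Y_L \<theta> n \<beta> (lam n \<omega>))
      (- 1) \<infinity>
      (\<lambda>n. real n powr (1 / 3) * sigma_sq \<beta>)
      (\<lambda>z. exp (- (of_real (A_const \<beta>) * z ^ 3 / 6)))"
proof -
  have strip: "z \<in> strip (- 1) \<infinity> \<longleftrightarrow> - 1 < Re z" for z
  proof -
    have "(- 1 :: ereal) = ereal (- 1)" by (simp add: one_ereal_def)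
    then show ?thesis unfolding strip_def by simp
  qed
  have Re_scaled: "- 1 < Re (z * of_real (real n powr (- 1 / 3)))" if z: "- 1 < Re z" and n: "n \<ge> 1" for z n
  proof -
    have N: "0 < real n powr (- 1 / 3)" "real n powr (- 1 / 3) \<le> 1" using n powr_mono[of "- 1 / 3" 0 "real n"] by auto
    show ?thesis
    proof (cases "Re z \<ge> 0")
      case True
      then have "0 \<le> Re z * real n powr (- 1 / 3)" using N by simp
      then show ?thesis by simp
    next
      case False
      then have "Re z * 1 \<le> Re z * real n powr (- 1 / 3)" using N by (intro mult_left_mono_neg) auto
      then show ?thesis using z by simp
    qed
  qed
  have resc: "exp (z * of_real (real n powr (- 1 / 3) * y)) = exp (z * of_real (real n powr (- 1 / 3)) * of_real y)" for z :: complex and n y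
    by (simp add: mult_ac)
  have mgf_eq: "mgf (M n) (\<lambda>\<omega>. real n powr (- 1 / 3) * Y_L \<theta> n \<beta> (lam n \<omega>)) z = 
     exp (centred_exponent (\<beta> / 2) \<theta> n (z * of_real (real n powr (- 1 / 3))))" if "- 1 < Re z" "n \<ge> 1" for z n
    unfolding mgf_def resc using assms(1,2) that by (intro integral_exp_Y_L[OF _ _ _ assms(4)] Re_scaled)
  show ?thesis unfolding mod_Gaussian_convergent_def
  proof (intro conjI allI impI ballI)
    fix n :: nat assume n: "n \<ge> 1"
    show "prob_space (M n)" using assms(3) n .
    show "(\<lambda>\<omega>. real n powr (- 1 / 3) * Y_L \<theta> n \<beta> (lam n \<omega>)) \<in> borel_measurable (M n)"
      using measurable_Y_L[OF assms(1,2) n assms(4)[OF n]] by measurable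
    fix z assume "z \<in> strip (- 1) \<infinity>"
    then show "mgf_exists (M n) (\<lambda>\<omega>. real n powr (- 1 / 3) * Y_L \<theta> n \<beta> (lam n \<omega>)) z"
      unfolding mgf_exists_def resc strip using assms(1,2) n by (intro integrable_exp_Y_L[OF _ _ _ assms(4)] Re_scaled)
  next
    show "filterlim (\<lambda>n. real n powr (1 / 3) * sigma_sq \<beta>) at_top sequentially"
      using sigma_sq_pos[OF assms(1)] by real_asymp
    show "(\<lambda>z. exp (- (of_real (A_const \<beta>) * z ^ 3 / 6))) analytic_on strip (- 1) \<infinity>"
      by (intro analytic_intros) auto
    show "locally_uniform_limit (strip (- 1) \<infinity>)
       (\<lambda>n z. mgf (M n) (\<lambda>\<omega>. real n powr (- 1 / 3) * Y_L \<theta> n \<beta> (lam n \<omega>)) z * exp (- (of_real (real n powr (1 / 3) * sigma_sq \<beta>) * z\<^sup>2 / 2)))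
       (\<lambda>z. exp (- (of_real (A_const \<beta>) * z ^ 3 / 6)))"
      unfolding locally_uniform_limit_def
    proof (intro ballI exI[of _ 1] conjI)
      fix z0 :: complex
      define S where "S = strip (- 1) \<infinity> \<inter> ball z0 1"
      have S: "bounded S" unfolding S_def by (rule bounded_subset[OF bounded_ball]) auto
      then obtain \<rho> where \<rho>: "\<And>z. z \<in> S \<Longrightarrow> norm z \<le> \<rho>" by (auto simp: bounded_iff)
      have "norm (- (of_real (A_const \<beta>) * z ^ 3 / 6)) \<le> \<bar>A_const \<beta>\<bar> * \<rho> ^ 3 / 6" if "z \<in> S" for z
        using \<rho>[OF that] by (simp add: norm_mult norm_power norm_divide mult_left_mono power_mono divide_right_mono)
      moreover have "uniform_limit S (\<lambda>n z. centred_exponent (\<beta> / 2) \<theta> n (z * of_real (real n powr (- 1 / 3))) - of_real (real n powr (1 / 3) * sigma_sq \<beta>) * z\<^sup>2 / 2)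
          (\<lambda>z. - (of_real (A_const \<beta>) * z ^ 3 / 6)) sequentially"
        using centred_exponent_uniform_limit[of "\<beta> / 2" \<theta> S] assms(1,2) S
        unfolding sigma_sq_eq[OF assms(1)] A_const_eq[OF assms(1)] by simp
      ultimately have lim: "uniform_limit S (\<lambda>n z. exp (centred_exponent (\<beta> / 2) \<theta> n (z * of_real (real n powr (- 1 / 3))) - of_real (real n powr (1 / 3) * sigma_sq \<beta>) * z\<^sup>2 / 2))
          (\<lambda>z. exp (- (of_real (A_const \<beta>) * z ^ 3 / 6))) sequentially"
        by (intro uniform_limit_exp_bounded[where B = "\<bar>A_const \<beta>\<bar> * \<rho> ^ 3 / 6"])
      have eq: "\<forall>\<^sub>F n in sequentially. \<forall>z\<in>S. exp (centred_exponent (\<beta> / 2) \<theta> n (z * of_real (real n powr (- 1 / 3))) - of_real (real n powr (1 / 3) * sigma_sq \<beta>) * z\<^sup>2 / 2) =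
         mgf (M n) (\<lambda>\<omega>. real n powr (- 1 / 3) * Y_L \<theta> n \<beta> (lam n \<omega>)) z * exp (- (of_real (real n powr (1 / 3) * sigma_sq \<beta>) * z\<^sup>2 / 2))"
        using eventually_ge_at_top[of 1]
      proof eventually_elim
        case (elim n)
        show ?case
        proof
          fix z assume "z \<in> S"
          then have "- 1 < Re z" by (auto simp: S_def strip)
          from mgf_eq[OF this elim] show "exp (centred_exponent (\<beta> / 2) \<theta> n (z * of_real (real n powr (- 1 / 3))) - of_real (real n powr (1 / 3) * sigma_sq \<beta>) * z\<^sup>2 / 2) =
             mgf (M n) (\<lambda>\<omega>. real n powr (- 1 / 3) * Y_L \<theta> n \<beta> (lam n \<omega>)) z * exp (- (of_real (real n powr (1 / 3) * sigma_sq \<beta>) * z\<^sup>2 / 2))"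
            by (simp add: mult_exp_exp)
        qed
      qed
      show "uniform_limit (strip (- 1) \<infinity> \<inter> ball z0 1) (\<lambda>n z. mgf (M n) (\<lambda>\<omega>. real n powr (- 1 / 3) * Y_L \<theta> n \<beta> (lam n \<omega>)) z * exp (- (of_real (real n powr (1 / 3) * sigma_sq \<beta>) * z\<^sup>2 / 2)))
        (\<lambda>z. exp (- (of_real (A_const \<beta>) * z ^ 3 / 6))) sequentially"
        using lim unfolding S_def[symmetric] by (subst (asm) uniform_limit_cong[OF eq]) auto
    qed auto
  qed auto
qed

end
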